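(* The set of forbidden induced minors for the class $\mathcal{M}_2$ is $\{M(K_4),U_{3,4}\}$; that is, a simple binary matroid is in $\mathcal{M}_2$ if and only if it has neither $M(K_4)$ nor $U_{3,4}$ as an induced minor, and each of $M(K_4)$, $U_{3,4}$ is a binary matroid not in $\mathcal{M}_2$ all of whose proper induced minors are in $\mathcal{M}_2$.
   Context: All matroids are simple; every contraction of a set is immediately followed by simplification. For matroids $M_1,M_2$ whose ground sets meet in a set $T$ that is a modular flat of $M_1$ with $M_1|T=M_2|T=N$, the generalized parallel connection $P_N(M_1,M_2)$ is the matroid on $E(M_1)\cup E(M_2)$ whose flats are the sets $X$ with $X\cap E(M_i)$ a flat of $M_i$ for $i=1,2$ (if $T=\emptyset$ this is $M_1\oplus M_2$). $\mathcal{M}_q$ is the class of matroids that can be built from projective geometries over $GF(q)$ by a sequence of generalized parallel connections across projective geometries over $GF(q)$. An induced minor of a matroid $M$ is a matroid obtained from $M$ by a sequence of restrictions to flats and contractions (each contraction followed by simplification). A forbidden induced minor for $\mathcal{M}_q$ is a $GF(q)$-representable matroid not in $\mathcal{M}_q$ all of whose proper induced minors are in $\mathcal{M}_q$. *)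

theory Defs
  imports Main "HOL.Vector_Spaces" "HOL-Library.Z2" "HOL-Library.Function_Algebras"
begin

text \<open>A matroid is a pair (ground set, rank function); only the values of the
rank function on subsets of the ground set matter.\<close>

type_synonym 'a matroid = "'a set \<times> ('a set \<Rightarrow> nat)"

definition ground :: "'a matroid \<Rightarrow> 'a set" where "ground M = fst M"
definition rk :: "'a matroid \<Rightarrow> 'a set \<Rightarrow> nat" where "rk M = snd M"

definition matroid :: "'a matroid \<Rightarrow> bool" where
  "matroid M \<longleftrightarrow> finite (ground M)
    \<and> (\<forall>X. X \<subseteq> ground M \<longrightarrow> rk M X \<le> card X)
    \<and> (\<forall>X Y. X \<subseteq> Y \<and> Y \<subseteq> ground M \<longrightarrow> rk M X \<le> rk M Y)
    \<and> (\<forall>X Y. X \<subseteq> ground M \<and> Y \<subseteq> ground M \<longrightarrow>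
         rk M (X \<union> Y) + rk M (X \<inter> Y) \<le> rk M X + rk M Y)"

definition simple :: "'a matroid \<Rightarrow> bool" where
  "simple M \<longleftrightarrow> matroid M \<and> (\<forall>e\<in>ground M. rk M {e} = 1)
     \<and> (\<forall>e\<in>ground M. \<forall>f\<in>ground M. e \<noteq> f \<longrightarrow> rk M {e, f} = 2)"

definition flat :: "'a matroid \<Rightarrow> 'a set \<Rightarrow> bool" where
  "flat M F \<longleftrightarrow> F \<subseteq> ground M \<and> (\<forall>e\<in>ground M - F. rk M (insert e F) = rk M F + 1)"

definition modular_flat :: "'a matroid \<Rightarrow> 'a set \<Rightarrow> bool" where
  "modular_flat M F \<longleftrightarrow> flat M F \<and>
     (\<forall>G. flat M G \<longrightarrow> rk M F + rk M G = rk M (F \<union> G) + rk M (F \<inter> G))"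

definition restrict :: "'a matroid \<Rightarrow> 'a set \<Rightarrow> 'a matroid" where
  "restrict M X = (X, \<lambda>Y. rk M (Y \<inter> X))"

definition contract :: "'a matroid \<Rightarrow> 'a set \<Rightarrow> 'a matroid" where
  "contract M C = (ground M - C, \<lambda>Y. rk M ((Y \<inter> (ground M - C)) \<union> C) - rk M C)"

definition isomorphic :: "'a matroid \<Rightarrow> 'b matroid \<Rightarrow> bool" where
  "isomorphic M N \<longleftrightarrow> (\<exists>f. bij_betw f (ground M) (ground N)
      \<and> (\<forall>X. X \<subseteq> ground M \<longrightarrow> rk N (f ` X) = rk M X))"

definition nonloops :: "'a matroid \<Rightarrow> 'a set" where
  "nonloops M = {e \<in> ground M. rk M {e} \<noteq> 0}"

text \<open>S is a set of representatives of the parallel classes of the non-loops;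
  the simplification of M is (up to isomorphism) the restriction of M to S.\<close>
definition simplification_set :: "'a matroid \<Rightarrow> 'a set \<Rightarrow> bool" where
  "simplification_set M S \<longleftrightarrow> S \<subseteq> nonloops M \<and>
     (\<forall>e\<in>nonloops M. \<exists>!s. s \<in> S \<and> rk M {e, s} = 1)"

definition induced_minor_step :: "'a matroid \<Rightarrow> 'a matroid \<Rightarrow> bool" where
  "induced_minor_step M N \<longleftrightarrow>
     (\<exists>F. flat M F \<and> N = restrict M F) \<or>
     (\<exists>C S. C \<subseteq> ground M \<and> simplification_set (contract M C) S
            \<and> N = restrict (contract M C) S)"

definition has_induced_minor :: "'a matroid \<Rightarrow> 'b matroid \<Rightarrow> bool" where
  "has_induced_minor M K \<longleftrightarrow> (\<exists>N. induced_minor_step\<^sup>*\<^sup>* M N \<and> isomorphic N K)"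

definition proper_induced_minor :: "'a matroid \<Rightarrow> 'a matroid \<Rightarrow> bool" where
  "proper_induced_minor M N \<longleftrightarrow> induced_minor_step\<^sup>*\<^sup>* M N \<and> card (ground N) < card (ground M)"

definition scl :: "'F::field \<Rightarrow> (nat \<Rightarrow> 'F) \<Rightarrow> (nat \<Rightarrow> 'F)" where
  "scl c v = (\<lambda>i. c * v i)"

definition vrank :: "(nat \<Rightarrow> 'F::field) set \<Rightarrow> nat" where
  "vrank V = vector_space.dim scl V"

definition representable :: "'F::field itself \<Rightarrow> 'a matroid \<Rightarrow> bool" where
  "representable _ M \<longleftrightarrow> matroid M \<and> (\<exists>\<phi> :: 'a \<Rightarrow> (nat \<Rightarrow> 'F).
      \<forall>X. X \<subseteq> ground M \<longrightarrow> rk M X = vrank (\<phi> ` X))"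

abbreviation binary :: "'a matroid \<Rightarrow> bool" where
  "binary M \<equiv> representable TYPE(bit) M"

text \<open>PG(n-1,F): points are the 1-dimensional subspaces of F^n.\<close>
definition PG :: "'F::field itself \<Rightarrow> nat \<Rightarrow> (nat \<Rightarrow> 'F) set matroid" where
  "PG _ n = ({module.span scl {v} | v :: nat \<Rightarrow> 'F. v \<noteq> 0 \<and> (\<forall>i\<ge>n. v i = 0)},
             \<lambda>X. vrank (\<Union>X))"

definition is_PG :: "'F::field itself \<Rightarrow> 'a matroid \<Rightarrow> bool" where
  "is_PG T N \<longleftrightarrow> (\<exists>n. isomorphic N (PG T n))"

text \<open>P is the generalized parallel connection of M1 and M2 (across T = E1 \<inter> E2):
  the matroid on E1 \<union> E2 whose flats are the X with X \<inter> Ei a flat of Mi.\<close>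
definition is_gpc :: "'a matroid \<Rightarrow> 'a matroid \<Rightarrow> 'a matroid \<Rightarrow> bool" where
  "is_gpc P M1 M2 \<longleftrightarrow> matroid P \<and> ground P = ground M1 \<union> ground M2 \<and>
     (\<forall>X. X \<subseteq> ground P \<longrightarrow>
        (flat P X \<longleftrightarrow> flat M1 (X \<inter> ground M1) \<and> flat M2 (X \<inter> ground M2)))"

inductive Mq_nat :: "'F::field itself \<Rightarrow> nat matroid \<Rightarrow> bool" for T :: "'F itself" where
  pg: "is_PG T M \<Longrightarrow> Mq_nat T M"
| iso: "Mq_nat T M \<Longrightarrow> isomorphic M M' \<Longrightarrow> Mq_nat T M'"
| gpc: "Mq_nat T M1 \<Longrightarrow> Mq_nat T M2 \<Longrightarrow>
        modular_flat M1 (ground M1 \<inter> ground M2) \<Longrightarrow>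
        restrict M1 (ground M1 \<inter> ground M2) = restrict M2 (ground M1 \<inter> ground M2) \<Longrightarrow>
        is_PG T (restrict M1 (ground M1 \<inter> ground M2)) \<Longrightarrow>
        is_gpc P M1 M2 \<Longrightarrow> Mq_nat T P"

definition in_Mq :: "'F::field itself \<Rightarrow> 'a matroid \<Rightarrow> bool" where
  "in_Mq T M \<longleftrightarrow> (\<exists>M' :: nat matroid. Mq_nat T M' \<and> isomorphic M M')"

abbreviation in_M2 :: "'a matroid \<Rightarrow> bool" where
  "in_M2 M \<equiv> in_Mq TYPE(bit) M"

definition forbidden_induced_minor :: "'F::field itself \<Rightarrow> 'a matroid \<Rightarrow> bool" where
  "forbidden_induced_minor T M \<longleftrightarrow> simple M \<and> representable T M \<and> \<not> in_Mq T M \<and>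
     (\<forall>N. proper_induced_minor M N \<longrightarrow> in_Mq T N)"

definition U34 :: "nat matroid" where
  "U34 = ({0..<4}, \<lambda>X. min (card X) 3)"

text \<open>Cycle matroid of K4: edges are 2-subsets of {0..3}; rank = |V| - #components.\<close>
definition K4_components :: "nat set set \<Rightarrow> nat set set" where
  "K4_components X = (let R = {(a, b). {a, b} \<in> X} in
     {{w \<in> {0..<4}. (v, w) \<in> (R \<union> R\<inverse>)\<^sup>*} | v. v \<in> {0..<(4::nat)}})"

definition MK4 :: "nat set matroid" where
  "MK4 = ({{a, b} | a b. a < 4 \<and> b < 4 \<and> a \<noteq> b},
          \<lambda>X. 4 - card (K4_components X))"

end

theory Submission
  imports Defs
begin

text \<open>
  A simple binary matroid is a finite set \<open>E\<close> of nonzero vectors over the two-element field,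
  where a subspace is just an additive subgroup; flats are intersections with subspaces
  and simplified contractions are images under linear maps.  Membership in \<open>M\<^sub>2\<close> means that
  \<open>E\<close> is a punctured subspace, or \<open>E \<subseteq> X \<union> Y\<close> for subspaces whose intersection is contained
  in \<open>E \<union> {0}\<close>, with both parts again in the class.

  As in Dirac's theorem on chordal graphs, the key point is that for \<open>e, f \<in> E\<close> with
  \<open>e + f \<notin> E\<close> every inclusion-minimal separator \<open>U = X \<inter> Y\<close> of \<open>e\<close> from \<open>f\<close> is complete.  By
  induction \<open>U\<close> becomes complete after contracting any element of \<open>E \<inter> U\<close>, which leaves two
  possible failures.  If \<open>E \<inter> U\<close> is empty, a shortest coincidence of a sum on one side with a
  sum on the other gives a circuit that contracts to \<open>U\<^sub>3\<^sub>,\<^sub>4\<close>.  If \<open>U = {0, a, b, a + b}\<close> with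
  \<open>a + b \<notin> E\<close>, a minimal separator of \<open>a\<close> from \<open>b\<close> is of the same kind, say with elements
  \<open>x, y\<close>; then \<open>a, x, b, y\<close> lie around a four-cycle of subspaces, and linking consecutive ones
  by circuits again gives \<open>U\<^sub>3\<^sub>,\<^sub>4\<close>.

  Conversely the class is closed under induced minors, and contains neither excluded plane.
  Abstract generalized parallel connections are represented by amalgamating the two vector
  representations along their common projective geometry.
\<close>

subsection \<open>Binary vectors\<close>

text \<open>Both excluded planes are caught by one pattern: a missing point \<open>n\<close>, two
  pairs of elements with difference \<open>n\<close>, and a third such pair lying wholly inside or
  wholly outside \<open>E\<close>. Hence a set that is invariant under translation by a missing
  vector contains at most one such pair. This remark is used twice: it starts the construction of
  separations, and it limits how a minimal separator can fail to be complete.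
  \<open>bad_free\<close> looks at a single contraction only. That is enough because contractions
  compose, and because they commute with passing to a subspace that contains the contracted
  elements. The obstacle compared with graphs is that a separator of a graph consists of vertices,
  whereas \<open>X \<inter> Y\<close> may a priori contain vectors that have nothing to do with
  elements of \<open>E\<close>. Paths through a separator are therefore replaced by sums of few
  elements of one side, and being joined by a path by \<open>linked\<close>, which asks for a common
  line after some contraction. Minimality of separators enters by rebuilding one side from spans or
  direct summands and comparing intersections.\<close>

type_synonym bvec = "nat \<Rightarrow> bit"

interpretation bv: vector_space "scl :: bit \<Rightarrow> bvec \<Rightarrow> bvec"
  by unfold_locales (auto simp: scl_def fun_eq_iff algebra_simps)

abbreviation span :: "bvec set \<Rightarrow> bvec set" where "span \<equiv> bv.span"
abbreviation subspace :: "bvec set \<Rightarrow> bool" where "subspace \<equiv> bv.subspace"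

lemma bvec_add_self [simp]: "(x::bvec) + x = 0"
  by (simp add: fun_eq_iff)

lemma bvec_add_self_left [simp]: "(x::bvec) + (x + y) = y"
  by (simp add: add.assoc[symmetric])

lemma bvec_add_eq_iff: "(x::bvec) + y = z \<longleftrightarrow> y = x + z"
  by (metis bvec_add_self_left)

lemma bvec_add_eq_0_iff [simp]: "(x::bvec) + y = 0 \<longleftrightarrow> x = y"
  by (metis add.right_neutral bvec_add_self_left)

lemmas bvec_ac = add.assoc add.commute add.left_commute

lemma bit_scl: "scl (c::bit) v = (if c = 0 then 0 else v)"
  by (cases c) (auto simp: scl_def fun_eq_iff)

lemma subspace_iff: "subspace S \<longleftrightarrow> 0 \<in> S \<and> (\<forall>x\<in>S. \<forall>y\<in>S. x + y \<in> S)"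
  by (auto simp: bv.subspace_def bit_scl)

lemma subspace_0: "subspace S \<Longrightarrow> 0 \<in> S"
  by (simp add: subspace_iff)

lemma subspace_add: "subspace S \<Longrightarrow> x \<in> S \<Longrightarrow> y \<in> S \<Longrightarrow> x + y \<in> S"
  by (simp add: subspace_iff)

lemma subspace_add_iff: "subspace S \<Longrightarrow> x \<in> S \<Longrightarrow> x + y \<in> S \<longleftrightarrow> y \<in> S"
  by (metis bvec_add_self_left subspace_add)

lemma subspace_add_iff': "subspace S \<Longrightarrow> x \<in> S \<Longrightarrow> y + x \<in> S \<longleftrightarrow> y \<in> S"
  by (metis add.commute subspace_add_iff)

lemma span_insert: "x \<in> span (insert a A) \<longleftrightarrow> x \<in> span A \<or> x + a \<in> span A"
proof -
  have "x \<in> span (insert a A) \<longleftrightarrow> (\<exists>k. x - scl k a \<in> span A)"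
    by (rule bv.span_breakdown_eq)
  also have "\<dots> \<longleftrightarrow> x - scl 0 a \<in> span A \<or> x - scl 1 a \<in> span A"
    by (metis bit_not_zero_iff)
  also have "x - scl 0 a = x" by (simp add: bit_scl)
  also have "x - scl 1 a = x + a"
    by (auto simp: bit_scl fun_eq_iff)
  finally show ?thesis .
qed

lemma span_insert_eq: "span (insert a A) = span A \<union> (\<lambda>x. x + a) ` span A"
proof -
  have "x + a \<in> span A \<longleftrightarrow> x \<in> (\<lambda>x. x + a) ` span A" for x
    by (metis (no_types, lifting) add.commute bvec_add_self_left image_iff)
  then show ?thesis by (intro set_eqI) (simp add: span_insert)
qed

lemma finite_span: "finite A \<Longrightarrow> finite (span A)"
  by (induction rule: finite_induct) (auto simp: span_insert_eq)

lemma span_add_iff: "x \<in> span A \<Longrightarrow> x + y \<in> span A \<longleftrightarrow> y \<in> span A"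
  by (rule subspace_add_iff[OF bv.subspace_span])

lemma span_add: "x \<in> span A \<Longrightarrow> y \<in> span A \<Longrightarrow> x + y \<in> span A"
  by (rule subspace_add[OF bv.subspace_span])

lemma span_subspace: "subspace U \<Longrightarrow> span U = U"
  by (simp add: bv.span_eq_iff)

lemma span_subset: "A \<subseteq> W \<Longrightarrow> subspace W \<Longrightarrow> span A \<subseteq> W"
  by (rule bv.span_minimal)

lemma span_diff_0: "span (A - {0}) = span A"
  by (rule bv.span_delete_0)

section \<open>Additive maps, spans and kernels\<close>

definition additive :: "(bvec \<Rightarrow> bvec) \<Rightarrow> bool" where
  "additive f \<longleftrightarrow> (\<forall>x y. f (x + y) = f x + f y)"

lemma additiveD: "additive f \<Longrightarrow> f (x + y) = f x + f y"
  by (simp add: additive_def)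

lemma additive_0: "additive f \<Longrightarrow> f 0 = 0"
  by (metis additiveD bvec_add_self)

lemma additive_comp: "additive f \<Longrightarrow> additive g \<Longrightarrow> additive (f \<circ> g)"
  by (simp add: additive_def)

lemma additive_id: "additive (\<lambda>x. x)"
  by (simp add: additive_def)

lemma additive_eq_iff: "additive f \<Longrightarrow> f x = f y \<longleftrightarrow> f (x + y) = 0"
  by (simp only: additiveD bvec_add_eq_0_iff)

lemma subspace_image:
  assumes f: "additive f" and S: "subspace S" shows "subspace (f ` S)"
  unfolding subspace_iff
proof (intro conjI ballI)
  show "0 \<in> f ` S" using additive_0[OF f] subspace_0[OF S] by (metis imageI)
  fix x y assume "x \<in> f ` S" "y \<in> f ` S"
  then obtain u v where "x = f u" "y = f v" "u \<in> S" "v \<in> S" by blast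
  then show "x + y \<in> f ` S"
    using additiveD[OF f, of u v] subspace_add[OF S] by (metis imageI)
qed

lemma subspace_vimage:
  assumes f: "additive f" and S: "subspace S" shows "subspace (f -` S)"
  unfolding subspace_iff
proof (intro conjI ballI)
  show "0 \<in> f -` S" using additive_0[OF f] subspace_0[OF S] by auto
  fix x y assume "x \<in> f -` S" "y \<in> f -` S"
  then show "x + y \<in> f -` S"
    using additiveD[OF f, of x y] subspace_add[OF S] by (metis vimageD vimageI)
qed

lemma span_image: "additive f \<Longrightarrow> span (f ` A) = f ` span A"
proof (intro equalityI)
  assume f: "additive f"
  show "span (f ` A) \<subseteq> f ` span A"
    by (intro span_subset subspace_image f bv.subspace_span image_mono bv.span_superset)
  have "span A \<subseteq> f -` span (f ` A)"
    by (rule span_subset) (use f in \<open>auto intro!: subspace_vimage intro: bv.span_base\<close>)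
  then show "f ` span A \<subseteq> span (f ` A)" by auto
qed

text \<open>Pulls a question about spans in a contraction back to the original vectors: modulo the
  kernel, adjoining \<open>A\<close> to \<open>B\<close> changes nothing.\<close>

lemma mem_span_image_iff:
  assumes f: "additive f" and ker: "\<And>x. f x = 0 \<longleftrightarrow> x \<in> span A"
  shows "f x \<in> span (f ` B) \<longleftrightarrow> x \<in> span (A \<union> B)"
proof
  assume "f x \<in> span (f ` B)"
  then obtain z where z: "z \<in> span B" "f x = f z"
    using span_image[OF f] by auto
  then have "x + z \<in> span A" using additive_eq_iff[OF f] ker by metis
  then have 1: "x + z \<in> span (A \<union> B)"
    using bv.span_mono[of A "A \<union> B"] by auto
  moreover have "z \<in> span (A \<union> B)" using z(1) bv.span_mono[of B "A \<union> B"] by auto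
  ultimately show "x \<in> span (A \<union> B)" by (metis add.commute span_add_iff)
next
  assume "x \<in> span (A \<union> B)"
  then have "f x \<in> span (f ` (A \<union> B))" using span_image[OF f] by auto
  moreover have "f ` (A \<union> B) \<subseteq> span (f ` B)"
  proof -
    have "f a = 0" if "a \<in> A" for a using that ker bv.span_base by auto
    then show ?thesis using bv.span_superset bv.span_zero by fastforce
  qed
  ultimately show "f x \<in> span (f ` B)"
    using span_subset[OF _ bv.subspace_span] by blast
qed

text \<open>Clears the first coordinate at which \<open>g\<close> is nonzero, by adding
  \<open>g\<close> where necessary, so the kernel is \<open>{0, g}\<close>. For \<open>g = 0\<close>
  the \<open>LEAST\<close> is unspecified, but both branches then give the identity.\<close>

definition proj :: "bvec \<Rightarrow> bvec \<Rightarrow> bvec" where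
  "proj g v = v + (if v (LEAST i. g i \<noteq> 0) = 0 then 0 else g)"

lemma additive_proj: "additive (proj g)"
  by (auto simp: additive_def proj_def bvec_ac)

lemma proj_eq_0_iff: "proj g v = 0 \<longleftrightarrow> v = 0 \<or> v = g"
proof (cases "g = 0")
  case True
  then show ?thesis by (simp add: proj_def)
next
  case False
  then obtain i where "g i \<noteq> 0" by (auto simp: fun_eq_iff)
  then have *: "g (LEAST i. g i \<noteq> 0) \<noteq> 0" by (rule LeastI)
  show ?thesis
  proof
    assume "proj g v = 0" then show "v = 0 \<or> v = g"
      by (auto simp: proj_def split: if_splits)
  next
    assume "v = 0 \<or> v = g" then show "proj g v = 0"
      using * by (auto simp: proj_def)
  qed
qed

text \<open>Realises a quotient inside the same vector type: projections along the successive images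
  of the generators are composed, and each enlarges the kernel by one generator.\<close>

lemma exists_additive_ker:
  assumes "finite C"
  shows "\<exists>f. additive f \<and> (\<forall>x. f x = 0 \<longleftrightarrow> x \<in> span C)"
  using assms
proof (induction rule: finite_induct)
  case empty
  have "x = 0 \<longleftrightarrow> x \<in> span {}" for x by simp
  then show ?case using additive_id by blast
next
  case (insert g C)
  then obtain f where f: "additive f" "\<And>x. f x = 0 \<longleftrightarrow> x \<in> span C" by blast
  have "(proj (f g) \<circ> f) x = 0 \<longleftrightarrow> x \<in> span (insert g C)" for x
    using f by (simp add: proj_eq_0_iff span_insert additive_eq_iff)
  then show ?case using additive_comp[OF additive_proj f(1)] by blast
qed

section \<open>Rank of finite sets of vectors\<close>

lemma vrank_empty [simp]: "vrank ({} :: bvec set) = 0"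
  unfolding vrank_def by (rule bv.dim_unique[of "{}"]) (auto simp: bv.independent_empty)

lemma vrank_insert:
  fixes A :: "bvec set"
  assumes "finite A"
  shows "vrank (insert a A) = (if a \<in> span A then vrank A else Suc (vrank A))"
proof (cases "a \<in> span A")
  case True
  then have "span (insert a A) = span A" by (simp add: bv.span_redundant)
  then show ?thesis using True unfolding vrank_def by (metis bv.dim_span)
next
  case False
  obtain B where B: "B \<subseteq> A" "bv.independent B" "A \<subseteq> span B" "card B = bv.dim A"
    by (rule bv.basis_exists)
  have sp: "span B = span A"
    using B by (meson bv.span_mono bv.span_minimal bv.subspace_span subset_antisym)
  have fin: "finite B" using B assms finite_subset by blast
  have nB: "a \<notin> B" using False B bv.span_base by auto
  have "bv.dim (insert a A) = card (insert a B)"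
  proof (rule bv.dim_unique[of "insert a B"])
    show "insert a B \<subseteq> insert a A" using B by auto
    show "insert a A \<subseteq> span (insert a B)"
      using B bv.span_superset[of "insert a B"] bv.span_mono[of B "insert a B"] by auto
    show "bv.independent (insert a B)"
      using B False sp by (intro bv.independent_insertI) auto
  qed simp
  then show ?thesis using False B fin nB by (simp add: vrank_def)
qed

lemma vrank_span: "vrank (span A) = vrank (A :: bvec set)"
  by (simp add: vrank_def)

lemma vrank_span_eq: "span A = span B \<Longrightarrow> vrank A = vrank (B::bvec set)"
  by (metis vrank_span)

lemma vrank_mono:
  fixes A B :: "bvec set"
  assumes "finite B" "A \<subseteq> B" shows "vrank A \<le> vrank B"
proof -
  have "vrank A \<le> vrank (A \<union> C)" if "finite C" for C
    using that
  proof (induction rule: finite_induct)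
    case (insert c C)
    have "finite (A \<union> C)" using insert assms finite_subset by auto
    then show ?case using insert vrank_insert[of "A \<union> C" c] by auto
  qed simp
  from this[of B] show ?thesis using assms by (simp add: Un_absorb1)
qed

lemma vrank_le_card:
  fixes A :: "bvec set" shows "finite A \<Longrightarrow> vrank A \<le> card A"
  by (induction rule: finite_induct) (auto simp: vrank_insert)

lemma vrank_submodular:
  fixes A B :: "bvec set"
  assumes "finite A" "finite B"
  shows "vrank (A \<union> B) + vrank (A \<inter> B) \<le> vrank A + vrank B"
proof -
  have "vrank (A \<union> C) + vrank D \<le> vrank A + vrank (D \<union> C)"
    if "finite C" "D \<subseteq> A" for C D
    using that(1)
  proof (induction rule: finite_induct)
    case empty then show ?case by simp
  next
    case (insert c C)
    have fin: "finite (A \<union> C)" "finite (D \<union> C)"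
      using insert assms that finite_subset by auto
    have "span (D \<union> C) \<subseteq> span (A \<union> C)" using that by (intro bv.span_mono) auto
    then show ?case using insert vrank_insert[OF fin(1), of c] vrank_insert[OF fin(2), of c]
      by (auto split: if_splits)
  qed
  from this[of B "A \<inter> B"] assms show ?thesis by (simp add: Un_absorb1)
qed

text \<open>Rank-nullity in the form of matroid contraction: the image has the rank of
  \<open>A\<close> after contracting \<open>C\<close>. A new element raises both sides at the same
  time, by \<open>mem_span_image_iff\<close>.\<close>

lemma vrank_image:
  fixes A C :: "bvec set"
  assumes f: "additive f" and ker: "\<And>x. f x = 0 \<longleftrightarrow> x \<in> span C"
    and fin: "finite A" "finite C"
  shows "vrank (A \<union> C) = vrank (f ` A) + vrank C"
  using fin(1)
proof (induction rule: finite_induct)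
  case empty then show ?case by simp
next
  case (insert a A)
  have "f a \<in> span (f ` A) \<longleftrightarrow> a \<in> span (A \<union> C)"
    using mem_span_image_iff[OF f ker] by (simp add: Un_commute)
  then show ?case using insert vrank_insert[of "A \<union> C" a] vrank_insert[of "f ` A" "f a"] fin
    by auto
qed

lemma vrank_inj_image:
  fixes A :: "bvec set"
  assumes f: "additive f" and ker: "\<And>x. x \<in> span A \<Longrightarrow> f x = 0 \<Longrightarrow> x = 0"
    and fin: "finite A"
  shows "vrank (f ` A) = vrank A"
proof -
  have "vrank (f ` B) = vrank B" if "finite B" "B \<subseteq> A" for B
    using that
  proof (induction rule: finite_induct)
    case empty then show ?case by simp
  next
    case (insert a B)
    have "f a \<in> span (f ` B) \<longleftrightarrow> a \<in> span B"
    proof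
      assume "f a \<in> span (f ` B)"
      then obtain z where z: "z \<in> span B" "f a = f z" using span_image[OF f] by auto
      then have "f (a + z) = 0" using additive_eq_iff[OF f] by metis
      moreover have "a + z \<in> span A" using z insert.prems bv.span_mono[of B A]
        by (intro span_add) (auto intro: bv.span_base)
      ultimately have "a + z = 0" using ker by blast
      then show "a \<in> span B" using z by simp
    qed (use span_image[OF f] in auto)
    then show ?case using insert vrank_insert[of B a] vrank_insert[of "f ` B" "f a"] by auto
  qed
  then show ?thesis using fin by blast
qed

lemma vrank_1 [simp]: "vrank {x::bvec} = (if x = 0 then 0 else 1)"
  using vrank_insert[of "{}" x] by simp

lemma span_empty: "span {} = {0}" by simp

lemma span_1: "span {x} = {0, x}"
  by (auto simp: span_insert)

lemma vrank_2: "x \<noteq> 0 \<Longrightarrow> y \<noteq> 0 \<Longrightarrow> vrank {x, y::bvec} = (if x = y then 1 else 2)"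
  using vrank_insert[of "{y}" x] by (auto simp: span_1)

subsection \<open>Contractions and separations of sets of vectors\<close>

text \<open>The plane spanned by \<open>s\<close>, \<open>t\<close>, \<open>n\<close> meets \<open>E\<close> in a copy of \<open>U\<^sub>3\<^sub>,\<^sub>4\<close>
  (if \<open>s + t \<notin> E\<close>) or of \<open>M(K\<^sub>4)\<close>, the Fano plane without the point \<open>n\<close>.\<close>

definition bad :: "bvec set \<Rightarrow> bool" where
  "bad E \<longleftrightarrow> (\<exists>s t n. s \<in> E \<and> s + n \<in> E \<and> t \<in> E \<and> t + n \<in> E \<and> n \<notin> E \<and> n \<noteq> 0
     \<and> t \<noteq> s \<and> t \<noteq> s + n \<and> (s + t \<in> E \<longleftrightarrow> s + t + n \<in> E))"

lemma badI:
  "\<lbrakk>s \<in> E; s + n \<in> E; t \<in> E; t + n \<in> E; n \<notin> E; n \<noteq> 0; t \<noteq> s; t \<noteq> s + n;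
    s + t \<in> E \<longleftrightarrow> s + t + n \<in> E\<rbrakk> \<Longrightarrow> bad E"
  unfolding bad_def by blast

text \<open>\<open>f ` E - {0}\<close> represents the simplification of the contraction of \<open>C\<close>: taking the image
  identifies parallel elements and removing \<open>0\<close> deletes the loops.\<close>

definition bad_free :: "bvec set \<Rightarrow> bool" where
  "bad_free E \<longleftrightarrow> (\<forall>f C. additive f \<and> C \<subseteq> E \<and> (\<forall>x. f x = 0 \<longleftrightarrow> x \<in> span C) \<longrightarrow> \<not> bad (f ` E - {0}))"

lemma bad_freeD:
  "bad_free E \<Longrightarrow> additive f \<Longrightarrow> C \<subseteq> E \<Longrightarrow> (\<And>x. f x = 0 \<longleftrightarrow> x \<in> span C) \<Longrightarrow> \<not> bad (f ` E - {0})"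
  unfolding bad_free_def by blast

lemma bad_free_not_bad:
  assumes "bad_free E" "0 \<notin> E" shows "\<not> bad E"
proof -
  have "x = 0 \<longleftrightarrow> x \<in> span {}" for x by simp
  from bad_freeD[OF assms(1) additive_id _ this] show ?thesis using assms(2) by simp
qed

abbreviation ctr :: "bvec \<Rightarrow> bvec set \<Rightarrow> bvec set" where
  "ctr g E \<equiv> proj g ` E - {0}"

lemma proj_eq_iff: "proj g x = proj g y \<longleftrightarrow> x = y \<or> x + y = g"
  using additive_eq_iff[OF additive_proj, of g x y] proj_eq_0_iff[of g "x + y"] by simp

lemma proj_0 [simp]: "proj g 0 = 0" and proj_self [simp]: "proj g g = 0"
  using proj_eq_0_iff by auto

lemma proj_add: "proj g (x + y) = proj g x + proj g y"
  by (rule additiveD[OF additive_proj])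

lemma proj_mem_image_iff: "subspace W \<Longrightarrow> g \<in> W \<Longrightarrow> proj g x \<in> proj g ` W \<longleftrightarrow> x \<in> W"
proof (intro iffI)
  assume W: "subspace W" "g \<in> W" and "proj g x \<in> proj g ` W"
  then obtain w where w: "w \<in> W" "x = w \<or> x + w = g" by (auto simp: proj_eq_iff)
  then show "x \<in> W" using W subspace_add_iff' by metis
qed auto

text \<open>Contracting \<open>g\<close> and afterwards the images of \<open>C0\<close> is one
  contraction, with kernel \<open>span (insert g C0)\<close>.\<close>

lemma bad_free_ctr:
  assumes "bad_free E" "g \<in> E" shows "bad_free (ctr g E)"
  unfolding bad_free_def
proof (intro allI impI, elim conjE)
  fix f C assume f: "additive f" and C: "C \<subseteq> ctr g E" and ker: "\<forall>x. f x = 0 \<longleftrightarrow> x \<in> span C"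
  then obtain C0 where C0: "C0 \<subseteq> E" "C = proj g ` C0" by (metis Diff_subset subset_imageE subset_trans)
  have ker': "(f \<circ> proj g) x = 0 \<longleftrightarrow> x \<in> span (insert g C0)" for x
  proof -
    have "proj g x = 0 \<longleftrightarrow> x \<in> span {g}" for x by (auto simp: proj_eq_0_iff span_1)
    from mem_span_image_iff[OF additive_proj this, of x C0] ker C0(2) show ?thesis by simp
  qed
  have "\<not> bad ((f \<circ> proj g) ` E - {0})"
    by (rule bad_freeD[OF assms(1) additive_comp[OF f additive_proj] _ ker']) (use C0 assms in auto)
  moreover have "(f \<circ> proj g) ` E - {0} = f ` ctr g E - {0}"
    using additive_0[OF f] by auto
  ultimately show "\<not> bad (f ` ctr g E - {0})" by simp
qed

text \<open>As \<open>n\<close> is the sum of \<open>s\<close> and \<open>s + n\<close>, a subspace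
  containing the four given points contains their whole plane, so a point of that plane missing from
  \<open>E \<inter> W\<close> is missing from \<open>E\<close>.\<close>

lemma bad_Int_subspace:
  assumes "bad (E \<inter> W)" "subspace W" shows "bad E"
proof -
  obtain s t n where *: "s \<in> E \<inter> W" "s + n \<in> E \<inter> W" "t \<in> E \<inter> W" "t + n \<in> E \<inter> W" "n \<notin> E \<inter> W" "n \<noteq> 0"
     "t \<noteq> s" "t \<noteq> s + n" "s + t \<in> E \<inter> W \<longleftrightarrow> s + t + n \<in> E \<inter> W"
    using assms(1) unfolding bad_def by blast
  have n: "n \<in> W" using * subspace_add_iff[OF assms(2)] by blast
  have "s + t \<in> W" "s + t + n \<in> W" using * n subspace_add[OF assms(2)] by blast+
  with * n show ?thesis by (intro badI[of s E n t]) auto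
qed

text \<open>The kernel \<open>span C\<close> lies in \<open>W\<close>, so an element of
  \<open>E\<close> whose image lies in the image of \<open>W\<close> is itself in \<open>W\<close>.
  Hence restriction to \<open>W\<close> and contraction of \<open>C\<close> commute.\<close>

lemma bad_free_Int_subspace:
  assumes "bad_free E" "subspace W" shows "bad_free (E \<inter> W)"
  unfolding bad_free_def
proof (intro allI impI notI, elim conjE)
  fix f C assume f: "additive f" and C: "C \<subseteq> E \<inter> W" and ker: "\<forall>x. f x = 0 \<longleftrightarrow> x \<in> span C"
    and b: "bad (f ` (E \<inter> W) - {0})"
  have CW: "span C \<subseteq> W" using C assms(2) by (intro span_subset) auto
  have "f ` (E \<inter> W) - {0} = (f ` E - {0}) \<inter> f ` W"
  proof -
    have "x \<in> f ` (E \<inter> W)" if x: "x \<in> f ` E" "x \<in> f ` W" for x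
    proof -
      obtain e w where e: "e \<in> E" "w \<in> W" "x = f e" "x = f w" using x by blast
      then have "w + e \<in> span C" using additive_eq_iff[OF f, of w e] ker by metis
      then have "e \<in> W" using CW e subspace_add_iff[OF assms(2)] by blast
      then show ?thesis using e by blast
    qed
    then show ?thesis by blast
  qed
  then have "bad (f ` E - {0})" using b bad_Int_subspace[OF _ subspace_image[OF f assms(2)]] by metis
  then show False using bad_freeD[OF assms(1) f, of C] ker C by blast
qed

section \<open>Separations and minimal separators\<close>

definition sep :: "bvec set \<Rightarrow> bvec \<Rightarrow> bvec \<Rightarrow> bvec set \<Rightarrow> bvec set \<Rightarrow> bool" where
  "sep E e f X Y \<longleftrightarrow> subspace X \<and> subspace Y \<and> E \<subseteq> X \<union> Y \<and> e \<in> X - Y \<and> f \<in> Y - X"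

text \<open>Only the intersections are compared, not the sides. A side may thus be rebuilt at will
  as long as the intersection does not grow, which is how minimality is exploited.\<close>

definition min_sep :: "bvec set \<Rightarrow> bvec \<Rightarrow> bvec \<Rightarrow> bvec set \<Rightarrow> bvec set \<Rightarrow> bool" where
  "min_sep E e f X Y \<longleftrightarrow> sep E e f X Y \<and>
     (\<forall>X' Y'. sep E e f X' Y' \<and> X' \<inter> Y' \<subseteq> X \<inter> Y \<longrightarrow> X' \<inter> Y' = X \<inter> Y)"

lemma min_sepI:
  "sep E e f X Y \<Longrightarrow> (\<And>X' Y'. sep E e f X' Y' \<Longrightarrow> X' \<inter> Y' \<subseteq> X \<inter> Y \<Longrightarrow> X' \<inter> Y' = X \<inter> Y) \<Longrightarrow> min_sep E e f X Y"
  unfolding min_sep_def by blast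

lemma min_sepD: "min_sep E e f X Y \<Longrightarrow> sep E e f X Y"
  "min_sep E e f X Y \<Longrightarrow> sep E e f X' Y' \<Longrightarrow> X' \<inter> Y' \<subseteq> X \<inter> Y \<Longrightarrow> X' \<inter> Y' = X \<inter> Y"
  unfolding min_sep_def by blast+

lemma sep_sym: "sep E e f X Y \<Longrightarrow> sep E f e Y X"
  unfolding sep_def by blast

lemma min_sep_sym: "min_sep E e f X Y \<Longrightarrow> min_sep E f e Y X"
  unfolding min_sep_def using sep_sym by (metis Int_commute)

lemma sep_lift:
  assumes "sep (ctr g E) (proj g e) (proj g f) X Y"
  shows "sep E e f (proj g -` X) (proj g -` Y)"
  using assms unfolding sep_def
  by (auto intro: subspace_vimage[OF additive_proj] subspace_0)

lemma sep_contract: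
  assumes "sep E e f X Y" "g \<in> X \<inter> Y"
  shows "sep (ctr g E) (proj g e) (proj g f) (proj g ` X) (proj g ` Y)"
  using assms proj_mem_image_iff unfolding sep_def
  by (auto intro: subspace_image[OF additive_proj])

lemma proj_image_Int:
  assumes "subspace X" "subspace Y" "g \<in> X \<inter> Y"
  shows "proj g ` X \<inter> proj g ` Y = proj g ` (X \<inter> Y)"
proof
  show "proj g ` X \<inter> proj g ` Y \<subseteq> proj g ` (X \<inter> Y)"
  proof
    fix z assume z: "z \<in> proj g ` X \<inter> proj g ` Y"
    then obtain x where x: "x \<in> X" "z = proj g x" by blast
    then have "x \<in> Y" using z proj_mem_image_iff assms by blast
    then show "z \<in> proj g ` (X \<inter> Y)" using x by blast
  qed
qed auto

text \<open>A smaller separator of the contraction lifts to preimages, and their intersection stays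
  inside \<open>X \<inter> Y\<close> because \<open>X \<inter> Y\<close> contains the kernel
  \<open>{0, g}\<close>.\<close>

lemma min_sep_contract:
  assumes "min_sep E e f X Y" "g \<in> X \<inter> Y"
  shows "min_sep (ctr g E) (proj g e) (proj g f) (proj g ` X) (proj g ` Y)"
proof (rule min_sepI)
  have s: "sep E e f X Y" using assms min_sepD by blast
  then have sub: "subspace X" "subspace Y" "subspace (X \<inter> Y)"
    by (auto simp: sep_def intro: bv.subspace_inter)
  show "sep (ctr g E) (proj g e) (proj g f) (proj g ` X) (proj g ` Y)"
    using sep_contract s assms by blast
  fix X' Y' assume s': "sep (ctr g E) (proj g e) (proj g f) X' Y'" and le: "X' \<inter> Y' \<subseteq> proj g ` X \<inter> proj g ` Y"
  have *: "proj g ` X \<inter> proj g ` Y = proj g ` (X \<inter> Y)" using sub assms by (intro proj_image_Int) auto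
  have "proj g -` X' \<inter> proj g -` Y' \<subseteq> X \<inter> Y"
    using le * proj_mem_image_iff[OF sub(3) assms(2)] by blast
  then have "proj g -` X' \<inter> proj g -` Y' = X \<inter> Y"
    using min_sepD(2)[OF assms(1) sep_lift[OF s']] by blast
  then have "proj g ` (X \<inter> Y) \<subseteq> X' \<inter> Y'" by blast
  then show "X' \<inter> Y' = proj g ` X \<inter> proj g ` Y" using le * by blast
qed

lemma card_ctr: "finite E \<Longrightarrow> g \<in> E \<Longrightarrow> card (ctr g E) < card E"
proof -
  assume fin: "finite E" and g: "g \<in> E"
  have "ctr g E \<subseteq> proj g ` (E - {g})" by auto
  then have "card (ctr g E) \<le> card (E - {g})" using fin by (meson card_image_le card_mono dual_order.trans finite_Diff finite_imageI)
  then show ?thesis using fin g by (metis card_Diff1_less order_le_less_trans)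
qed

text \<open>If some third element \<open>g\<close> has \<open>e + f + g\<close> outside
  \<open>E\<close>, then contracting \<open>g\<close> keeps \<open>e + f\<close> outside, and a
  separation of the contraction lifts. If there is no such \<open>g\<close>, then \<open>E\<close>
  is invariant under translation by the missing vector \<open>e + f\<close>; a third element would
  give a bad plane, so only \<open>e\<close> and \<open>f\<close> remain.\<close>

lemma exists_sep:
  "\<lbrakk>finite E; 0 \<notin> E; bad_free E; e \<in> E; f \<in> E; e \<noteq> f; e + f \<notin> E\<rbrakk> \<Longrightarrow> \<exists>X Y. sep E e f X Y"
proof (induction "card E" arbitrary: E e f rule: less_induct)
  case less
  show ?case
  proof (cases "\<exists>g\<in>E - {e, f}. e + f + g \<notin> E")
    case True
    then obtain g where g: "g \<in> E" "g \<noteq> e" "g \<noteq> f" "e + f + g \<notin> E" by blast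
    have "e + f \<noteq> g" using g less.prems by blast
    then have ne: "proj g e \<noteq> proj g f" using less.prems by (simp add: proj_eq_iff)
    have nz: "proj g e \<noteq> 0" "proj g f \<noteq> 0" using g less.prems by (metis proj_eq_0_iff)+
    have "proj g e + proj g f \<notin> ctr g E"
    proof
      assume "proj g e + proj g f \<in> ctr g E"
      then obtain h where h: "h \<in> E" "proj g (e + f) = proj g h" by (auto simp: proj_add)
      then have "e + f = h \<or> e + f + h = g" by (simp only: proj_eq_iff)
      then have "e + f = h \<or> e + f + g = h" by (metis bvec_add_eq_iff add.commute)
      then show False using h less.prems g by blast
    qed
    with less.hyps[of "ctr g E" "proj g e" "proj g f"] obtain X Y where
      "sep (ctr g E) (proj g e) (proj g f) X Y"
      using card_ctr[of E g] bad_free_ctr[of E g] less.prems g ne nz by fastforce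
    then show ?thesis using sep_lift by blast
  next
    case False
    then have all: "e + f + g \<in> E" if "g \<in> E" "g \<noteq> e" "g \<noteq> f" for g using that by blast
    have "E = {e, f}"
    proof (rule ccontr)
      assume "E \<noteq> {e, f}"
      then obtain g where g: "g \<in> E" "g \<noteq> e" "g \<noteq> f" using less.prems by blast
      have ne: "e + g \<noteq> e" "e + g \<noteq> f" "f + g \<noteq> e" "f + g \<noteq> f"
        using g less.prems by (auto simp: bvec_add_eq_iff bvec_ac)
      have "e + g \<in> E \<longleftrightarrow> e + g + (e + f) \<in> E"
        using all[of "e + g"] all[of "f + g"] ne by (auto simp: bvec_ac)
      then have "bad E" using less.prems g all[OF g]
        by (intro badI[of e E "e + f" g]) (auto simp: bvec_ac)
      then show False using bad_free_not_bad less.prems by blast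
    qed
    then have "sep E e f {0, e} {0, f}" using less.prems by (auto simp: sep_def subspace_iff)
    then show ?thesis by blast
  qed
qed

lemma exists_min_sep:
  assumes "finite E" "sep E e f X Y" "e \<in> E" "f \<in> E"
  shows "\<exists>X Y. min_sep E e f X Y"
proof -
  let ?P = "\<lambda>Z. sep E e f (fst Z) (snd Z) \<and> finite (fst Z \<inter> snd Z)"
  let ?m = "\<lambda>Z. card (fst Z \<inter> snd Z)"
  \<comment> \<open>Cutting down to the span of \<open>E\<close> makes the intersection finite, so
    one of least cardinality exists; it is minimal under inclusion.\<close>
  have "sep E e f (X \<inter> span E) (Y \<inter> span E)"
    using assms bv.span_superset[of E] unfolding sep_def by (auto intro: bv.subspace_inter)
  then have "?P (X \<inter> span E, Y \<inter> span E)" using finite_span[OF assms(1)] by auto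
  then obtain Z where Z: "?P Z" "\<And>Z'. ?P Z' \<Longrightarrow> ?m Z \<le> ?m Z'"
    using ex_has_least_nat[of ?P _ ?m] by blast
  have "min_sep E e f (fst Z) (snd Z)"
  proof (rule min_sepI)
    fix X' Y' assume s: "sep E e f X' Y'" and le: "X' \<inter> Y' \<subseteq> fst Z \<inter> snd Z"
    have "finite (X' \<inter> Y')" using le Z(1) finite_subset by blast
    with s have "?P (X', Y')" by simp
    then have "card (fst Z \<inter> snd Z) \<le> card (X' \<inter> Y')" using Z(2)[of "(X', Y')"] by simp
    then show "X' \<inter> Y' = fst Z \<inter> snd Z" using le Z(1) card_seteq by blast
  qed (use Z in auto)
  then show ?thesis by blast
qed

text \<open>After contracting \<open>C\<close> the elements \<open>p1, p2, q1, q2\<close> form a circuit, and no element is on any of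
  the three diagonals.\<close>

lemma bad_contraction:
  assumes C: "C \<subseteq> E" "finite C"
    and E: "p1 \<in> E" "p2 \<in> E" "q1 \<in> E" "q2 \<in> E"
    and sum: "p1 + p2 + q1 + q2 \<in> span C"
    and n: "\<And>x. x \<in> insert 0 E \<Longrightarrow> x + p1 + p2 \<notin> span C"
      "\<And>x. x \<in> insert 0 E \<Longrightarrow> x + p1 + q1 \<notin> span C"
      "\<And>x. x \<in> insert 0 E \<Longrightarrow> x + p2 + q1 \<notin> span C"
  shows "\<not> bad_free E"
proof
  assume "bad_free E"
  obtain f where f: "additive f" "\<And>x. f x = 0 \<longleftrightarrow> x \<in> span C"
    using exists_additive_ker[OF C(2)] by blast
  have eq: "f x = f y \<longleftrightarrow> x + y \<in> span C" for x y using f additive_eq_iff by metis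
  have add: "f (x + y) = f x + f y" for x y using f(1) additiveD by blast
  have q2: "f q2 = f (p1 + p2 + q1)" unfolding eq using sum by (simp add: bvec_ac)
  have n': "f (p1 + p2) \<notin> f ` E" "f (p1 + q1) \<notin> f ` E" "f (p2 + q1) \<notin> f ` E"
    using n by (auto simp: eq bvec_ac)
  have n0: "f (p1 + p2) \<noteq> 0" "f (p1 + q1) \<noteq> 0" "f (p2 + q1) \<noteq> 0"
    using n[of 0] by (auto simp: f(2))
  have nz: "f p1 \<noteq> 0" "f p2 \<noteq> 0" "f q1 \<noteq> 0" "f q2 \<noteq> 0"
    using n' E q2 by (auto simp: add)
  have "bad (f ` E - {0})"
  proof (rule badI[of "f p1" _ "f (p1 + p2)" "f q1"])
    show "f p1 + f (p1 + p2) \<in> f ` E - {0}" using E nz by (simp add: add)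
    show "f q1 + f (p1 + p2) \<in> f ` E - {0}" using E nz q2 by (simp add: add bvec_ac) (metis imageI)
    show "f q1 \<noteq> f p1" "f q1 \<noteq> f p1 + f (p1 + p2)" using n0 by (auto simp: add)
    show "(f p1 + f q1 \<in> f ` E - {0}) = (f p1 + f q1 + f (p1 + p2) \<in> f ` E - {0})"
      using n' by (simp add: add bvec_ac)
  qed (use E nz n' n0 in auto)
  then show False using bad_freeD[OF \<open>bad_free E\<close> f(1) C(1) f(2)] by blast
qed

text \<open>The assumption \<open>mod\<close> says that \<open>U\<close> becomes complete when any
  one of its elements is contracted. If \<open>n\<close> in \<open>U\<close> is missing, then
  \<open>E \<inter> U\<close> is invariant under translation by \<open>n\<close>, hence is a single
  pair \<open>{s, s + n}\<close> by absence of a bad plane. Contracting \<open>s\<close> once more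
  shows that \<open>U\<close> has no vectors besides \<open>0\<close>, \<open>n\<close> and this
  pair.\<close>

lemma complete_mod_points:
  assumes U: "subspace U" and E: "0 \<notin> E" "\<not> bad E"
    and mod: "\<And>g x. g \<in> E \<inter> U \<Longrightarrow> x \<in> U \<Longrightarrow> x \<noteq> 0 \<Longrightarrow> x \<noteq> g \<Longrightarrow> x \<in> E \<or> x + g \<in> E"
  shows "U - {0} \<subseteq> E \<or> E \<inter> U = {} \<or>
    (\<exists>a b. a \<in> E \<and> b \<in> E \<and> a \<noteq> b \<and> a + b \<notin> E \<and> U = {0, a, b, a + b})"
proof (cases "U - {0} \<subseteq> E \<or> E \<inter> U = {}")
  case False
  then obtain n s where n: "n \<in> U" "n \<noteq> 0" "n \<notin> E" and s: "s \<in> E" "s \<in> U" by blast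
  have shift: "t + n \<in> E" if "t \<in> E" "t \<in> U" for t
    using mod[of t n] that n by (auto simp: bvec_ac)
  have only: "t = s \<or> t = s + n" if t: "t \<in> E" "t \<in> U" for t
  proof (rule ccontr)
    assume ne: "\<not> (t = s \<or> t = s + n)"
    have U': "s + t \<in> U" "s + t + n \<in> U" using s t n subspace_add[OF U] by blast+
    have "s + t \<in> E \<longleftrightarrow> s + t + n \<in> E"
      using shift[of "s + t"] shift[of "s + t + n"] U' by (auto simp: bvec_ac)
    then have "bad E" using s t n ne shift by (intro badI[of s E n t]) auto
    then show False using E by blast
  qed
  have "u = 0 \<or> u = s \<or> u = s + n \<or> u = n" if u: "u \<in> U" for u
  proof (cases "u = 0 \<or> u = s")
    case False
    then have "u \<in> E \<or> u + s \<in> E" using mod s u by blast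
    then have "u = s \<or> u = s + n \<or> u + s = s \<or> u + s = s + n"
      using only u s subspace_add[OF U] by blast
    then show ?thesis by (metis add.commute bvec_add_self bvec_add_self_left)
  qed auto
  then have "U = {0, s, s + n, s + (s + n)}"
    using n s subspace_add[OF U] subspace_0[OF U] by auto
  then show ?thesis using s n shift[of s] by (intro disjI2 exI[of _ s] exI[of _ "s + n"]) auto
qed blast

text \<open>Lists make lengths add up under concatenation. Repeated entries do no harm, since
  \<open>k\<close> is only an upper bound on the length.\<close>

definition sums :: "bvec set \<Rightarrow> nat \<Rightarrow> bvec set" where
  "sums F k = {sum_list xs | xs. set xs \<subseteq> F \<and> length xs \<le> k}"

lemma sumsI: "set xs \<subseteq> F \<Longrightarrow> length xs \<le> k \<Longrightarrow> sum_list xs \<in> sums F k"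
  unfolding sums_def by blast

lemma zero_in_sums: "0 \<in> sums F k"
  using sumsI[of "[]"] by simp

lemma elem_in_sums: "x \<in> insert 0 F \<Longrightarrow> x \<in> sums F 1"
proof (elim insertE)
  show "x \<in> F \<Longrightarrow> x \<in> sums F 1" using sumsI[of "[x]" F 1] by simp
qed (simp only: zero_in_sums)

lemma sums_add: "x \<in> sums F k \<Longrightarrow> y \<in> sums F l \<Longrightarrow> x + y \<in> sums F (k + l)"
proof -
  assume "x \<in> sums F k" "y \<in> sums F l"
  then obtain xs ys where "x = sum_list xs" "set xs \<subseteq> F" "length xs \<le> k"
    "y = sum_list ys" "set ys \<subseteq> F" "length ys \<le> l" unfolding sums_def by blast
  then show ?thesis using sumsI[of "xs @ ys" F "k + l"] by simp
qed

lemma span_subset_sums: "x \<in> span (set xs) \<Longrightarrow> set xs \<subseteq> F \<Longrightarrow> x \<in> sums F (length xs)"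
proof (induction xs arbitrary: x)
  case Nil
  then have "x = 0" by simp
  then show ?case by (simp only: zero_in_sums)
next
  case (Cons a xs)
  then have "x \<in> span (set xs) \<or> x + a \<in> span (set xs)" by (simp add: span_insert)
  moreover have "x = a + (x + a)" by (simp add: bvec_ac)
  ultimately obtain y where y: "y \<in> span (set xs)" "x = y \<or> x = a + y" by metis
  then have "y \<in> sums F (length xs)" using Cons by simp
  moreover have "0 \<in> sums F 1" "a \<in> sums F 1" using elem_in_sums[of _ F] Cons.prems by auto
  ultimately show ?case using y(2) sums_add[of _ F 1 y "length xs"] by force
qed

lemma sum_list_in_span: "sum_list xs \<in> span (set xs)"
proof (induction xs)
  case (Cons a xs)
  have "a + sum_list xs \<in> span (set (a # xs))"
    using Cons bv.span_mono[of "set xs" "set (a # xs)"] bv.span_base[of a "set (a # xs)"]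
    by (intro span_add) auto
  then show ?case by (simp only: sum_list.Cons)
qed (simp only: sum_list.Nil bv.span_zero)

lemma sum_list_in_subspace: "set xs \<subseteq> W \<Longrightarrow> subspace W \<Longrightarrow> sum_list xs \<in> W"
  using sum_list_in_span span_subset by blast

text \<open>Any dependency involving few elements splits into a part in \<open>A\<close> and a part in \<open>B\<close> with equal sums,
  which vanish by minimality.\<close>

lemma minimal_cycle_aux:
  assumes A: "set as \<subseteq> A" "a1 \<in> A" "a2 \<in> A" "u = a1 + a2 + sum_list as"
    and B: "set bs \<subseteq> B" "b1 \<in> B" "b2 \<in> B" "u = b1 + b2 + sum_list bs"
    and u: "u \<noteq> 0"
    and min': "\<forall>v k l. v \<in> sums A k \<longrightarrow> v \<in> sums B l \<longrightarrow> k + l < length as + length bs + 4 \<longrightarrow> v = 0"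
    and x: "x \<in> insert 0 A"
  shows "x + u \<notin> span (set as \<union> set bs)" "x + a1 + b1 \<notin> span (set as \<union> set bs)"
proof -
  let ?p = "length as" and ?q = "length bs"
  note min = min'[rule_format]
  have el: "x \<in> sums A 1" "a1 \<in> sums A 1" "a2 \<in> sums A 1" "b1 \<in> sums B 1" "b2 \<in> sums B 1"
    using elem_in_sums A B x by auto
  have \<alpha>: "\<alpha> \<in> sums A ?p" if "\<alpha> \<in> span (set as)" for \<alpha> using span_subset_sums that A by blast
  have \<beta>: "\<beta> \<in> sums B ?q" if "\<beta> \<in> span (set bs)" for \<beta> using span_subset_sums that B by blast
  have uA: "u \<in> sums A (1 + 1 + ?p)" using A el \<alpha>[OF sum_list_in_span] by (simp only: A sums_add)
  have uB: "u \<in> sums B (1 + 1 + ?q)" using B el \<beta>[OF sum_list_in_span] by (simp only: B sums_add)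
  show "x + u \<notin> span (set as \<union> set bs)"
  proof
    assume "x + u \<in> span (set as \<union> set bs)"
    then obtain \<alpha>' \<beta>' where s: "\<alpha>' \<in> span (set as)" "\<beta>' \<in> span (set bs)" "x + u = \<alpha>' + \<beta>'"
      by (auto simp: bv.span_Un)
    \<comment> \<open>The count is always \<open>?p + ?q + 3\<close>, one below the minimum. Here
      \<open>\<beta>'\<close> costs \<open>?p + 3\<close> elements of \<open>A\<close> against
      \<open>?q\<close> of \<open>B\<close>, so it vanishes; then \<open>u\<close> costs
      \<open>?p + 1\<close> of \<open>A\<close> against \<open>?q + 2\<close> of \<open>B\<close>,
      and would vanish too.\<close>
    have "\<beta>' = x + a1 + a2 + (sum_list as + \<alpha>')" using s(3) A(4)
      by (metis add.assoc add.commute bvec_add_self_left)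
    moreover have "sum_list as + \<alpha>' \<in> sums A ?p"
      by (intro \<alpha> span_add sum_list_in_span s)
    ultimately have "\<beta>' \<in> sums A (1 + 1 + 1 + ?p)" using el by (simp only: sums_add)
    then have "\<beta>' = 0" using min[of \<beta>'] \<beta>[OF s(2)] by simp
    then have "u = x + \<alpha>'" using s(3) by (metis add.right_neutral bvec_add_self_left)
    then have "u \<in> sums A (1 + ?p)" using el \<alpha>[OF s(1)] by (simp only: sums_add)
    then show False using min[of u "1 + ?p" "1 + 1 + ?q"] uB u by simp
  qed
  show "x + a1 + b1 \<notin> span (set as \<union> set bs)"
  proof
    assume "x + a1 + b1 \<in> span (set as \<union> set bs)"
    then obtain \<alpha>' \<beta>' where s: "\<alpha>' \<in> span (set as)" "\<beta>' \<in> span (set bs)" "x + a1 + b1 = \<alpha>' + \<beta>'"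
      by (auto simp: bv.span_Un)
    have eq: "b1 + \<beta>' = x + a1 + \<alpha>'" using s(3)
      by (metis add.assoc add.commute bvec_add_self_left)
    have "b1 + \<beta>' \<in> sums B (1 + ?q)" "b1 + \<beta>' \<in> sums A (1 + 1 + ?p)"
      using el \<alpha>[OF s(1)] \<beta>[OF s(2)] sums_add by (blast, simp only: eq sums_add)
    then have "b1 + \<beta>' = 0" using min[of "b1 + \<beta>'"] by simp
    then have "u = b2 + (\<beta>' + sum_list bs)" using B(4) by (simp add: bvec_ac)
    moreover have "\<beta>' + sum_list bs \<in> sums B ?q"
      by (intro \<beta> span_add sum_list_in_span s)
    ultimately have "u \<in> sums B (1 + ?q)" using el by (simp only: sums_add)
    then show False using min[of u "1 + 1 + ?p" "1 + ?q"] uA u by simp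
  qed
qed

text \<open>Replacing \<open>X\<close> by the span of \<open>E \<inter> X\<close> keeps a separation
  and cannot enlarge the intersection, so minimality makes the two intersections equal.\<close>

lemma min_sep_subset_span:
  assumes m: "min_sep E e f X Y" and "e \<in> E"
  shows "X \<inter> Y \<subseteq> span (E \<inter> X)"
proof -
  have s: "sep E e f X Y" using m min_sepD by blast
  have "span (E \<inter> X) \<subseteq> X" using s by (intro span_subset) (auto simp: sep_def)
  moreover have "E \<inter> X \<subseteq> span (E \<inter> X)" by (rule bv.span_superset)
  ultimately have "sep E e f (span (E \<inter> X)) Y" using s \<open>e \<in> E\<close> unfolding sep_def by auto
  from min_sepD(2)[OF m this] \<open>span (E \<inter> X) \<subseteq> X\<close> show ?thesis by blast
qed

text \<open>A nonzero vector of \<open>X \<inter> Y\<close> is a sum of elements of either side. In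
  a shortest coincidence of two such sums the common value \<open>u\<close> is nonzero and not in
  \<open>E\<close>, so each side uses at least two elements. Contracting all but two on each side
  leaves a circuit of four elements, and shortness keeps all elements of \<open>E\<close> off its
  diagonals.\<close>

lemma min_sep_empty:
  assumes m: "min_sep E e f X Y" and E: "finite E" "e \<in> E" "f \<in> E"
    and empty: "E \<inter> (X \<inter> Y) = {}" and bf: "bad_free E"
  shows "X \<inter> Y = {0}"
proof (rule ccontr)
  assume "X \<inter> Y \<noteq> {0}"
  have s: "sep E e f X Y" using m min_sepD by blast
  then have sub: "subspace X" "subspace Y" and cov: "E \<subseteq> X \<union> Y" by (auto simp: sep_def)
  then obtain u0 where u0: "u0 \<in> X \<inter> Y" "u0 \<noteq> 0" using subspace_0 \<open>X \<inter> Y \<noteq> {0}\<close> by blast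
  let ?P = "\<lambda>Z. set (fst Z) \<subseteq> E \<inter> X \<and> set (snd Z) \<subseteq> E \<inter> Y \<and> sum_list (fst Z) = sum_list (snd Z) \<and> sum_list (fst Z) \<noteq> 0"
  let ?m = "\<lambda>Z. length (fst Z) + length (snd Z)"
  have lists: "\<exists>xs. set xs \<subseteq> F \<and> sum_list xs = u0" if "u0 \<in> span F" "finite F" for F
  proof -
    obtain xs where "set xs = F" using \<open>finite F\<close> finite_list by blast
    then show ?thesis using span_subset_sums[of u0 xs F] that by (auto simp: sums_def)
  qed
  have "u0 \<in> span (E \<inter> X)" "u0 \<in> span (E \<inter> Y)"
    using min_sep_subset_span[OF m] min_sep_subset_span[OF min_sep_sym[OF m]] E u0 by blast+
  then obtain xs0 ys0 where "set xs0 \<subseteq> E \<inter> X" "sum_list xs0 = u0" "set ys0 \<subseteq> E \<inter> Y" "sum_list ys0 = u0"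
    using lists[of "E \<inter> X"] lists[of "E \<inter> Y"] E by blast
  then have "?P (xs0, ys0)" using u0 by simp
  then obtain Z where Z: "?P Z" "\<And>Z'. ?P Z' \<Longrightarrow> ?m Z \<le> ?m Z'"
    using ex_has_least_nat[of ?P _ ?m] by blast
  obtain xs ys where Zxy: "Z = (xs, ys)" by fastforce
  define u where "u = sum_list xs"
  have P: "set xs \<subseteq> E \<inter> X" "set ys \<subseteq> E \<inter> Y" "u = sum_list ys" "u \<noteq> 0"
    using Z Zxy u_def by auto
  have min: "v = 0" if "v \<in> sums (E \<inter> X) k" "v \<in> sums (E \<inter> Y) l" "k + l < length xs + length ys" for v k l
  proof (rule ccontr)
    assume "v \<noteq> 0"
    obtain xs' ys' where "v = sum_list xs'" "set xs' \<subseteq> E \<inter> X" "length xs' \<le> k"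
      "v = sum_list ys'" "set ys' \<subseteq> E \<inter> Y" "length ys' \<le> l" using \<open>v \<in> sums (E \<inter> X) k\<close> \<open>v \<in> sums (E \<inter> Y) l\<close>
      unfolding sums_def by blast
    then show False using Z(2)[of "(xs', ys')"] Zxy \<open>v \<noteq> 0\<close> \<open>k + l < _\<close> by auto
  qed
  have uXY: "u \<in> X" "u \<in> Y" using P u_def sum_list_in_subspace[of xs X] sum_list_in_subspace[of ys Y] sub by auto
  then have "u \<notin> E" using empty by blast
  obtain a1 a2 as where xs: "xs = a1 # a2 # as"
    using P \<open>u \<notin> E\<close> u_def by (cases xs; cases "tl xs") auto
  obtain b1 b2 bs where ys: "ys = b1 # b2 # bs"
    using P \<open>u \<notin> E\<close> by (cases ys; cases "tl ys") auto
  let ?S = "span (set as \<union> set bs)"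
  note aux1 = minimal_cycle_aux[of as "E \<inter> X" _ _ u bs "E \<inter> Y"]
  note aux2 = minimal_cycle_aux[of bs "E \<inter> Y" _ _ u as "E \<inter> X"]
  have u: "u = a1 + a2 + sum_list as" "u = a2 + a1 + sum_list as"
    "u = b1 + b2 + sum_list bs" "u = b2 + b1 + sum_list bs"
    using P u_def xs ys by (simp_all add: bvec_ac)
  have mem: "set as \<subseteq> E \<inter> X" "a1 \<in> E \<inter> X" "a2 \<in> E \<inter> X" "set bs \<subseteq> E \<inter> Y" "b1 \<in> E \<inter> Y" "b2 \<in> E \<inter> Y"
    using P xs ys by auto
  have min1: "\<forall>v k l. v \<in> sums (E \<inter> X) k \<longrightarrow> v \<in> sums (E \<inter> Y) l \<longrightarrow> k + l < length as + length bs + 4 \<longrightarrow> v = 0"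
    using min xs ys by simp
  then have min2: "\<forall>v k l. v \<in> sums (E \<inter> Y) k \<longrightarrow> v \<in> sums (E \<inter> X) l \<longrightarrow> k + l < length bs + length as + 4 \<longrightarrow> v = 0"
    by (metis add.commute)
  \<comment> \<open>Elements on the side \<open>X\<close>: the third diagonal comes from exchanging
    \<open>a1\<close> and \<open>a2\<close>. The fact \<open>B\<close> is the same with the two
    sides exchanged.\<close>
  have A: "x + u \<notin> ?S" "x + a1 + b1 \<notin> ?S" "x + a2 + b1 \<notin> ?S" if "x \<in> insert 0 (E \<inter> X)" for x
    using aux1[OF mem(1-3) u(1) mem(4-6) u(3) P(4) min1 that]
      aux1[OF mem(1,3,2) u(2) mem(4-6) u(3) P(4) min1 that] by blast+
  have B: "x + u \<notin> ?S" "x + a1 + b1 \<notin> ?S" "x + a2 + b1 \<notin> ?S" if "x \<in> insert 0 (E \<inter> Y)" for x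
    using aux2[OF mem(4-6) u(3) mem(1-3) u(1) P(4) min2 that]
      aux2[OF mem(4-6) u(3) mem(1,3,2) u(2) P(4) min2 that] by (simp_all add: Un_commute bvec_ac)
  have AB: "x + u \<notin> ?S" "x + a1 + b1 \<notin> ?S" "x + a2 + b1 \<notin> ?S" if "x \<in> insert 0 E" for x
    using A[of x] B[of x] that cov by blast+
  have sp: "sum_list as \<in> ?S" "sum_list bs \<in> ?S"
    using sum_list_in_span bv.span_mono[of "set as" "set as \<union> set bs"] bv.span_mono[of "set bs" "set as \<union> set bs"] by blast+
  have "\<not> bad_free E"
  proof (rule bad_contraction[of "set as \<union> set bs" E a1 a2 b1 b2])
    have "a1 + a2 + b1 + b2 = sum_list as + sum_list bs"
    proof -
      have "a1 + a2 = u + sum_list as" using u(1) by (metis bvec_add_eq_iff add.commute)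
      moreover have "b1 + b2 = u + sum_list bs" using u(3) by (metis bvec_add_eq_iff add.commute)
      ultimately have "(a1 + a2) + (b1 + b2) = (u + sum_list as) + (u + sum_list bs)" by (simp only:)
      then show ?thesis by (simp only: bvec_ac bvec_add_self_left)
    qed
    then show "a1 + a2 + b1 + b2 \<in> ?S" using sp span_add by metis
    fix x assume x: "x \<in> insert 0 E"
    have "x + u = sum_list as + (x + a1 + a2)" using u(1) by (simp add: bvec_ac)
    then show "x + a1 + a2 \<notin> ?S" using AB(1)[OF x] span_add_iff[OF sp(1)] by metis
  qed (use mem AB in auto)
  then show False using bf by blast
qed

subsection \<open>Circuits through two elements\<close>

text \<open>After contracting \<open>C\<close> the elements \<open>a\<close> and \<open>x\<close> stay distinct and \<open>z\<close> becomes the third point of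
  their line.\<close>

definition linked :: "bvec set \<Rightarrow> bvec \<Rightarrow> bvec \<Rightarrow> bool" where
  "linked F a x \<longleftrightarrow> (\<exists>C z. C \<subseteq> F \<and> z \<in> F \<and> z + a + x \<in> span C
     \<and> a \<notin> span C \<and> x \<notin> span C \<and> a + x \<notin> span C)"

text \<open>A direct sum decomposition of \<open>F\<close> with \<open>a\<close> and
  \<open>x\<close> in different summands: for elements of \<open>F\<close> this says that they lie
  in different connected components of the matroid.\<close>

definition split :: "bvec set \<Rightarrow> bvec \<Rightarrow> bvec \<Rightarrow> bool" where
  "split F a x \<longleftrightarrow> (\<exists>X Y. subspace X \<and> subspace Y \<and> F \<subseteq> X \<union> Y \<and> X \<inter> Y = {0} \<and> a \<in> X \<and> x \<in> Y)"

lemma splitI: "subspace X \<Longrightarrow> subspace Y \<Longrightarrow> F \<subseteq> X \<union> Y \<Longrightarrow> X \<inter> Y \<subseteq> {0} \<Longrightarrow> a \<in> X \<Longrightarrow> x \<in> Y \<Longrightarrow> split F a x"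
  unfolding split_def using subspace_0 by blast

lemma split_sym: "split F a x \<Longrightarrow> split F x a"
  unfolding split_def by (metis Un_commute Int_commute)

lemma proj_in_span_iff: "proj g v \<in> span (proj g ` C) \<longleftrightarrow> v \<in> span (insert g C)"
proof -
  have "proj g x = 0 \<longleftrightarrow> x \<in> span {g}" for x by (auto simp: proj_eq_0_iff span_1)
  from mem_span_image_iff[OF additive_proj this, of v C] show ?thesis by simp
qed

lemma linked_ctr:
  assumes "linked (ctr g F) (proj g a) (proj g x)" "g \<in> F"
  shows "linked F a x"
proof -
  obtain C z where *: "C \<subseteq> ctr g F" "z \<in> ctr g F" "z + proj g a + proj g x \<in> span C"
    "proj g a \<notin> span C" "proj g x \<notin> span C" "proj g a + proj g x \<notin> span C"
    using assms unfolding linked_def by blast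
  then obtain C0 where C0: "C0 \<subseteq> F" "C = proj g ` C0" by (metis Diff_subset subset_imageE subset_trans)
  obtain z0 where z0: "z0 \<in> F" "z = proj g z0" using * by blast
  show ?thesis unfolding linked_def
    using * C0 z0 \<open>g \<in> F\<close> unfolding C0 z0 proj_add[symmetric] proj_in_span_iff
    by (intro exI[of _ "insert g C0"] exI[of _ z0]) auto
qed

text \<open>The summand of \<open>g\<close> is merged with \<open>Y\<close>, which gives
  \<open>?Z\<close>. If \<open>w = u + v\<close> lies in \<open>X1 \<inter> X\<close> as well, then
  \<open>v\<close> is in \<open>X \<inter> Y\<close>, hence is \<open>0\<close> or \<open>g\<close>
  and belongs to \<open>X2\<close>; so \<open>w\<close> is in \<open>X1 \<inter> X2\<close>.\<close>

lemma split_extend: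
  assumes X: "subspace X" and Y: "subspace Y" and F: "F \<subseteq> X \<union> Y" and g: "X \<inter> Y \<subseteq> {0, g}"
    and x: "x \<in> Y" and s: "split (F \<inter> X) a g" and a: "a \<in> X"
  shows "split F a x"
proof -
  obtain X1 X2 where s: "subspace X1" "subspace X2" "F \<inter> X \<subseteq> X1 \<union> X2" "X1 \<inter> X2 = {0}" "a \<in> X1" "g \<in> X2"
    using s unfolding split_def by blast
  let ?Z = "{u + v | u v. u \<in> X2 \<inter> X \<and> v \<in> Y}"
  have Z: "subspace ?Z" using bv.subspace_sums[of "X2 \<inter> X" Y] bv.subspace_inter s X Y by blast
  have "X2 \<inter> X \<subseteq> ?Z" "Y \<subseteq> ?Z"
    using subspace_0[OF Y] subspace_0[OF X] subspace_0[OF s(2)]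
    by (blast intro: add_0_right[symmetric] add_0[symmetric])+
  have "(X1 \<inter> X) \<inter> ?Z \<subseteq> {0}"
  proof
    fix w assume "w \<in> (X1 \<inter> X) \<inter> ?Z"
    then obtain u v where w: "w = u + v" "u \<in> X2" "u \<in> X" "v \<in> Y" "w \<in> X1" "w \<in> X" by blast
    then have "v \<in> X" using subspace_add_iff[OF X] by metis
    then have "v \<in> X2" using w g s(6) subspace_0[OF s(2)] by auto
    then have "w \<in> X2" using w subspace_add[OF s(2)] by blast
    then show "w \<in> {0}" using w s(4) by blast
  qed
  moreover have "F \<subseteq> (X1 \<inter> X) \<union> ?Z" using F s(3) \<open>X2 \<inter> X \<subseteq> ?Z\<close> \<open>Y \<subseteq> ?Z\<close> by blast
  moreover have "a \<in> X1 \<inter> X" "x \<in> ?Z" using s a x \<open>Y \<subseteq> ?Z\<close> by blast+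
  ultimately show ?thesis using Z bv.subspace_inter[OF s(1) X] by (intro splitI)
qed

text \<open>Circuits on the two sides are joined at \<open>g\<close>, as in a 2-sum. Contracting
  \<open>C\<close>, \<open>D\<close> and the third point \<open>z\<close> of the first line turns
  \<open>t\<close> into the third point of the line through \<open>a\<close> and \<open>x\<close>,
  because \<open>g\<close> cancels from the two dependencies. Nothing degenerates: a dependency can
  cross from \<open>Y\<close> to \<open>X\<close> only through \<open>0\<close> or \<open>g\<close>,
  and the choice of \<open>C\<close> and \<open>D\<close> excludes both.\<close>

lemma linked_trans:
  assumes X: "subspace X" and Y: "subspace Y" and g: "X \<inter> Y \<subseteq> {0, g}"
    and a: "a \<in> X" and x: "x \<in> Y"
    and l: "linked (F \<inter> X) a g" "linked (F \<inter> Y) x g"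
  shows "linked F a x"
proof -
  obtain C z where C: "C \<subseteq> F \<inter> X" "z \<in> F \<inter> X" "z + a + g \<in> span C"
    "a \<notin> span C" "g \<notin> span C" "a + g \<notin> span C"
    using l unfolding linked_def by blast
  obtain D t where D: "D \<subseteq> F \<inter> Y" "t \<in> F \<inter> Y" "t + x + g \<in> span D"
    "x \<notin> span D" "g \<notin> span D" "x + g \<notin> span D"
    using l unfolding linked_def by blast
  have CX: "span C \<subseteq> X" and DY: "span D \<subseteq> Y" using C D X Y span_subset by blast+
  let ?S = "span (insert z (C \<union> D))"
  note addS = span_add[of _ "insert z (C \<union> D)"]
  have sub: "span C \<subseteq> ?S" "span D \<subseteq> ?S" "z \<in> ?S" by (auto intro: bv.span_mono[THEN subsetD] bv.span_base)
  have dec: "\<exists>c d. c \<in> span C \<and> d \<in> span D \<and> (w = c + d \<or> w = c + z + d)" if w: "w \<in> ?S" for w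
  proof -
    have "w \<in> span (C \<union> D) \<or> w + z \<in> span (C \<union> D)" using w by (simp add: span_insert)
    then obtain c d where cd: "c \<in> span C" "d \<in> span D" "w = c + d \<or> w + z = c + d"
      by (auto simp: bv.span_Un)
    have "w = c + z + d" if "w + z = c + d" using that
      by (metis add.assoc add.commute bvec_add_self_left)
    then show ?thesis using cd by blast
  qed
  have xd: "x + d \<notin> X" if d: "d \<in> span D" for d
  proof
    assume "x + d \<in> X"
    moreover have "x + d \<in> Y" using d DY x subspace_add[OF Y] by blast
    ultimately have "x + d = 0 \<or> x + d = g" using g by blast
    then have "d = x \<or> d = x + g" by (metis bvec_add_eq_0_iff bvec_add_eq_iff)
    then show False using d D by blast
  qed
  have "a \<notin> ?S"
  proof
    assume "a \<in> ?S"
    then obtain c d where cd: "c \<in> span C" "d \<in> span D" "a = c + d \<or> a = c + z + d" using dec by blast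
    then have "d = c + a \<or> d = c + z + a" by (metis bvec_add_eq_iff)
    then have "d \<in> X" using cd(1) CX C(2) a subspace_add[OF X] by blast
    then have "d = 0" using cd(2) DY g D(5) by blast
    then have "a = c \<or> a + z = c" using cd(3) by (metis add.right_neutral add.commute bvec_add_self_left)
    moreover have "a \<noteq> c" using cd C by blast
    ultimately have "a + z \<in> span C" using cd by blast
    moreover have "(a + z) + g \<in> span C" using C(3) by (simp add: bvec_ac)
    ultimately have "g \<in> span C" using span_add_iff by blast
    then show False using C by blast
  qed
  moreover have "x \<notin> ?S"
  proof
    assume "x \<in> ?S"
    then obtain c d where cd: "c \<in> span C" "d \<in> span D" "x = c + d \<or> x = c + z + d" using dec by blast
    then have "x + d = c \<or> x + d = c + z" by (metis add.commute bvec_add_self_left)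
    then have "x + d \<in> X" using cd(1) CX C(2) subspace_add[OF X] by (metis IntD2 subsetD)
    then show False using xd cd by blast
  qed
  moreover have "a + x \<notin> ?S"
  proof
    assume "a + x \<in> ?S"
    then obtain c d where cd: "c \<in> span C" "d \<in> span D" "a + x = c + d \<or> a + x = c + z + d" using dec by blast
    have *: "x + d = a + w" if "a + x = w + d" for w
      using that by (metis add.assoc add.commute bvec_add_self_left)
    have "x + d = a + c \<or> x + d = a + (c + z)" using cd(3) * by blast
    moreover have "a + c \<in> X" "a + (c + z) \<in> X" using cd(1) CX C(2) a subspace_add[OF X] by blast+
    ultimately have "x + d \<in> X" by metis
    then show False using xd cd by blast
  qed
  moreover have "t + a + x \<in> ?S"
  proof -
    have "(z + a + g) + (t + x + g) \<in> ?S" using C(3) D(3) sub by (intro addS[of "z + a + g" "t + x + g"]) blast+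
    then have "z + ((z + a + g) + (t + x + g)) \<in> ?S" using sub(3) by (rule addS[rotated])
    then show ?thesis by (simp add: bvec_ac)
  qed
  ultimately show ?thesis unfolding linked_def using C D
    by (intro exI[of _ "insert z (C \<union> D)"] exI[of _ t]) blast
qed

text \<open>The linear form of the fact that two elements of one component lie on a common circuit.
  A third element \<open>g\<close> is contracted. A link lifts directly. A splitting lifts to two
  sides meeting in at most \<open>{0, g}\<close>; by induction each side either separates its
  element from \<open>g\<close>, which extends to a splitting of \<open>F\<close>, or links it to
  \<open>g\<close>, and two links combine.\<close>

lemma linked_or_split:
  "\<lbrakk>finite F; 0 \<notin> F; a \<in> F; x \<in> F; a \<noteq> x\<rbrakk> \<Longrightarrow> linked F a x \<or> split F a x"
proof (induction "card F" arbitrary: F a x rule: less_induct)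
  case less
  consider "a + x \<in> F" | "F = {a, x}" | g where "g \<in> F" "g \<noteq> a" "g \<noteq> x" "a + x \<notin> F"
    using less.prems by blast
  then show ?case
  proof cases
    case 1
    have "a + x + a + x = 0" by (simp add: bvec_ac)
    then have "linked F a x" unfolding linked_def using 1 less.prems
      by (intro exI[of _ "{}"] exI[of _ "a + x"]) auto
    then show ?thesis ..
  next
    case 2
    then have "split F a x" using less.prems by (intro splitI[of "{0, a}" "{0, x}"]) (auto simp: subspace_iff)
    then show ?thesis ..
  next
    case 3
    have "a + x \<noteq> g" using 3 by blast
    then have ne: "proj g a \<noteq> proj g x" using less.prems by (simp add: proj_eq_iff)
    have nz: "proj g a \<noteq> 0" "proj g x \<noteq> 0" using 3 less.prems by (metis proj_eq_0_iff)+
    have "linked (ctr g F) (proj g a) (proj g x) \<or> split (ctr g F) (proj g a) (proj g x)"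
      using less.prems 3 nz ne card_ctr[of F g] by (intro less.hyps) auto
    then show ?thesis
    proof
      assume "linked (ctr g F) (proj g a) (proj g x)"
      then show ?thesis using linked_ctr 3 by blast
    next
      assume "split (ctr g F) (proj g a) (proj g x)"
      then obtain X' Y' where s: "subspace X'" "subspace Y'" "ctr g F \<subseteq> X' \<union> Y'" "X' \<inter> Y' = {0}"
        "proj g a \<in> X'" "proj g x \<in> Y'" unfolding split_def by blast
      define X Y where "X = proj g -` X'" and "Y = proj g -` Y'"
      have XY: "subspace X" "subspace Y" using s subspace_vimage[OF additive_proj] X_def Y_def by auto
      have Int: "X \<inter> Y \<subseteq> {0, g}"
      proof
        fix w assume "w \<in> X \<inter> Y"
        then have "proj g w = 0" using s(4) unfolding X_def Y_def by blast
        then show "w \<in> {0, g}" by (simp add: proj_eq_0_iff)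
      qed
      have cov: "F \<subseteq> X \<union> Y" using s(3) subspace_0[OF s(1)] by (auto simp: X_def Y_def)
      have mem: "a \<in> X" "x \<in> Y" "g \<in> X" "g \<in> Y"
        using s subspace_0[OF s(1)] subspace_0[OF s(2)] by (auto simp: X_def Y_def)
      have nmem: "a \<notin> Y" "x \<notin> X" using mem Int less.prems 3 by blast+
      have "card (F \<inter> X) < card F" "card (F \<inter> Y) < card F"
        using nmem less.prems by (auto intro!: psubset_card_mono)
      then have "linked (F \<inter> X) a g \<or> split (F \<inter> X) a g" "linked (F \<inter> Y) x g \<or> split (F \<inter> Y) x g"
        using less.hyps[of "F \<inter> X" a g] less.hyps[of "F \<inter> Y" x g] less.prems 3 mem by blast+
      moreover have "split F a x" if "split (F \<inter> X) a g"
        using split_extend[OF XY cov Int mem(2) that mem(1)] .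
      moreover have "split F a x" if "split (F \<inter> Y) x g"
      proof -
        have "F \<subseteq> Y \<union> X" "Y \<inter> X \<subseteq> {0, g}" using cov Int by auto
        from split_extend[OF XY(2,1) this mem(1) that mem(2)] show ?thesis by (rule split_sym)
      qed
      moreover have "linked F a x" if "linked (F \<inter> X) a g" "linked (F \<inter> Y) x g"
        using linked_trans[OF XY Int mem(1,2) that] .
      ultimately show ?thesis by blast
    qed
  qed
qed

subsection \<open>Minimal separators are complete\<close>

text \<open>The subspaces \<open>A1\<close>, \<open>B1\<close>, \<open>B2\<close>, \<open>A2\<close>
  form a cycle whose consecutive members share \<open>x\<close>, \<open>b\<close>, \<open>y\<close>,
  \<open>a\<close>, and each \<open>ci\<close> stands for a combination of contracted elements in
  one of them. Moving all terms of \<open>W1\<close> to one side puts the rest into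
  \<open>W1 \<inter> W2\<close>, where only \<open>0\<close>, \<open>a\<close>, \<open>b\<close>,
  \<open>a + b\<close> are available.\<close>

lemma four_cycle_aux:
  assumes sub: "subspace W1" "subspace W2" "subspace A1" "subspace B1" "subspace A2" "subspace B2"
    and le: "A1 \<subseteq> W1" "B1 \<subseteq> W1" "A2 \<subseteq> W2" "B2 \<subseteq> W2"
    and W: "W1 \<inter> W2 \<subseteq> {0, a, b, a + b}" and I1: "A1 \<inter> B1 \<subseteq> {0, x}" and I2: "A2 \<inter> B2 \<subseteq> {0, y}"
    and mem: "a \<in> A1" "a \<in> A2" "b \<in> B1" "b \<in> B2" "x \<in> A1" "x \<in> B1" "y \<in> A2" "y \<in> B2"
    and c: "c1 \<in> A1" "c2 \<in> B1" "c3 \<in> A2" "c4 \<in> B2"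
    and c2: "c2 \<notin> {b, x, b + x}"
    and c3: "c3 \<notin> {a, y, a + y}"
    and c4: "c4 \<notin> {b, y, b + y}"
    and v: "v \<in> A1"
  shows "v + a + b \<noteq> c1 + c2 + c3 + c4" "v + x + y \<noteq> c1 + c2 + c3 + c4" "v + a + b + x + y \<noteq> c1 + c2 + c3 + c4"
proof -
  note addA1 = subspace_add[OF sub(3)] and addB1 = subspace_add[OF sub(4)]
    and addA2 = subspace_add[OF sub(5)] and addB2 = subspace_add[OF sub(6)]
    and addW1 = subspace_add[OF sub(1)] and addW2 = subspace_add[OF sub(2)]
  have A2B2: "p = 0 \<or> p = y" if "p \<in> A2" "q \<in> B2" "p = q" for p q using that I2 by blast
  \<comment> \<open>Each of the four possible values of \<open>c3 + d\<close> yields a vector common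
    to \<open>A2\<close> and \<open>B2\<close>, hence \<open>0\<close> or \<open>y\<close>. This
    makes \<open>c3\<close> or \<open>d\<close> one of the excluded vectors, except when both are
    \<open>0\<close>.\<close>
  have F1: "c3 = 0 \<and> d = 0" if h: "c3 + d \<in> W1" and d: "d \<in> B2" "d \<notin> {b, b + y}" for d
  proof -
    have h2: "c3 + d \<in> W2" using c d le by (intro addW2) blast+
    consider "c3 + d = 0" | "c3 + d = a" | "c3 + d = b" | "c3 + d = a + b"
      using subsetD[OF W IntI[OF h h2]] by (elim insertE emptyE; simp only:)
    then show ?thesis
    proof cases
      case 1
      then have "c3 = d" by simp
      then show ?thesis using A2B2[OF c(3) d(1)] c3 by auto
    next
      case 2
      then have "a + c3 = d" by (metis add.commute bvec_add_eq_iff)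
      then have "a + c3 = 0 \<or> a + c3 = y" using A2B2[OF addA2[OF mem(2) c(3)] d(1)] by blast
      then show ?thesis using c3 by (auto simp: bvec_add_eq_iff)
    next
      case 3
      then have "c3 = b + d" by (metis add.commute bvec_add_eq_iff)
      then have "b + d = 0 \<or> b + d = y" using A2B2[OF c(3) addB2[OF mem(4) d(1)]] by metis
      then show ?thesis using d(2) by (auto simp: bvec_add_eq_iff)
    next
      case 4
      then have "a + c3 = b + d" by (metis add.commute add.left_commute bvec_add_eq_iff)
      then have "a + c3 = 0 \<or> a + c3 = y" using A2B2[OF addA2[OF mem(2) c(3)] addB2[OF mem(4) d(1)]] by metis
      then show ?thesis using c3 by (auto simp: bvec_add_eq_iff)
    qed
  qed
  have F2: False if h: "y + c3 + c4 \<in> W1"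
  proof -
    have "c3 + (y + c4) \<in> W1" using h by (simp only: bvec_ac)
    moreover have "y + c4 \<notin> {b, b + y}" using c4 by (auto simp: bvec_add_eq_iff bvec_ac)
    ultimately have "y + c4 = 0" using F1[of "y + c4"] addB2[OF mem(8) c(4)] by blast
    then show False using c4 by simp
  qed
  show "v + a + b \<noteq> c1 + c2 + c3 + c4"
  proof
    assume e: "v + a + b = c1 + c2 + c3 + c4"
    then have "c3 + c4 = v + a + b + c1 + c2" by (simp add: bvec_ac)
    moreover have "v + a + b + c1 + c2 \<in> W1" using v mem c le by (intro addW1) blast+
    ultimately have "c3 = 0 \<and> c4 = 0" using F1[of c4] c(4) c4 by auto
    then have "v + a + b = c1 + c2" using e by simp
    then have e': "v + a + c1 = b + c2" by (metis add.commute add.left_commute bvec_add_eq_iff)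
    have "v + a + c1 \<in> A1" "b + c2 \<in> B1" using v mem c by (intro addA1 addB1; blast)+
    then have "b + c2 = 0 \<or> b + c2 = x" using e' I1 by (metis IntI insertE singletonD subsetD)
    then show False using c2 by (auto simp: bvec_add_eq_iff)
  qed
  show "v + x + y \<noteq> c1 + c2 + c3 + c4"
  proof
    assume e: "v + x + y = c1 + c2 + c3 + c4"
    have "y + c3 + c4 = (v + x + y) + v + x + c3 + c4" by (simp add: bvec_ac)
    then have "y + c3 + c4 = v + x + c1 + c2" unfolding e by (simp add: bvec_ac)
    moreover have "v + x + c1 + c2 \<in> W1" using v mem c le by (intro addW1) blast+
    ultimately show False using F2 by metis
  qed
  show "v + a + b + x + y \<noteq> c1 + c2 + c3 + c4"
  proof
    assume e: "v + a + b + x + y = c1 + c2 + c3 + c4"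
    have "y + c3 + c4 = (v + a + b + x + y) + v + a + b + x + c3 + c4" by (simp add: bvec_ac)
    then have "y + c3 + c4 = v + a + b + x + c1 + c2" unfolding e by (simp add: bvec_ac)
    moreover have "v + a + b + x + c1 + c2 \<in> W1" using v mem c le by (intro addW1) blast+
    ultimately show False using F2 by metis
  qed
qed

text \<open>Modulo the contracted set \<open>C\<close> the third points become
  \<open>z1 = a + x\<close>, \<open>z2 = b + x\<close>, \<open>z3 = a + y\<close>,
  \<open>z4 = b + y\<close>. Their sum vanishes, and the diagonals are \<open>a + b\<close>,
  \<open>x + y\<close> and \<open>a + b + x + y\<close>; the fact \<open>key\<close> keeps them
  nonzero and away from every element of \<open>E\<close>.\<close>

lemma four_cycle_not_bad_free:
  assumes E: "finite E" "E \<subseteq> W1 \<union> W2" "E \<subseteq> A \<union> B"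
    and sub: "subspace W1" "subspace W2" "subspace A" "subspace B"
    and W: "W1 \<inter> W2 \<subseteq> {0, a, b, a + b}" and I1: "W1 \<inter> A \<inter> (W1 \<inter> B) \<subseteq> {0, x}" and I2: "W2 \<inter> A \<inter> (W2 \<inter> B) \<subseteq> {0, y}"
    and mem: "a \<in> W1 \<inter> W2 \<inter> A" "b \<in> W1 \<inter> W2 \<inter> B" "x \<in> W1 \<inter> A \<inter> B" "y \<in> W2 \<inter> A \<inter> B"
    and link: "linked (E \<inter> (W1 \<inter> A)) a x" "linked (E \<inter> (W1 \<inter> B)) b x" "linked (E \<inter> (W2 \<inter> A)) a y" "linked (E \<inter> (W2 \<inter> B)) b y"
  shows "\<not> bad_free E"
proof -
  let ?A1 = "W1 \<inter> A" and ?B1 = "W1 \<inter> B" and ?A2 = "W2 \<inter> A" and ?B2 = "W2 \<inter> B"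
  have sub': "subspace ?A1" "subspace ?B1" "subspace ?A2" "subspace ?B2"
    using sub bv.subspace_inter by blast+
  obtain C1 z1 where 1: "C1 \<subseteq> E \<inter> ?A1" "z1 \<in> E" "z1 + a + x \<in> span C1" "a \<notin> span C1" "x \<notin> span C1" "a + x \<notin> span C1"
    using link(1) unfolding linked_def by blast
  obtain C2 z2 where 2: "C2 \<subseteq> E \<inter> ?B1" "z2 \<in> E" "z2 + b + x \<in> span C2" "b \<notin> span C2" "x \<notin> span C2" "b + x \<notin> span C2"
    using link(2) unfolding linked_def by blast
  obtain C3 z3 where 3: "C3 \<subseteq> E \<inter> ?A2" "z3 \<in> E" "z3 + a + y \<in> span C3" "a \<notin> span C3" "y \<notin> span C3" "a + y \<notin> span C3"
    using link(3) unfolding linked_def by blast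
  obtain C4 z4 where 4: "C4 \<subseteq> E \<inter> ?B2" "z4 \<in> E" "z4 + b + y \<in> span C4" "b \<notin> span C4" "y \<notin> span C4" "b + y \<notin> span C4"
    using link(4) unfolding linked_def by blast
  define C where "C = C1 \<union> C2 \<union> C3 \<union> C4"
  have C: "C \<subseteq> E" "finite C" using 1 2 3 4 E finite_subset[of C E] unfolding C_def by auto
  have spC: "span C1 \<subseteq> span C" "span C2 \<subseteq> span C" "span C3 \<subseteq> span C" "span C4 \<subseteq> span C"
    unfolding C_def by (intro bv.span_mono; blast)+
  have in_sub: "span C1 \<subseteq> ?A1" "span C2 \<subseteq> ?B1" "span C3 \<subseteq> ?A2" "span C4 \<subseteq> ?B2"
    using 1(1) 2(1) 3(1) 4(1) by (intro span_subset sub'; blast)+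
  have key: "v + a + b \<notin> span C \<and> v + x + y \<notin> span C \<and> v + a + b + x + y \<notin> span C" if v: "v \<in> insert 0 E" for v
  proof -
    have ne: "v + a + b \<noteq> c1 + c2 + c3 + c4 \<and> v + x + y \<noteq> c1 + c2 + c3 + c4 \<and> v + a + b + x + y \<noteq> c1 + c2 + c3 + c4"
      if c: "c1 \<in> span C1" "c2 \<in> span C2" "c3 \<in> span C3" "c4 \<in> span C4" for c1 c2 c3 c4
    proof -
      have cm: "c1 \<in> ?A1" "c2 \<in> ?B1" "c3 \<in> ?A2" "c4 \<in> ?B2" using c in_sub by blast+
      have c1: "c1 \<notin> {a, x, a + x}" "c1 \<notin> {x, a, x + a}" using c 1 by (auto simp: add.commute)
      have c2: "c2 \<notin> {b, x, b + x}" "c2 \<notin> {x, b, x + b}" using c 2 by (auto simp: add.commute)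
      have c3: "c3 \<notin> {a, y, a + y}" "c3 \<notin> {y, a, y + a}" using c 3 by (auto simp: add.commute)
      have c4: "c4 \<notin> {b, y, b + y}" "c4 \<notin> {y, b, y + b}" using c 4 by (auto simp: add.commute)
      have W': "W1 \<inter> W2 \<subseteq> {0, b, a, b + a}" "W2 \<inter> W1 \<subseteq> {0, a, b, a + b}" "W2 \<inter> W1 \<subseteq> {0, b, a, b + a}"
        using W by (auto simp: add.commute)
      have I': "?B1 \<inter> ?A1 \<subseteq> {0, x}" "?B2 \<inter> ?A2 \<subseteq> {0, y}" using I1 I2 by blast+
      have m: "a \<in> ?A1" "a \<in> ?A2" "b \<in> ?B1" "b \<in> ?B2" "x \<in> ?A1" "x \<in> ?B1" "y \<in> ?A2" "y \<in> ?B2"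
        using mem by blast+
      have le: "?A1 \<subseteq> W1" "?B1 \<subseteq> W1" "?A2 \<subseteq> W2" "?B2 \<subseteq> W2" by blast+
      have "0 \<in> ?A1" using sub' subspace_0 by blast
      \<comment> \<open>The four cases are one case up to the symmetries of the cycle that exchange
        \<open>A\<close> with \<open>B\<close> and \<open>W1\<close> with \<open>W2\<close>.\<close>
      then consider "v \<in> ?A1" | "v \<in> ?B1" | "v \<in> ?A2" | "v \<in> ?B2" using v E(2,3) by blast
      then show ?thesis
      proof cases
        case 1
        show ?thesis
          using four_cycle_aux[OF sub(1,2) sub' le W I1 I2 m cm c2(1) c3(1) c4(1) 1] by blast
      next
        case 2
        show ?thesis
          using four_cycle_aux[OF sub(1,2) sub'(2,1,4,3) le(2,1,4,3) W'(1) I' m(3,4,1,2,6,5,8,7) cm(2,1,4,3) c1(1) c4(1) c3(1) 2]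
          by (simp add: bvec_ac)
      next
        case 3
        show ?thesis
          using four_cycle_aux[OF sub(2,1) sub'(3,4,1,2) le(3,4,1,2) W'(2) I2 I1 m(2,1,4,3,7,8,5,6) cm(3,4,1,2) c4(1) c1(1) c2(1) 3]
          by (simp add: bvec_ac)
      next
        case 4
        show ?thesis
          using four_cycle_aux[OF sub(2,1) sub'(4,3,2,1) le(4,3,2,1) W'(3) I'(2,1) m(4,3,2,1,8,7,6,5) cm(4,3,2,1) c3(1) c2(1) c1(1) 4]
          by (simp add: bvec_ac)
      qed
    qed
    have dec: "\<exists>c1 c2 c3 c4. c1 \<in> span C1 \<and> c2 \<in> span C2 \<and> c3 \<in> span C3 \<and> c4 \<in> span C4 \<and> w = c1 + c2 + c3 + c4"
      if "w \<in> span C" for w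
      using that unfolding C_def bv.span_Un by blast
    show ?thesis using dec ne by blast
  qed
  have z: "z1 + a + x \<in> span C" "z2 + b + x \<in> span C" "z3 + a + y \<in> span C" "z4 + b + y \<in> span C"
    using 1(3) 2(3) 3(3) 4(3) spC by blast+
  note addS = span_add[of _ C]
  show ?thesis
  proof (rule bad_contraction[OF C 1(2) 2(2) 3(2) 4(2)])
    have "((z1 + a + x) + (z2 + b + x)) + ((z3 + a + y) + (z4 + b + y)) \<in> span C"
      by (rule addS[OF addS[OF z(1,2)] addS[OF z(3,4)]])
    then show "z1 + z2 + z3 + z4 \<in> span C" by (simp add: bvec_ac)
    fix v assume v: "v \<in> insert 0 E"
    have eq: "v + a + b = (v + z1 + z2) + ((z1 + a + x) + (z2 + b + x))"
      "v + x + y = (v + z1 + z3) + ((z1 + a + x) + (z3 + a + y))"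
      "v + a + b + x + y = (v + z2 + z3) + ((z2 + b + x) + (z3 + a + y))" by (simp_all add: bvec_ac)
    show "v + z1 + z2 \<notin> span C" using key[OF v] addS[OF _ addS[OF z(1,2)]] unfolding eq(1) by blast
    show "v + z1 + z3 \<notin> span C" using key[OF v] addS[OF _ addS[OF z(1,3)]] unfolding eq(2) by blast
    show "v + z2 + z3 \<notin> span C" using key[OF v] addS[OF _ addS[OF z(2,3)]] unfolding eq(3) by blast
  qed
qed

text \<open>If \<open>E \<inter> X\<close> were a direct sum with \<open>a\<close> and
  \<open>b\<close> in different summands, the summand without \<open>e\<close> could be moved over
  to \<open>Y\<close>. This still separates \<open>e\<close> from \<open>f\<close>, but the new
  intersection contains only one of \<open>a\<close> and \<open>b\<close>, against
  minimality.\<close>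

lemma min_sep_not_split:
  assumes m: "min_sep E e f X Y" and e: "e \<in> E" and U: "X \<inter> Y = {0, a, b, a + b}"
    and ab: "a \<noteq> b" "a \<noteq> 0" "b \<noteq> 0"
  shows "\<not> split (E \<inter> X) a b"
proof
  assume sp: "split (E \<inter> X) a b"
  have s: "sep E e f X Y" using m min_sepD by blast
  then have X: "subspace X" and Y: "subspace Y" and cov: "E \<subseteq> X \<union> Y" and ef: "e \<in> X" "e \<notin> Y" "f \<in> Y" "f \<notin> X"
    by (auto simp: sep_def)
  have main: False if 1: "subspace X1" "subspace X2" "E \<inter> X \<subseteq> X1 \<union> X2" "X1 \<inter> X2 = {0}" "p \<in> X1" "q \<in> X2" "e \<in> X1"
    and pq: "X \<inter> Y = {0, p, q, p + q}" "p \<noteq> q" "q \<noteq> 0" for X1 X2 p q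
  proof -
    let ?Z = "{u + v | u v. u \<in> X2 \<inter> X \<and> v \<in> Y}"
    have Z: "subspace ?Z" using bv.subspace_sums[of "X2 \<inter> X" Y] bv.subspace_inter 1 X Y by blast
    have le: "X2 \<inter> X \<subseteq> ?Z" "Y \<subseteq> ?Z"
      using subspace_0[OF Y] subspace_0[OF X] subspace_0[OF 1(2)]
      by (blast intro: add_0_right[symmetric] add_0[symmetric])+
    have Int: "(X1 \<inter> X) \<inter> ?Z \<subseteq> {0, p}"
    proof
      fix w assume "w \<in> (X1 \<inter> X) \<inter> ?Z"
      then obtain u v where w: "w = u + v" "u \<in> X2" "u \<in> X" "v \<in> Y" "w \<in> X1" "w \<in> X" by blast
      then have "v \<in> X" using subspace_add_iff[OF X] by metis
      then have "v \<in> {0, p, q, p + q}" using w pq by blast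
      then obtain v1 v2 where v: "v = v1 + v2" "v1 \<in> {0, p}" "v2 \<in> {0, q}"
        by (metis add.right_neutral add_0 insertCI insertE singletonD)
      have "w + v1 = u + v2" using w(1) v(1) by (simp add: bvec_ac)
      moreover have "w + v1 \<in> X1" using w v 1 subspace_add[OF 1(1)] subspace_0[OF 1(1)] by blast
      moreover have "u + v2 \<in> X2" using w v 1 subspace_add[OF 1(2)] subspace_0[OF 1(2)] by blast
      ultimately have "w + v1 = 0" using 1(4) by (metis IntI singletonD)
      then show "w \<in> {0, p}" using v by simp
    qed
    have "p \<in> Y" "0 \<in> Y" using pq subspace_0[OF Y] by blast+
    then have pY: "{0, p} \<subseteq> Y" by simp
    define Z' where "Z' = ?Z"
    note ZZ = Z[folded Z'_def] le[folded Z'_def] Int[folded Z'_def]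
    have "e \<in> X1 \<inter> X" using 1(7) ef(1) by (rule IntI)
    moreover have "e \<notin> Z'" using subsetD[OF subset_trans[OF ZZ(4) pY], of e] calculation ef(2) by (metis IntI)
    moreover have "f \<in> Z'" "f \<notin> X1 \<inter> X" using ef ZZ(3) by auto
    moreover have "E \<subseteq> (X1 \<inter> X) \<union> Z'" using cov 1(3) ZZ(2,3) by auto
    ultimately have "sep E e f (X1 \<inter> X) Z'"
      unfolding sep_def using ZZ(1) bv.subspace_inter[OF 1(1) X] by (metis DiffI)
    moreover have "(X1 \<inter> X) \<inter> Z' \<subseteq> X \<inter> Y" using subset_trans[OF ZZ(4) pY] by auto
    ultimately have "(X1 \<inter> X) \<inter> Z' = X \<inter> Y" by (rule min_sepD(2)[OF m])
    moreover have "q \<in> X \<inter> Y" unfolding pq(1) by simp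
    ultimately have "q \<in> {0, p}" using ZZ(4) by (metis subsetD)
    then show False using pq by blast
  qed
  obtain X1 X2 where X12: "subspace X1" "subspace X2" "E \<inter> X \<subseteq> X1 \<union> X2" "X1 \<inter> X2 = {0}" "a \<in> X1" "b \<in> X2"
    using sp unfolding split_def by blast
  have "e \<in> X1 \<or> e \<in> X2" using X12 e ef by blast
  then show False
  proof
    assume "e \<in> X1" then show False using main[OF X12 _ U] ab by blast
  next
    assume "e \<in> X2"
    moreover have "E \<inter> X \<subseteq> X2 \<union> X1" "X2 \<inter> X1 = {0}" "X \<inter> Y = {0, b, a, b + a}"
      using X12 U by (auto simp: add.commute)
    ultimately show False using main[OF X12(2,1) _ _ X12(6,5)] ab by blast
  qed
qed

text \<open>If the piece in \<open>A\<close> split \<open>a\<close> from \<open>x\<close>, then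
  joining the summand of \<open>x\<close> to \<open>X \<inter> B\<close> would split
  \<open>a\<close> from \<open>b\<close> in all of \<open>E \<inter> X\<close>, since the two pieces
  meet only in \<open>{0, x}\<close>.\<close>

lemma min_sep_piece_linked:
  assumes E: "finite E" "0 \<notin> E" and X: "subspace X" and AB: "subspace A" "subspace B" "E \<subseteq> A \<union> B"
    and I: "X \<inter> A \<inter> (X \<inter> B) \<subseteq> {0, x}" and mem: "a \<in> E" "x \<in> E" "a \<in> X \<inter> A" "b \<in> X \<inter> B" "x \<in> X \<inter> A \<inter> B"
    and ne: "a \<noteq> x" and ns: "\<not> split (E \<inter> X) a b"
  shows "linked (E \<inter> (X \<inter> A)) a x"
proof (rule ccontr)
  assume "\<not> linked (E \<inter> (X \<inter> A)) a x"
  then have "split (E \<inter> (X \<inter> A)) a x"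
    using linked_or_split[of "E \<inter> (X \<inter> A)" a x] E mem ne by blast
  moreover have "E \<inter> (X \<inter> A) = E \<inter> X \<inter> (X \<inter> A)" by blast
  ultimately have "split (E \<inter> X \<inter> (X \<inter> A)) a x" by metis
  then have "split (E \<inter> X) a b"
    using split_extend[of "X \<inter> A" "X \<inter> B" "E \<inter> X" x b a] bv.subspace_inter[OF X] AB I mem by blast
  then show False using ns by blast
qed

text \<open>In the remaining case a second minimal separator \<open>?Q\<close>, of \<open>a\<close>
  from \<open>b\<close>, has to leave both \<open>X\<close> and \<open>Y\<close>. It cannot be
  complete, as it would then be a subspace covered by \<open>X\<close> and \<open>Y\<close> without
  lying in either. So it is again of the exceptional kind, with one element on each side, and the
  four-cycle closes.\<close>

theorem min_sep_complete:
  "\<lbrakk>finite E; 0 \<notin> E; bad_free E; e \<in> E; f \<in> E; min_sep E e f X Y\<rbrakk> \<Longrightarrow> X \<inter> Y - {0} \<subseteq> E"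
proof (induction "card E" arbitrary: E e f X Y rule: less_induct)
  case less
  note E = less.prems(1,2,3)
  \<comment> \<open>Stated for arbitrary pairs within the same \<open>E\<close>, because it is
    applied to \<open>e\<close>, \<open>f\<close> and then again to \<open>a\<close>,
    \<open>b\<close>.\<close>
  have dich: "X \<inter> Y - {0} \<subseteq> E \<or> (\<exists>a b. a \<in> E \<and> b \<in> E \<and> a \<noteq> b \<and> a + b \<notin> E \<and> X \<inter> Y = {0, a, b, a + b})"
    if ef: "e \<in> E" "f \<in> E" and m: "min_sep E e f X Y" for e f X Y
  proof -
    have s: "sep E e f X Y" using m min_sepD by blast
    then have sub: "subspace (X \<inter> Y)" "subspace X" "subspace Y" and ne: "e \<notin> X \<inter> Y" "f \<notin> X \<inter> Y"
      unfolding sep_def using bv.subspace_inter by blast+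
    have mod: "x \<in> E \<or> x + g \<in> E" if g: "g \<in> E \<inter> (X \<inter> Y)" and x: "x \<in> X \<inter> Y" "x \<noteq> 0" "x \<noteq> g" for g x
    proof -
      have "e \<noteq> 0" "f \<noteq> 0" "e \<noteq> g" "f \<noteq> g" using ef E ne g by blast+
      then have "proj g e \<in> ctr g E" "proj g f \<in> ctr g E" using ef by (auto simp: proj_eq_0_iff)
      then have "proj g ` X \<inter> proj g ` Y - {0} \<subseteq> ctr g E"
        using less.hyps[OF card_ctr _ _ _ _ _ min_sep_contract[OF m]] E g bad_free_ctr[OF E(3)] by auto
      moreover have "proj g x \<in> proj g ` X \<inter> proj g ` Y - {0}" using x by (auto simp: proj_eq_0_iff)
      ultimately obtain h where "h \<in> E" "proj g x = proj g h" by auto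
      then show ?thesis by (metis proj_eq_iff bvec_add_eq_iff add.commute)
    qed
    have "E \<inter> (X \<inter> Y) = {} \<Longrightarrow> X \<inter> Y = {0}" using min_sep_empty[OF m E(1) ef _ E(3)] .
    then show ?thesis
      using complete_mod_points[OF sub(1) E(2) bad_free_not_bad[OF E(3,2)] mod] by auto
  qed
  show ?case
  proof (rule ccontr)
    assume "\<not> X \<inter> Y - {0} \<subseteq> E"
    then obtain a b where ab: "a \<in> E" "b \<in> E" "a \<noteq> b" "a + b \<notin> E" and U: "X \<inter> Y = {0, a, b, a + b}"
      using dich[OF less.prems(4,5,6)] by blast
    have nz: "a \<noteq> 0" "b \<noteq> 0" using ab E by blast+
    have s: "sep E e f X Y" using less.prems min_sepD by blast
    then have XY: "subspace X" "subspace Y" "E \<subseteq> X \<union> Y" unfolding sep_def by blast+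
    have nsX: "\<not> split (E \<inter> X) a b" using min_sep_not_split[OF less.prems(6,4) U ab(3) nz] .
    have nsY: "\<not> split (E \<inter> Y) a b"
      using min_sep_not_split[OF min_sep_sym[OF less.prems(6)] less.prems(5) _ ab(3) nz] U by (simp add: Int_commute)
    obtain A0 B0 where "sep E a b A0 B0" using exists_sep[OF E ab] by blast
    then obtain A B where m: "min_sep E a b A B" using exists_min_sep[OF E(1) _ ab(1,2)] by blast
    then have s': "sep E a b A B" using min_sepD by blast
    then have AB: "subspace A" "subspace B" "E \<subseteq> A \<union> B" "a \<in> A" "a \<notin> B" "b \<in> B" "b \<notin> A" unfolding sep_def by blast+
    let ?Q = "A \<inter> B"
    have Q: "subspace ?Q" using AB bv.subspace_inter by blast
    have "a + b \<notin> A" using AB subspace_add_iff by blast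
    then have QU: "?Q \<inter> (X \<inter> Y) \<subseteq> {0}" using U AB by blast
    \<comment> \<open>If \<open>?Q\<close> lay inside one side, it would meet the other side only in
      \<open>0\<close>, and \<open>A\<close>, \<open>B\<close> would cut that other side into a
      direct sum separating \<open>a\<close> from \<open>b\<close>.\<close>
    have nQ: "\<not> ?Q \<subseteq> V" if V: "V' \<inter> V = X \<inter> Y" "subspace V'" "\<not> split (E \<inter> V') a b" for V V'
    proof
      assume "?Q \<subseteq> V"
      then have "(A \<inter> V') \<inter> (B \<inter> V') \<subseteq> {0}" using QU V by blast
      moreover have "a \<in> V'" "b \<in> V'" using V(1) U by blast+
      ultimately have "split (E \<inter> V') a b"
        using AB V(2) bv.subspace_inter by (intro splitI[of "A \<inter> V'" "B \<inter> V'"]) blast+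
      then show False using V by blast
    qed
    have nQX: "\<not> ?Q \<subseteq> X" using nQ[of Y X] XY nsY by blast
    have nQY: "\<not> ?Q \<subseteq> Y" using nQ[of X Y] XY nsX by blast
    from dich[OF ab(1,2) m] show False
    proof (elim disjE exE conjE)
      assume c: "?Q - {0} \<subseteq> E"
      obtain p q where pq: "p \<in> ?Q" "p \<notin> X" "q \<in> ?Q" "q \<notin> Y" using nQX nQY by blast
      have QXY: "?Q \<subseteq> X \<union> Y" using c XY(3) subspace_0[OF XY(1)] by auto
      then have "p \<in> Y" "q \<in> X" using pq by blast+
      moreover have "p + q \<in> X \<union> Y" by (rule subsetD[OF QXY subspace_add[OF Q pq(1,3)]])
      ultimately show False using pq subspace_add_iff[OF XY(1)] subspace_add_iff[OF XY(2)] by (metis UnE add.commute)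
    next
      fix x y assume xy: "x \<in> E" "y \<in> E" "x \<noteq> y" "x + y \<notin> E" "?Q = {0, x, y, x + y}"
      have 0: "0 \<in> X" "0 \<in> Y" using XY subspace_0 by blast+
      have final: False if xy: "x \<in> E" "y \<in> E" "x \<in> X" "x \<notin> Y" "y \<in> Y" "y \<notin> X" "?Q = {0, x, y, x + y}" for x y
      proof -
        have "x + y \<notin> X" "y + x \<notin> Y" using xy subspace_add_iff XY by blast+
        then have I: "X \<inter> A \<inter> (X \<inter> B) \<subseteq> {0, x}" "Y \<inter> A \<inter> (Y \<inter> B) \<subseteq> {0, y}"
          using xy by (auto simp: add.commute)
        then have I': "X \<inter> B \<inter> (X \<inter> A) \<subseteq> {0, x}" "Y \<inter> B \<inter> (Y \<inter> A) \<subseteq> {0, y}" by blast+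
        have mem: "a \<in> X \<inter> Y \<inter> A" "b \<in> X \<inter> Y \<inter> B" "x \<in> X \<inter> A \<inter> B" "y \<in> Y \<inter> A \<inter> B"
          using U AB xy by blast+
        have ns': "\<not> split (E \<inter> X) b a" "\<not> split (E \<inter> Y) b a" using nsX nsY split_sym by blast+
        have BA: "E \<subseteq> B \<union> A" using AB by blast
        have ne: "a \<noteq> x" "a \<noteq> y" "b \<noteq> x" "b \<noteq> y" "x \<noteq> 0" "y \<noteq> 0" using mem xy AB E by blast+
        have l: "linked (E \<inter> (X \<inter> A)) a x" "linked (E \<inter> (X \<inter> B)) b x" "linked (E \<inter> (Y \<inter> A)) a y" "linked (E \<inter> (Y \<inter> B)) b y"
          using min_sep_piece_linked[OF E(1,2) XY(1) AB(1,2,3) I(1) ab(1) xy(1) _ _ _ ne(1) nsX]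
            min_sep_piece_linked[OF E(1,2) XY(1) AB(2,1) BA I'(1) ab(2) xy(1) _ _ _ ne(3) ns'(1)]
            min_sep_piece_linked[OF E(1,2) XY(2) AB(1,2,3) I(2) ab(1) xy(2) _ _ _ ne(2) nsY]
            min_sep_piece_linked[OF E(1,2) XY(2) AB(2,1) BA I'(2) ab(2) xy(2) _ _ _ ne(4) ns'(2)]
            mem by blast+
        have "X \<inter> Y \<subseteq> {0, a, b, a + b}" using U by blast
        from four_cycle_not_bad_free[OF E(1) XY(3) AB(3) XY(1,2) AB(1,2) this I mem l]
        show False using E by blast
      qed
      have "\<not> (x \<in> X \<and> y \<in> X)" "\<not> (x \<in> Y \<and> y \<in> Y)"
        using nQX nQY xy(5) 0 subspace_add[OF XY(1), of x y] subspace_add[OF XY(2), of x y] by auto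
      then have "x \<in> X \<and> x \<notin> Y \<and> y \<in> Y \<and> y \<notin> X \<or> y \<in> X \<and> y \<notin> Y \<and> x \<in> Y \<and> x \<notin> X"
        using xy XY by blast
      moreover have "?Q = {0, y, x, y + x}" using xy(5) by (auto simp: add.commute)
      ultimately show False using final[of x y] final[of y x] xy by blast
    qed
  qed
qed

subsection \<open>Decomposable sets of vectors\<close>

inductive good :: "bvec set \<Rightarrow> bool" where
  complete: "subspace U \<Longrightarrow> finite U \<Longrightarrow> good (U - {0})"
| glue: "subspace X \<Longrightarrow> subspace Y \<Longrightarrow> E \<subseteq> X \<union> Y \<Longrightarrow> X \<inter> Y - {0} \<subseteq> E \<Longrightarrow>
    good (E \<inter> X) \<Longrightarrow> good (E \<inter> Y) \<Longrightarrow> good E"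

lemma bad_free_good: "\<lbrakk>finite E; 0 \<notin> E; bad_free E\<rbrakk> \<Longrightarrow> good E"
proof (induction "card E" arbitrary: E rule: less_induct)
  case less
  show ?case
  proof (cases "\<exists>e\<in>E. \<exists>f\<in>E. e \<noteq> f \<and> e + f \<notin> E")
    case True
    then obtain e f where ef: "e \<in> E" "f \<in> E" "e \<noteq> f" "e + f \<notin> E" by blast
    obtain X Y where m: "min_sep E e f X Y"
      using exists_sep[OF less.prems ef] exists_min_sep[OF less.prems(1) _ ef(1,2)] by blast
    then have s: "sep E e f X Y" using min_sepD by blast
    then have XY: "subspace X" "subspace Y" "E \<subseteq> X \<union> Y" "f \<notin> X" "e \<notin> Y" unfolding sep_def by blast+
    have "card (E \<inter> X) < card E" "card (E \<inter> Y) < card E"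
      using XY ef less.prems by (auto intro!: psubset_card_mono)
    then have "good (E \<inter> X)" "good (E \<inter> Y)"
      using less.hyps[of "E \<inter> X"] less.hyps[of "E \<inter> Y"] less.prems bad_free_Int_subspace XY by auto
    then show ?thesis
      using glue[OF XY(1-3) min_sep_complete[OF less.prems ef(1,2) m]] by blast
  next
    case False
    then have "subspace (insert 0 E)" by (auto simp: subspace_iff)
    then have "good (insert 0 E - {0})" using less.prems by (intro complete) auto
    then show ?thesis using less.prems by simp
  qed
qed

lemma good_finite: "good E \<Longrightarrow> finite E"
proof (induction rule: good.induct)
  case (glue X Y E)
  then show ?case using finite_subset[of E "(E \<inter> X) \<union> (E \<inter> Y)"] by blast
qed auto

lemma good_nonzero: "good E \<Longrightarrow> 0 \<notin> E"
  by (induction rule: good.induct) (auto simp: subspace_0)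

lemma good_Int_subspace: "good E \<Longrightarrow> subspace W \<Longrightarrow> good (E \<inter> W)"
proof (induction rule: good.induct)
  case (complete U)
  have "good (U \<inter> W - {0})" using complete by (intro good.complete bv.subspace_inter) auto
  moreover have "(U - {0}) \<inter> W = U \<inter> W - {0}" by blast
  ultimately show ?case by simp
next
  case (glue X Y E)
  have eq: "E \<inter> W \<inter> (X \<inter> W) = E \<inter> X \<inter> W" "E \<inter> W \<inter> (Y \<inter> W) = E \<inter> Y \<inter> W" by blast+
  have "good (E \<inter> W \<inter> (X \<inter> W))" "good (E \<inter> W \<inter> (Y \<inter> W))"
    unfolding eq using glue.IH glue.prems by blast+
  then show ?case
    by (rule good.glue[of "X \<inter> W" "Y \<inter> W", rotated -2])
      (use glue.hyps glue.prems bv.subspace_inter in auto)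
qed

text \<open>The kernel condition says that \<open>f\<close> contracts elements of \<open>E\<close>.
  It cannot be dropped: four independent vectors projected from their sum become \<open>U34\<close>.
  In a glued set it lets every kernel vector be written as a kernel vector of one side plus one of
  the other, and this passes the condition on to both sides.\<close>

lemma good_image:
  "\<lbrakk>good E; additive f; \<And>x. x \<in> span E \<Longrightarrow> f x = 0 \<Longrightarrow> x \<in> span {e \<in> E. f e = 0}\<rbrakk> \<Longrightarrow> good (f ` E - {0})"
proof (induction rule: good.induct)
  case (complete U)
  have "f ` (U - {0}) - {0} = f ` U - {0}"
  proof -
    have "x \<noteq> 0" if "f x \<noteq> 0" for x using additive_0[OF complete.prems(1)] that by metis
    then show ?thesis by blast
  qed
  then show ?case
    using good.complete[OF subspace_image[OF complete.prems(1) complete.hyps(1)]] complete.hyps(2) by (metis finite_imageI)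
next
  case (glue X Y E)
  note f = glue.prems(1)
  let ?K = "\<lambda>F. {e \<in> F. f e = 0}"
  \<comment> \<open>The image is decomposed along the images of these spans and not of
    \<open>X\<close> and \<open>Y\<close>, because the kernel of \<open>f\<close> is controlled only
    on \<open>span E\<close>.\<close>
  let ?X = "span (E \<inter> X)" and ?Y = "span (E \<inter> Y)"
  have le: "?X \<subseteq> X" "?Y \<subseteq> Y" using span_subset[of "E \<inter> X" X] span_subset[of "E \<inter> Y" Y] glue.hyps by blast+
  have kz: "f k = 0" if "k \<in> span (?K F)" for k F
  proof -
    have "f k \<in> span (f ` ?K F)" using span_image[OF f, of "?K F"] that by blast
    moreover have "span (f ` ?K F) \<subseteq> {0}" by (rule span_subset) auto
    ultimately show ?thesis by blast
  qed
  have KX: "span (?K (E \<inter> X)) \<subseteq> ?X" and KY: "span (?K (E \<inter> Y)) \<subseteq> ?Y"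
    by (rule bv.span_mono, blast)+
  have ker: "\<exists>k1 k2. k1 \<in> span (?K (E \<inter> X)) \<and> k2 \<in> span (?K (E \<inter> Y)) \<and> x = k1 + k2"
    if "x \<in> span E" "f x = 0" for x
  proof -
    have "?K E = ?K (E \<inter> X) \<union> ?K (E \<inter> Y)" using glue.hyps by blast
    then have "x \<in> span (?K (E \<inter> X) \<union> ?K (E \<inter> Y))" using glue.prems(2)[OF that] by metis
    then show ?thesis unfolding bv.span_Un by blast
  qed
  have XE: "?X \<subseteq> span E" and YE: "?Y \<subseteq> span E" by (rule bv.span_mono, blast)+
  have U: "w = 0 \<or> w \<in> E \<inter> X \<inter> Y" if "w \<in> X" "w \<in> Y" for w using that glue.hyps by blast
  have X: "good (f ` (E \<inter> X) - {0})"
  proof (rule glue.IH(1)[OF f])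
    fix x assume x: "x \<in> ?X" "f x = 0"
    then obtain k1 k2 where k: "k1 \<in> span (?K (E \<inter> X))" "k2 \<in> span (?K (E \<inter> Y))" "x = k1 + k2"
      using ker XE by blast
    have "k2 \<in> X" using k x le KX subspace_add_iff[OF glue.hyps(1)] by blast
    then have "k2 \<in> span (?K (E \<inter> X))"
      using U[of k2] k le KY kz[OF k(2)] bv.span_zero bv.span_base[of k2 "?K (E \<inter> X)"] by blast
    then show "x \<in> span (?K (E \<inter> X))" using k span_add by blast
  qed
  have Y: "good (f ` (E \<inter> Y) - {0})"
  proof (rule glue.IH(2)[OF f])
    fix x assume x: "x \<in> ?Y" "f x = 0"
    then obtain k1 k2 where k: "k1 \<in> span (?K (E \<inter> X))" "k2 \<in> span (?K (E \<inter> Y))" "x = k1 + k2"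
      using ker YE by blast
    have "k1 \<in> Y" using k x le KY subspace_add_iff'[OF glue.hyps(2)] by blast
    then have "k1 \<in> span (?K (E \<inter> Y))"
      using U[of k1] k le KX kz[OF k(1)] bv.span_zero bv.span_base[of k1 "?K (E \<inter> Y)"] by blast
    then show "x \<in> span (?K (E \<inter> Y))" using k span_add by blast
  qed
  have fk: "f (x + k) = f x" if "k \<in> span (?K F)" for x k F
    by (simp only: additiveD[OF f] kz[OF that] add_0_right)
  \<comment> \<open>Two preimages of \<open>v\<close>, one from each side, differ by a kernel vector
    \<open>k1 + k2\<close>; correcting each by its own part makes them equal, so \<open>v\<close>
    has a preimage in \<open>X \<inter> Y\<close>.\<close>
  have common: "\<exists>w\<in>E \<inter> X \<inter> Y. v = f w" if xy: "x \<in> ?X" "y \<in> ?Y" "v = f x" "v = f y" "v \<noteq> 0" for x y v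
  proof -
    have "f (x + y) = 0" using additive_eq_iff[OF f, of x y] xy by metis
    moreover have "x + y \<in> span E" using xy XE YE span_add by blast
    ultimately obtain k1 k2 where k: "k1 \<in> span (?K (E \<inter> X))" "k2 \<in> span (?K (E \<inter> Y))" "x + y = k1 + k2"
      using ker by blast
    have eq: "x + k1 = y + k2" using k(3) by (metis add.commute add.left_commute bvec_add_eq_iff)
    have "x + k1 \<in> X" using xy k KX le subspace_add[OF glue.hyps(1)] by blast
    moreover have "x + k1 \<in> Y" unfolding eq using xy k KY le subspace_add[OF glue.hyps(2)] by blast
    moreover have v: "f (x + k1) = v" using fk[OF k(1)] xy by metis
    moreover have "x + k1 \<noteq> 0" using v xy additive_0[OF f] by metis
    ultimately show ?thesis using U by blast
  qed
  have base: "E \<inter> X \<subseteq> ?X" "E \<inter> Y \<subseteq> ?Y" by (rule bv.span_superset)+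
  have E: "E = (E \<inter> X) \<union> (E \<inter> Y)" using glue.hyps by blast
  have "(f ` E - {0}) \<inter> f ` ?X = f ` (E \<inter> X) - {0}"
  proof
    show "(f ` E - {0}) \<inter> f ` ?X \<subseteq> f ` (E \<inter> X) - {0}"
    proof
      fix v assume v: "v \<in> (f ` E - {0}) \<inter> f ` ?X"
      then obtain e x where e: "e \<in> E" "v = f e" "x \<in> ?X" "v = f x" "v \<noteq> 0" by blast
      show "v \<in> f ` (E \<inter> X) - {0}"
      proof (cases "e \<in> X")
        case False
        then have "e \<in> ?Y" using e E base by blast
        then show ?thesis using common[OF e(3) _ e(4,2,5)] e by blast
      qed (use e in blast)
    qed
  qed (use base in blast)
  moreover have "(f ` E - {0}) \<inter> f ` ?Y = f ` (E \<inter> Y) - {0}"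
  proof
    show "(f ` E - {0}) \<inter> f ` ?Y \<subseteq> f ` (E \<inter> Y) - {0}"
    proof
      fix v assume v: "v \<in> (f ` E - {0}) \<inter> f ` ?Y"
      then obtain e x where e: "e \<in> E" "v = f e" "x \<in> ?Y" "v = f x" "v \<noteq> 0" by blast
      show "v \<in> f ` (E \<inter> Y) - {0}"
      proof (cases "e \<in> Y")
        case False
        then have "e \<in> ?X" using e E base by blast
        then show ?thesis using common[OF _ e(3,2,4,5)] e by blast
      qed (use e in blast)
    qed
  qed (use base in blast)
  moreover have "f ` E - {0} \<subseteq> f ` ?X \<union> f ` ?Y" using E base by blast
  moreover have "f ` ?X \<inter> f ` ?Y - {0} \<subseteq> f ` E - {0}" using common by blast
  ultimately show ?case
    using good.glue[OF subspace_image[OF f bv.subspace_span] subspace_image[OF f bv.subspace_span], of "f ` E - {0}" "E \<inter> X" "E \<inter> Y"] X Y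
    by metis
qed

text \<open>If \<open>n\<close> is in exactly one of \<open>X\<close> and \<open>Y\<close>, both
  pairs lie in that side and it is bad already. So \<open>n\<close> is in neither, and each pair has
  one member in \<open>X\<close> and the other in \<open>Y\<close>. Then one of
  \<open>s + t\<close>, \<open>s + t + n\<close> is both a sum within \<open>X\<close> and a sum
  within \<open>Y\<close>, hence an element of \<open>E\<close>. So is its partner, and a side
  containing the partner contains \<open>n\<close>.\<close>

lemma good_not_bad: "good E \<Longrightarrow> \<not> bad E"
proof (induction rule: good.induct)
  case (complete U)
  show ?case
  proof
    assume "bad (U - {0})"
    then obtain s n where "s \<in> U" "s + n \<in> U" "n \<notin> U - {0}" "n \<noteq> 0" unfolding bad_def by blast
    then show False using subspace_add_iff[OF complete(1)] by blast
  qed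
next
  case (glue X Y E)
  note addX = subspace_add[OF glue.hyps(1)] and addY = subspace_add[OF glue.hyps(2)]
  note iffX = subspace_add_iff[OF glue.hyps(1)] and iffY = subspace_add_iff[OF glue.hyps(2)]
  have U: "w \<in> E" if "w \<in> X" "w \<in> Y" "w \<noteq> 0" for w using that glue.hyps by blast
  show ?case
  proof
    assume "bad E"
    then obtain s t n where b: "s \<in> E" "s + n \<in> E" "t \<in> E" "t + n \<in> E" "n \<notin> E" "n \<noteq> 0"
      "t \<noteq> s" "t \<noteq> s + n" "s + t \<in> E \<longleftrightarrow> s + t + n \<in> E" unfolding bad_def by blast
    have cov: "w \<in> X \<or> w \<in> Y" if "w \<in> E" for w using that glue.hyps by blast
    have nX: "s + t \<in> X" "s + t + n \<in> X" if "s \<in> X" "t \<in> X" "n \<in> X" using that addX by blast+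
    have nY: "s + t \<in> Y" "s + t + n \<in> Y" if "s \<in> Y" "t \<in> Y" "n \<in> Y" using that addY by blast+
    have no3: False if "s \<in> X" "t \<in> X" "n \<in> X"
      using glue.IH(1) badI[of s "E \<inter> X" n t] b nX[OF that] that addX by blast
    have no4: False if "s \<in> Y" "t \<in> Y" "n \<in> Y"
      using glue.IH(2) badI[of s "E \<inter> Y" n t] b nY[OF that] that addY by blast
    have nXY: "\<not> (n \<in> X \<and> n \<in> Y)" using U b by blast
    note iffX' = subspace_add_iff'[OF glue.hyps(1)] and iffY' = subspace_add_iff'[OF glue.hyps(2)]
    note props = cov[OF b(1)] cov[OF b(2)] cov[OF b(3)] cov[OF b(4)]
      iffX[of s n] iffY[of s n] iffX[of t n] iffY[of t n] iffX'[of n s] iffY'[of n s] iffX'[of n t] iffY'[of n t]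
    have nn: "n \<notin> X" "n \<notin> Y" using props nXY no3 no4 by argo+
    have st: "s + t \<noteq> 0" "s + t + n \<noteq> 0" using b by (auto simp: bvec_ac)
    have s: "s \<in> X \<and> s + n \<in> Y \<or> s \<in> Y \<and> s + n \<in> X" using props nn by argo
    have t: "t \<in> X \<and> t + n \<in> Y \<or> t \<in> Y \<and> t + n \<in> X" using props nn by argo
    have eq: "s + t = (s + n) + (t + n)" "s + t + n = s + (t + n)" "s + t + n = (s + n) + t"
      by (simp_all add: bvec_ac)
    have "s + t \<in> X \<and> s + t \<in> Y \<or> s + t + n \<in> X \<and> s + t + n \<in> Y"
      using s t addX addY eq by metis
    moreover from this have "s + t \<in> E" "s + t + n \<in> E" using U st b(9) by blast+
    ultimately show False
      using cov[of "s + t"] cov[of "s + t + n"] nn iffX[of "s + t" n] iffY[of "s + t" n] iffX[of "s + t + n" "s + t"]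
        iffY[of "s + t + n" "s + t"] iffX'[of "s + t" n]
      by (metis add.commute bvec_add_self_left iffX iffY)
  qed
qed

subsection \<open>Representations of matroids\<close>

lemma ground_restrict [simp]: "ground (restrict M X) = X"
  by (simp add: ground_def restrict_def)

lemma rk_restrict [simp]: "rk (restrict M X) Y = rk M (Y \<inter> X)"
  by (simp add: rk_def restrict_def)

lemma ground_contract [simp]: "ground (contract M C) = ground M - C"
  by (simp add: ground_def contract_def)

lemma rk_contract: "rk (contract M C) Y = rk M ((Y \<inter> (ground M - C)) \<union> C) - rk M C"
  by (simp add: rk_def contract_def)

lemma isomorphic_refl: "isomorphic M M"
  unfolding isomorphic_def by (rule exI[of _ id]) auto

lemma isomorphic_sym:
  assumes "isomorphic M N" shows "isomorphic N M"
proof -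
  obtain f where f: "bij_betw f (ground M) (ground N)" "\<And>X. X \<subseteq> ground M \<Longrightarrow> rk N (f ` X) = rk M X"
    using assms unfolding isomorphic_def by blast
  let ?g = "inv_into (ground M) f"
  have g: "bij_betw ?g (ground N) (ground M)" using f(1) by (rule bij_betw_inv_into)
  have "rk M (?g ` X) = rk N X" if X: "X \<subseteq> ground N" for X
  proof -
    have "?g ` X \<subseteq> ground M" using g X by (auto simp: bij_betw_def)
    moreover have "f ` ?g ` X = X" using f(1) X by (simp add: bij_betw_def image_inv_into_cancel)
    ultimately show ?thesis using f(2) by metis
  qed
  then show ?thesis unfolding isomorphic_def using g by blast
qed

lemma isomorphic_trans:
  assumes "isomorphic M N" "isomorphic N K" shows "isomorphic M K"
proof -
  obtain f where f: "bij_betw f (ground M) (ground N)" "\<And>X. X \<subseteq> ground M \<Longrightarrow> rk N (f ` X) = rk M X"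
    using assms unfolding isomorphic_def by blast
  obtain g where g: "bij_betw g (ground N) (ground K)" "\<And>X. X \<subseteq> ground N \<Longrightarrow> rk K (g ` X) = rk N X"
    using assms unfolding isomorphic_def by blast
  have "rk K ((g \<circ> f) ` X) = rk M X" if "X \<subseteq> ground M" for X
  proof -
    have "f ` X \<subseteq> ground N" using f(1) that by (auto simp: bij_betw_def)
    then show ?thesis using f(2)[OF that] g(2)[of "f ` X"] by (simp add: image_comp)
  qed
  then show ?thesis unfolding isomorphic_def using bij_betw_trans[OF f(1) g(1)] by blast
qed

text \<open>Injectivity and avoiding \<open>0\<close> encode simplicity, so that the image of the
  ground set, a plain set of vectors, determines the matroid up to isomorphism.\<close>

definition vrep :: "'a matroid \<Rightarrow> ('a \<Rightarrow> bvec) \<Rightarrow> bool" where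
  "vrep M \<phi> \<longleftrightarrow> finite (ground M) \<and> inj_on \<phi> (ground M) \<and> 0 \<notin> \<phi> ` ground M
     \<and> (\<forall>X. X \<subseteq> ground M \<longrightarrow> rk M X = vrank (\<phi> ` X))"

lemma vrepD:
  assumes "vrep M \<phi>"
  shows "finite (ground M)" "inj_on \<phi> (ground M)" "0 \<notin> \<phi> ` ground M"
    "\<And>X. X \<subseteq> ground M \<Longrightarrow> rk M X = vrank (\<phi> ` X)"
  using assms unfolding vrep_def by blast+

lemma simple_binary_vrep:
  assumes "simple M" "binary M" shows "\<exists>\<phi>. vrep M \<phi>"
proof -
  obtain \<phi> :: "'a \<Rightarrow> bvec" where \<phi>: "\<And>X. X \<subseteq> ground M \<Longrightarrow> rk M X = vrank (\<phi> ` X)" and m: "matroid M"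
    using assms unfolding representable_def by blast
  have nz: "\<phi> e \<noteq> 0" if "e \<in> ground M" for e
  proof
    assume "\<phi> e = 0"
    then have "rk M {e} = 0" using \<phi>[of "{e}"] that by (simp only: image_insert image_empty) simp
    then show False using assms that unfolding simple_def by force
  qed
  moreover have "inj_on \<phi> (ground M)"
  proof (rule inj_onI, rule ccontr)
    fix e f assume e: "e \<in> ground M" "f \<in> ground M" "\<phi> e = \<phi> f" "e \<noteq> f"
    have "rk M {e, f} = vrank {\<phi> f}" using \<phi>[of "{e, f}"] e by simp
    moreover have "rk M {e, f} = 2" using assms e unfolding simple_def by blast
    ultimately show False using vrank_1[of "\<phi> f"] by (auto split: if_splits)
  qed
  ultimately have "vrep M \<phi>" unfolding vrep_def using \<phi> m by (auto simp: matroid_def)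
  then show ?thesis by blast
qed

lemma vrep_matroid:
  assumes "vrep M \<phi>" shows "matroid M"
proof -
  note v = vrepD[OF assms]
  have fin: "finite (\<phi> ` X)" if "X \<subseteq> ground M" for X using v(1) that finite_subset by blast
  show ?thesis
    unfolding matroid_def
  proof (intro conjI allI impI)
    fix X assume X: "X \<subseteq> ground M"
    then have "vrank (\<phi> ` X) \<le> card (\<phi> ` X)" using fin vrank_le_card by blast
    also have "\<dots> \<le> card X" using X v(1) finite_subset card_image_le by blast
    finally show "rk M X \<le> card X" using v(4) X by simp
  next
    fix X Y assume XY: "X \<subseteq> Y \<and> Y \<subseteq> ground M"
    then have "vrank (\<phi> ` X) \<le> vrank (\<phi> ` Y)" using fin by (intro vrank_mono) auto
    then show "rk M X \<le> rk M Y" using v(4)[of X] v(4)[of Y] XY by (metis subset_trans)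
  next
    fix X Y assume XY: "X \<subseteq> ground M \<and> Y \<subseteq> ground M"
    have "\<phi> ` (X \<inter> Y) = \<phi> ` X \<inter> \<phi> ` Y" using XY v(2) by (intro inj_on_image_Int) auto
    then have "vrank (\<phi> ` (X \<union> Y)) + vrank (\<phi> ` (X \<inter> Y)) \<le> vrank (\<phi> ` X) + vrank (\<phi> ` Y)"
      using XY fin vrank_submodular[of "\<phi> ` X" "\<phi> ` Y"] by (simp add: image_Un)
    then show "rk M (X \<union> Y) + rk M (X \<inter> Y) \<le> rk M X + rk M Y"
      using v(4)[of X] v(4)[of Y] v(4)[of "X \<union> Y"] v(4)[of "X \<inter> Y"] XY by (simp add: le_infI1)
  qed (rule v(1))
qed

lemma vrep_simple:
  assumes "vrep M \<phi>" shows "simple M"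
  unfolding simple_def
proof (intro conjI ballI impI)
  note v = vrepD[OF assms]
  show "matroid M" using vrep_matroid assms .
  have nz: "\<phi> e \<noteq> 0" if "e \<in> ground M" for e using v(3) that by (metis imageI)
  fix e assume e: "e \<in> ground M"
  then show "rk M {e} = 1" using v(4)[of "{e}"] nz by simp
  fix f assume f: "f \<in> ground M" "e \<noteq> f"
  then have "\<phi> e \<noteq> \<phi> f" using v(2) e inj_onD by metis
  then have "vrank {\<phi> e, \<phi> f} = 2" using vrank_2[OF nz[OF e] nz[OF f(1)]] by simp
  then show "rk M {e, f} = 2" using v(4)[of "{e, f}"] e f by simp
qed

lemma vrep_binary: "vrep M \<phi> \<Longrightarrow> binary M"
  unfolding representable_def by (intro conjI exI[of _ \<phi>] allI impI) (simp_all add: vrep_matroid vrepD(4))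

lemma vrep_isomorphic:
  assumes "vrep N \<psi>" "isomorphic M N"
  shows "\<exists>\<phi>. vrep M \<phi> \<and> \<phi> ` ground M = \<psi> ` ground N"
proof -
  note v = vrepD[OF assms(1)]
  obtain f where f: "bij_betw f (ground M) (ground N)" "\<And>X. X \<subseteq> ground M \<Longrightarrow> rk N (f ` X) = rk M X"
    using assms unfolding isomorphic_def by blast
  have im: "f ` ground M = ground N" using f by (simp add: bij_betw_def)
  then have im': "(\<psi> \<circ> f) ` ground M = \<psi> ` ground N" by (metis image_comp)
  have "vrep M (\<psi> \<circ> f)" unfolding vrep_def im'
  proof (intro conjI allI impI)
    show "finite (ground M)" using bij_betw_finite[OF f(1)] v(1) by simp
    show "inj_on (\<psi> \<circ> f) (ground M)" using f(1) v(2) im by (simp add: bij_betw_def comp_inj_on)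
    fix X assume X: "X \<subseteq> ground M"
    then have "f ` X \<subseteq> ground N" using im by blast
    then show "rk M X = vrank ((\<psi> \<circ> f) ` X)" using f(2)[OF X] v(4) by (simp add: image_comp)
  qed (rule v(3))
  then show ?thesis using im' by blast
qed

lemma isomorphic_by_additive:
  assumes M: "vrep M \<phi>" and N: "vrep N \<psi>" and L: "additive L" "L ` \<phi> ` ground M = \<psi> ` ground N"
    and inj: "\<And>x. x \<in> span (\<phi> ` ground M) \<Longrightarrow> L x = 0 \<Longrightarrow> x = 0"
  shows "isomorphic M N"
proof -
  note v = vrepD[OF M] and w = vrepD[OF N]
  have "inj_on L (span (\<phi> ` ground M))"
  proof (rule inj_onI)
    fix x y assume xy: "x \<in> span (\<phi> ` ground M)" "y \<in> span (\<phi> ` ground M)" "L x = L y"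
    then have "x + y = 0" using inj additive_eq_iff[OF L(1)] span_add by blast
    then show "x = y" by simp
  qed
  then have "inj_on L (\<phi> ` ground M)" using bv.span_superset inj_on_subset by blast
  then have 1: "bij_betw (L \<circ> \<phi>) (ground M) (\<psi> ` ground N)"
    using v(2) L(2) by (simp add: bij_betw_def comp_inj_on image_comp)
  have 2: "bij_betw (inv_into (ground N) \<psi>) (\<psi> ` ground N) (ground N)"
    using w(2) by (intro bij_betw_inv_into) (simp add: bij_betw_def)
  let ?f = "inv_into (ground N) \<psi> \<circ> (L \<circ> \<phi>)"
  have f: "bij_betw ?f (ground M) (ground N)" using bij_betw_trans[OF 1 2] .
  moreover have "rk N (?f ` X) = rk M X" if X: "X \<subseteq> ground M" for X
  proof -
    have sub: "L ` \<phi> ` X \<subseteq> \<psi> ` ground N" using X L(2) by (metis image_mono)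
    have "\<psi> ` ?f ` X = \<psi> ` inv_into (ground N) \<psi> ` (L ` \<phi> ` X)" by (simp add: image_comp comp_assoc)
    also have "\<dots> = L ` \<phi> ` X" using sub by (simp add: image_inv_into_cancel[OF refl])
    finally have "rk N (?f ` X) = vrank (L ` \<phi> ` X)" using w(4)[of "?f ` X"] f X
      by (metis bij_betw_def image_mono)
    also have "\<dots> = vrank (\<phi> ` X)"
    proof (rule vrank_inj_image[OF L(1)])
      show "finite (\<phi> ` X)" using X v(1) finite_subset by blast
      fix x assume "x \<in> span (\<phi> ` X)" "L x = 0"
      then show "x = 0" using inj bv.span_mono[of "\<phi> ` X" "\<phi> ` ground M"] X by blast
    qed
    finally show ?thesis using v(4)[OF X] by simp
  qed
  ultimately show ?thesis unfolding isomorphic_def by blast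
qed

lemma vrep_flat_iff:
  assumes "vrep M \<phi>"
  shows "flat M F \<longleftrightarrow> F \<subseteq> ground M \<and> (\<forall>e\<in>ground M. \<phi> e \<in> span (\<phi> ` F) \<longrightarrow> e \<in> F)"
proof -
  note v = vrepD[OF assms]
  have "rk M (insert e F) = rk M F + 1 \<longleftrightarrow> \<phi> e \<notin> span (\<phi> ` F)"
    if "F \<subseteq> ground M" "e \<in> ground M" for e
  proof -
    have "finite (\<phi> ` F)" using v(1) that finite_subset by blast
    then show ?thesis using v(4)[of F] v(4)[of "insert e F"] that vrank_insert[of "\<phi> ` F" "\<phi> e"] by auto
  qed
  then show ?thesis unfolding flat_def by blast
qed

lemma vrep_restrict:
  assumes "vrep M \<phi>" "F \<subseteq> ground M" shows "vrep (restrict M F) \<phi>"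
  using assms unfolding vrep_def by (auto intro: finite_subset inj_on_subset simp: Int_absorb2)

lemma vrep_flat_image:
  assumes "vrep M \<phi>" "flat M F" shows "\<phi> ` F = \<phi> ` ground M \<inter> span (\<phi> ` F)"
  using assms(2) unfolding vrep_flat_iff[OF assms(1)] using bv.span_superset by blast

text \<open>By \<open>vrank_image\<close> the difference defining the rank of a contraction is the
  rank of the image under \<open>f\<close>. Loops are therefore the elements sent to
  \<open>0\<close>, and parallel elements those with equal images.\<close>

lemma vrep_contract_rank:
  assumes M: "vrep M \<phi>" and C: "C \<subseteq> ground M"
    and f: "additive f" "\<And>x. f x = 0 \<longleftrightarrow> x \<in> span (\<phi> ` C)"
  shows "Y \<subseteq> ground M - C \<Longrightarrow> rk (contract M C) Y = vrank ((f \<circ> \<phi>) ` Y)"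
    and "nonloops (contract M C) = {e \<in> ground M - C. (f \<circ> \<phi>) e \<noteq> 0}"
    and "e \<in> nonloops (contract M C) \<Longrightarrow> s \<in> nonloops (contract M C) \<Longrightarrow>
      rk (contract M C) {e, s} = 1 \<longleftrightarrow> (f \<circ> \<phi>) e = (f \<circ> \<phi>) s"
proof -
  note v = vrepD[OF M]
  let ?N = "contract M C" and ?f = "f \<circ> \<phi>"
  have rank: "rk ?N Y = vrank (?f ` Y)" if Y: "Y \<subseteq> ground M - C" for Y
  proof -
    have YG: "Y \<subseteq> ground M" using Y by blast
    have "rk ?N Y = rk M (Y \<union> C) - rk M C" using Y by (simp add: rk_contract Int_absorb2)
    also have "\<dots> = vrank (\<phi> ` Y \<union> \<phi> ` C) - vrank (\<phi> ` C)" using v(4)[of "Y \<union> C"] v(4)[OF C] YG C by (simp add: image_Un)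
    also have "\<dots> = vrank (f ` \<phi> ` Y)"
      using vrank_image[OF f, of "\<phi> ` Y"] v(1) YG C finite_subset by (metis add_diff_cancel_right' finite_imageI)
    finally show ?thesis by (simp add: image_comp)
  qed
  then show "Y \<subseteq> ground M - C \<Longrightarrow> rk ?N Y = vrank (?f ` Y)" .
  have "rk ?N {e} \<noteq> 0 \<longleftrightarrow> ?f e \<noteq> 0" if "e \<in> ground M - C" for e
    using rank[of "{e}"] that by simp
  then show nl: "nonloops ?N = {e \<in> ground M - C. ?f e \<noteq> 0}"
    unfolding nonloops_def ground_contract by blast
  assume "e \<in> nonloops ?N" "s \<in> nonloops ?N"
  then have nz: "?f e \<noteq> 0" "?f s \<noteq> 0" "{e, s} \<subseteq> ground M - C" unfolding nl by blast+
  have "rk ?N {e, s} = vrank {?f e, ?f s}" using rank[OF nz(3)] by simp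
  then show "rk ?N {e, s} = 1 \<longleftrightarrow> ?f e = ?f s" unfolding vrank_2[OF nz(1,2)] by simp
qed

lemma vrep_contract:
  assumes M: "vrep M \<phi>" and C: "C \<subseteq> ground M" and S: "simplification_set (contract M C) S"
    and f: "additive f" "\<And>x. f x = 0 \<longleftrightarrow> x \<in> span (\<phi> ` C)"
  shows "vrep (restrict (contract M C) S) (f \<circ> \<phi>)" "(f \<circ> \<phi>) ` S = f ` \<phi> ` ground M - {0}"
proof -
  note v = vrepD[OF M]
  let ?N = "contract M C"
  let ?f = "f \<circ> \<phi>"
  note rank = vrep_contract_rank(1)[OF M C f] and nl = vrep_contract_rank(2)[OF M C f]
    and par = vrep_contract_rank(3)[OF M C f]
  have S1: "S \<subseteq> nonloops ?N" and S2: "\<And>e. e \<in> nonloops ?N \<Longrightarrow> \<exists>!s. s \<in> S \<and> rk ?N {e, s} = 1"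
    using S unfolding simplification_set_def by blast+
  have SG: "S \<subseteq> ground M - C" using S1 nl by blast
  have inj: "inj_on ?f S"
  proof (rule inj_onI)
    fix s t assume st: "s \<in> S" "t \<in> S" "?f s = ?f t"
    then have "rk ?N {s, s} = 1" "rk ?N {s, t} = 1" using par S1 by blast+
    then show "s = t" using S2[of s] S1 st by blast
  qed
  show im: "?f ` S = f ` \<phi> ` ground M - {0}"
  proof
    show "?f ` S \<subseteq> f ` \<phi> ` ground M - {0}" using S1 unfolding nl by auto
    show "f ` \<phi> ` ground M - {0} \<subseteq> ?f ` S"
    proof
      fix x assume "x \<in> f ` \<phi> ` ground M - {0}"
      then obtain e where e: "e \<in> ground M" "x = ?f e" "?f e \<noteq> 0" by auto
      have "e \<notin> C" using e(3) f(2)[of "\<phi> e"] bv.span_base[of "\<phi> e" "\<phi> ` C"] by auto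
      then have en: "e \<in> nonloops ?N" using e nl by blast
      then obtain s where "s \<in> S" "rk ?N {e, s} = 1" using S2 by blast
      then show "x \<in> ?f ` S" using par[OF en] S1 e by blast
    qed
  qed
  show "vrep (restrict ?N S) ?f" unfolding vrep_def
  proof (intro conjI allI impI; (simp only: ground_restrict)?)
    show "finite S" using SG v(1) finite_subset by blast
    show "0 \<notin> ?f ` S" unfolding im by blast
    fix X assume "X \<subseteq> S"
    then show "rk (restrict ?N S) X = vrank (?f ` X)" using rank[of X] SG by (simp add: Int_absorb2)
  qed (rule inj)
qed

text \<open>The function \<open>?r\<close> chooses one nonloop in each fibre of \<open>?f\<close>,
  that is, in each parallel class.\<close>

lemma exists_simplification_set:
  assumes M: "vrep M \<phi>" and C: "C \<subseteq> ground M"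
  shows "\<exists>S. simplification_set (contract M C) S"
proof -
  note v = vrepD[OF M]
  obtain f where f: "additive f" "\<And>x. f x = 0 \<longleftrightarrow> x \<in> span (\<phi> ` C)"
    using exists_additive_ker[of "\<phi> ` C"] C v(1) finite_subset by blast
  let ?N = "contract M C" and ?f = "f \<circ> \<phi>"
  note nl = vrep_contract_rank(2)[OF M C f] and par = vrep_contract_rank(3)[OF M C f]
  let ?r = "inv_into (nonloops ?N) ?f"
  let ?S = "?r ` ?f ` nonloops ?N"
  have r: "?r (?f e) \<in> nonloops ?N" "?f (?r (?f e)) = ?f e" if "e \<in> nonloops ?N" for e
    using that inv_into_into[of "?f e" ?f "nonloops ?N"] f_inv_into_f[of "?f e" ?f "nonloops ?N"] by blast+
  have "\<exists>!s. s \<in> ?S \<and> rk ?N {e, s} = 1" if e: "e \<in> nonloops ?N" for e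
  proof (rule ex1I[of _ "?r (?f e)"])
    show "?r (?f e) \<in> ?S \<and> rk ?N {e, ?r (?f e)} = 1" using r[OF e] e par[OF e, of "?r (?f e)"] by auto
    fix s assume s: "s \<in> ?S \<and> rk ?N {e, s} = 1"
    then obtain g where g: "g \<in> nonloops ?N" "s = ?r (?f g)" by blast
    then have "?f e = ?f g" using s par[OF e r(1)[OF g(1)]] r(2)[OF g(1)] by metis
    then show "s = ?r (?f e)" using g(2) by simp
  qed
  moreover have "?S \<subseteq> nonloops ?N" using r(1) by (intro image_subsetI) (elim imageE, simp only:)
  ultimately have "simplification_set ?N ?S" unfolding simplification_set_def by simp
  then show ?thesis ..
qed

lemma good_induced_minor_step:
  assumes M: "vrep M \<phi>" "good (\<phi> ` ground M)" and step: "induced_minor_step M N"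
  shows "\<exists>\<psi>. vrep N \<psi> \<and> good (\<psi> ` ground N)"
proof -
  consider F where "flat M F" "N = restrict M F"
    | C S where "C \<subseteq> ground M" "simplification_set (contract M C) S" "N = restrict (contract M C) S"
    using step unfolding induced_minor_step_def by blast
  then show ?thesis
  proof cases
    case 1
    have "good (\<phi> ` F)" using good_Int_subspace[OF M(2) bv.subspace_span] vrep_flat_image[OF M(1) 1(1)] by metis
    moreover have "vrep N \<phi>" using vrep_restrict[OF M(1)] 1 by (simp add: flat_def)
    ultimately show ?thesis using 1 by auto
  next
    case 2
    have "finite (\<phi> ` C)" using 2 vrepD(1)[OF M(1)] finite_subset by blast
    then obtain f where f: "additive f" "\<And>x. f x = 0 \<longleftrightarrow> x \<in> span (\<phi> ` C)"
      using exists_additive_ker by blast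
    note N = vrep_contract[OF M(1) 2(1,2) f]
    have "good (f ` \<phi> ` ground M - {0})"
    proof (rule good_image[OF M(2) f(1)])
      fix x assume "f x = 0"
      then have "x \<in> span (\<phi> ` C)" using f by blast
      moreover have "\<phi> ` C \<subseteq> {e \<in> \<phi> ` ground M. f e = 0}" using 2(1) f(2) bv.span_base by blast
      ultimately show "x \<in> span {e \<in> \<phi> ` ground M. f e = 0}" using bv.span_mono by blast
    qed
    then have "good ((f \<circ> \<phi>) ` ground N)" using N(2) 2(3) by simp
    then show ?thesis using N(1) 2(3) by blast
  qed
qed

lemma good_induced_minor:
  assumes "induced_minor_step\<^sup>*\<^sup>* M N" "vrep M \<phi>" "good (\<phi> ` ground M)"
  shows "\<exists>\<psi>. vrep N \<psi> \<and> good (\<psi> ` ground N)"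
  using assms by (induction rule: rtranclp_induct) (blast intro: good_induced_minor_step)+

lemma matroidD:
  assumes "matroid M"
  shows "finite (ground M)"
    and "X \<subseteq> ground M \<Longrightarrow> rk M X \<le> card X"
    and "X \<subseteq> Y \<Longrightarrow> Y \<subseteq> ground M \<Longrightarrow> rk M X \<le> rk M Y"
    and "X \<subseteq> ground M \<Longrightarrow> Y \<subseteq> ground M \<Longrightarrow> rk M (X \<union> Y) + rk M (X \<inter> Y) \<le> rk M X + rk M Y"
  using assms unfolding matroid_def by auto

text \<open>The elements that do not raise the rank of \<open>X\<close> form its closure. By
  submodularity the closure is a flat and is contained in every flat above \<open>X\<close>.\<close>

lemma rank_insert_eq_iff_flats:
  assumes m: "matroid M" and X: "X \<subseteq> ground M" and e: "e \<in> ground M"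
  shows "rk M (insert e X) = rk M X \<longleftrightarrow> (\<forall>F. flat M F \<and> X \<subseteq> F \<longrightarrow> e \<in> F)"
proof -
  note fin = matroidD(1)[OF m] and cd = matroidD(2)[OF m] and mono = matroidD(3)[OF m] and sm = matroidD(4)[OF m]
  show ?thesis
  proof
    assume eq: "rk M (insert e X) = rk M X"
    show "\<forall>F. flat M F \<and> X \<subseteq> F \<longrightarrow> e \<in> F"
    proof (intro allI impI, rule ccontr)
      fix F assume F: "flat M F \<and> X \<subseteq> F" and ne: "e \<notin> F"
      have FG: "F \<subseteq> ground M" using F by (simp add: flat_def)
      have "F \<union> insert e X = insert e F" "F \<inter> insert e X = X" using F ne by blast+
      then have "rk M (insert e F) + rk M X \<le> rk M F + rk M X" using sm[of F "insert e X"] FG X e eq by simp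
      moreover have "rk M (insert e F) = rk M F + 1" using F ne e unfolding flat_def by blast
      ultimately show False by simp
    qed
  next
    assume all: "\<forall>F. flat M F \<and> X \<subseteq> F \<longrightarrow> e \<in> F"
    let ?F = "{g \<in> ground M. rk M (insert g X) = rk M X}"
    have ext: "rk M (X \<union> A) = rk M X" if "finite A" "A \<subseteq> ?F" for A
      using that
    proof (induction rule: finite_induct)
      case (insert g A)
      have A: "X \<union> A \<subseteq> ground M" "insert g X \<subseteq> ground M" using insert X by blast+
      have "X \<subseteq> (X \<union> A) \<inter> insert g X" by blast
      then have "rk M X \<le> rk M ((X \<union> A) \<inter> insert g X)" using A by (intro mono) auto
      moreover have "(X \<union> A) \<union> insert g X = X \<union> insert g A" by blast
      ultimately have "rk M (X \<union> insert g A) \<le> rk M X" using sm[OF A] insert by auto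
      moreover have "rk M X \<le> rk M (X \<union> insert g A)" using insert X by (intro mono) auto
      ultimately show ?case by simp
    qed simp
    have XF: "X \<subseteq> ?F" using X by (auto simp: insert_absorb)
    then have rF: "rk M ?F = rk M X" using ext[of ?F] fin by (simp add: Un_absorb1)
    have "flat M ?F" unfolding flat_def
    proof (intro conjI ballI)
      fix g assume g: "g \<in> ground M - ?F"
      have "rk M (insert g X) \<noteq> rk M X" using g by blast
      moreover have "rk M X \<le> rk M (insert g X)" using X g by (intro mono) auto
      ultimately have "rk M X + 1 \<le> rk M (insert g X)" by simp
      also have "\<dots> \<le> rk M (insert g ?F)" using XF g by (intro mono) auto
      finally have "rk M ?F + 1 \<le> rk M (insert g ?F)" using rF by simp
      moreover have "rk M (insert g ?F) \<le> rk M ?F + 1"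
        using sm[of ?F "{g}"] cd[of "{g}"] g by simp
      ultimately show "rk M (insert g ?F) = rk M ?F + 1" by simp
    qed auto
    then have "e \<in> ?F" using all XF by blast
    then show "rk M (insert e X) = rk M X" by simp
  qed
qed

text \<open>Needed because \<^const>\<open>is_gpc\<close> determines its first argument only through the flats.\<close>

lemma matroid_eq_by_flats:
  assumes M: "matroid M" and N: "matroid N" and g: "ground M = ground N"
    and flats: "\<And>F. F \<subseteq> ground M \<Longrightarrow> flat M F \<longleftrightarrow> flat N F"
    and X: "X \<subseteq> ground M"
  shows "rk M X = rk N X"
proof -
  have "F \<subseteq> ground K" if "flat K F" for F and K :: "'a matroid" using that by (simp add: flat_def)
  then have fl: "flat M F \<longleftrightarrow> flat N F" for F using flats g by metis
  have step: "rk K (insert e A) = (if rk K (insert e A) = rk K A then rk K A else rk K A + 1)"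
    if K: "matroid K" "A \<subseteq> ground K" "e \<in> ground K" for e A and K :: "'a matroid"
  proof -
    note cd = matroidD(2)[OF K(1)] and mono = matroidD(3)[OF K(1)] and sm = matroidD(4)[OF K(1)]
    have "rk K A \<le> rk K (insert e A)" using K by (intro mono) auto
    moreover have "rk K (insert e A) \<le> rk K A + rk K {e}" using sm[of A "{e}"] K by simp
    moreover have "rk K {e} \<le> 1" using cd[of "{e}"] K by simp
    ultimately show ?thesis by simp
  qed
  have "finite X" using finite_subset[OF X matroidD(1)[OF M]] .
  then show ?thesis using X
  proof (induction rule: finite_induct)
    case empty
    have "rk M {} \<le> card ({} :: 'a set)" using matroidD(2)[OF M, of "{}"] by simp
    moreover have "rk N {} \<le> card ({} :: 'a set)" using matroidD(2)[OF N, of "{}"] by simp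
    ultimately show ?case by simp
  next
    case (insert e A)
    have "rk M (insert e A) = rk M A \<longleftrightarrow> rk N (insert e A) = rk N A"
      using rank_insert_eq_iff_flats[OF M, of A e] rank_insert_eq_iff_flats[OF N, of A e] insert.prems g fl by simp
    then show ?case using step[OF M, of A e] step[OF N, of A e] insert g by auto
  qed
qed

subsection \<open>The two excluded matroids\<close>

definition chi :: "nat set \<Rightarrow> bvec" where "chi A = (\<lambda>i. if i \<in> A then 1 else 0)"

lemma chi_add: "chi A + chi B = chi ((A - B) \<union> (B - A))"
  by (auto simp: chi_def fun_eq_iff)

lemma chi_eq_iff: "chi A = chi B \<longleftrightarrow> A = B"
proof
  assume "chi A = chi B"
  then have "chi A i = chi B i" for i by (rule fun_cong)
  then have "i \<in> A \<longleftrightarrow> i \<in> B" for i unfolding chi_def by (metis zero_neq_one)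
  then show "A = B" by blast
qed simp

lemma chi_empty: "0 = chi {}"
  by (simp add: chi_def fun_eq_iff)

lemma in_span_empty: "x \<in> span {} \<longleftrightarrow> x = chi {}"
  by (simp add: chi_empty)

lemma chi_eq_0_iff: "chi A = 0 \<longleftrightarrow> A = {}"
  by (simp only: chi_empty chi_eq_iff)

lemmas chi_simps = chi_eq_0_iff chi_add chi_eq_iff in_span_empty insert_Diff_if

text \<open>Three basis vectors and their sum: over two elements the coefficients of the fourth
  vector must all be 1, as any three of the four are independent.\<close>

definition U34_vec :: "nat \<Rightarrow> bvec" where
  "U34_vec i = chi (if i < 3 then {i} else {0, 1, 2})"

lemma vrep_U34: "vrep U34 U34_vec"
  unfolding vrep_def
proof (intro conjI allI impI)
  have g: "ground U34 = {0, 1, 2, 3}" by (auto simp: ground_def U34_def)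
  show "finite (ground U34)" unfolding g by simp
  show "inj_on U34_vec (ground U34)" unfolding g by (auto simp: inj_on_def U34_vec_def chi_eq_iff)
  show "0 \<notin> U34_vec ` ground U34" unfolding g chi_empty by (auto simp: U34_vec_def chi_eq_iff)
  fix X assume "X \<subseteq> ground U34"
  then have X: "X \<in> Pow {0, 1, 2, 3}" unfolding g by simp
  have "U34_vec 0 = chi {0}" "U34_vec 1 = chi {1}" "U34_vec 2 = chi {2}" "U34_vec 3 = chi {0, 1, 2}"
    by (auto simp: U34_vec_def chi_eq_iff)
  note U = this this(2)[unfolded One_nat_def]
  show "rk U34 X = vrank (U34_vec ` X)"
    using X unfolding Pow_insert Pow_empty image_insert image_empty Un_insert_left Un_empty_left
    by (elim insertE emptyE; simp add: rk_def U34_def U vrank_insert span_insert chi_simps del: bv.span_empty)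
qed


section \<open>The cycle matroid of the complete graph: components and rank\<close>

lemma ground_MK4: "ground MK4 = {{0, 1}, {0, 2}, {0, 3}, {1, 2}, {1, 3}, {2, 3}}"
proof -
  have lt: "a < 4 \<longleftrightarrow> a = 0 \<or> a = 1 \<or> a = 2 \<or> a = 3" for a :: nat by auto
  have mem: "{a, b} \<in> ground MK4" if "a < 4" "b < 4" "a \<noteq> b" for a b
    using that unfolding ground_def MK4_def by auto
  have "ground MK4 \<subseteq> {{0, 1}, {0, 2}, {0, 3}, {1, 2}, {1, 3}, {2, 3}}"
    unfolding ground_def MK4_def using lt by (auto simp: insert_commute)
  then show ?thesis using mem[of 0 1] mem[of 0 2] mem[of 0 3] mem[of 1 2] mem[of 1 3] mem[of 2 3]
    by (intro subset_antisym) simp_all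
qed

definition adj :: "nat set set \<Rightarrow> (nat \<times> nat) set" where
  "adj X = {(a, b). {a, b} \<in> X}"

definition comp :: "nat set set \<Rightarrow> nat \<Rightarrow> nat set" where
  "comp X v = {w \<in> {0..<4}. (v, w) \<in> (adj X)\<^sup>*}"

lemma K4_components_eq: "K4_components X = comp X ` {0..<4}"
proof -
  have "{(a, b). {a, b} \<in> X} \<union> {(a, b). {a, b} \<in> X}\<inverse> = adj X"
    by (auto simp: adj_def insert_commute)
  then show ?thesis unfolding K4_components_def Let_def comp_def by auto
qed

lemma adj_sym: "(v, w) \<in> (adj X)\<^sup>* \<longleftrightarrow> (w, v) \<in> (adj X)\<^sup>*"
proof -
  have "sym (adj X)" by (auto simp: sym_def adj_def insert_commute)
  then show ?thesis using sym_rtrancl symD by metis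
qed

lemma adj_insert: "adj (insert {a, b} X) = insert (a, b) (insert (b, a) (adj X))"
  by (auto simp: adj_def doubleton_eq_iff)

lemma edgeE:
  assumes "e \<in> ground MK4" obtains a b where "e = {a, b}" "a < 4" "b < 4" "a \<noteq> b"
  using assms unfolding ground_def MK4_def by auto

lemma chi_edge: "a \<noteq> b \<Longrightarrow> chi {a, b} = chi {a} + chi {b}"
  by (simp add: chi_simps insert_commute)

lemma sum_chi: "finite A \<Longrightarrow> (\<Sum>i\<in>A. chi {a} i) = (if a \<in> A then 1 else 0)"
  by (simp add: chi_def)

text \<open>Along a path the edge vectors telescope. Conversely, let \<open>K\<close> be the
  component of \<open>v\<close>: summing coordinates over \<open>K\<close> is a functional that
  vanishes on every edge of \<open>X\<close>, whose ends are both inside or both outside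
  \<open>K\<close>, but not on \<open>chi {v} + chi {w}\<close> for \<open>w\<close> outside
  \<open>K\<close>.\<close>

lemma connected_iff_span:
  assumes X: "X \<subseteq> ground MK4" and vw: "v < 4" "w < 4"
  shows "(v, w) \<in> (adj X)\<^sup>* \<longleftrightarrow> chi {v} + chi {w} \<in> span (chi ` X)"
proof
  assume "(v, w) \<in> (adj X)\<^sup>*"
  then show "chi {v} + chi {w} \<in> span (chi ` X)"
  proof (induction rule: rtrancl_induct)
    case base
    show ?case by (simp only: bvec_add_self bv.span_zero)
  next
    case (step y z)
    have "{y, z} \<in> X" using step.hyps(2) by (simp add: adj_def)
    moreover have "y \<noteq> z"
    proof -
      obtain a b where "{y, z} = {a, b}" "a < 4" "b < 4" "a \<noteq> b" by (rule edgeE[OF subsetD[OF X \<open>{y, z} \<in> X\<close>]])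
      then show ?thesis by (auto simp: doubleton_eq_iff)
    qed
    ultimately have "chi {y} + chi {z} \<in> span (chi ` X)"
      using bv.span_base[of "chi {y, z}" "chi ` X"] chi_edge[of y z] by (metis imageI)
    from span_add[OF step.IH this] show ?case by (simp only: bvec_ac bvec_add_self_left)
  qed
next
  assume s: "chi {v} + chi {w} \<in> span (chi ` X)"
  define K where "K = {w \<in> {0..<4}. (v, w) \<in> (adj X)\<^sup>*}"
  have finK: "finite K" by (simp add: K_def)
  define S where "S = {x :: bvec. (\<Sum>i\<in>K. x i) = 0}"
  have S: "subspace S" unfolding subspace_iff S_def by (auto simp: sum.distrib plus_fun_apply zero_fun_apply simp del: add_bit_eq_xor)
  have two: "(\<Sum>i\<in>K. (chi {a} + chi {b}) i) = (if a \<in> K then 1 else 0) + (if b \<in> K then 1 else 0)" for a b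
    using sum_chi[OF finK] by (simp add: sum.distrib del: add_bit_eq_xor)
  have "chi ` X \<subseteq> S"
  proof
    fix x assume "x \<in> chi ` X"
    then obtain e where e: "e \<in> X" "x = chi e" by blast
    then obtain a b where ab: "e = {a, b}" "a < 4" "b < 4" "a \<noteq> b" using edgeE[OF subsetD[OF X e(1)]] by metis
    have "(a, b) \<in> adj X" "(b, a) \<in> adj X" using e ab by (auto simp: adj_def insert_commute)
    then have "a \<in> K \<longleftrightarrow> b \<in> K" using ab unfolding K_def by (auto intro: rtrancl_into_rtrancl)
    then show "x \<in> S" unfolding S_def e ab(1) chi_edge[OF ab(4)] using two by simp
  qed
  then have "chi {v} + chi {w} \<in> S" using s span_subset[OF _ S] by blast
  then have "(if v \<in> K then 1 else 0) + (if w \<in> K then 1 else (0 :: bit)) = 0" unfolding S_def mem_Collect_eq two .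
  moreover have "v \<in> K" using vw by (simp add: K_def)
  ultimately have "w \<in> K" by (auto split: if_splits)
  then show "(v, w) \<in> (adj X)\<^sup>*" by (simp add: K_def)
qed

text \<open>The new edge replaces the two distinct classes of \<open>a\<close> and \<open>b\<close>
  by their union, which was not a class before.\<close>

lemma card_components_insert:
  assumes ab: "a < 4" "b < 4" and n: "(a, b) \<notin> (adj X)\<^sup>*"
  shows "Suc (card (comp (insert {a, b} X) ` {0..<4})) = card (comp X ` {0..<4})"
proof -
  let ?r = "\<lambda>v w. (v, w) \<in> (adj X)\<^sup>*"
  have refl: "?r v v" for v by simp
  have sym: "?r v w \<Longrightarrow> ?r w v" for v w using adj_sym by blast
  have trans: "?r u v \<Longrightarrow> ?r v w \<Longrightarrow> ?r u w" for u v w by (rule rtrancl_trans)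
  have r': "(v, w) \<in> (adj (insert {a, b} X))\<^sup>* \<longleftrightarrow> ?r v w \<or> (?r v a \<or> ?r v b) \<and> (?r w a \<or> ?r w b)" for v w
  proof -
    have "(v, w) \<in> (adj (insert {a, b} X))\<^sup>* \<longleftrightarrow>
      ?r v w \<or> ?r v b \<and> ?r a w \<or> (?r v a \<or> ?r v b) \<and> (?r b w \<or> ?r a w)"
      unfolding adj_insert rtrancl_insert by auto
    moreover have "?r a w \<longleftrightarrow> ?r w a" "?r b w \<longleftrightarrow> ?r w b" by (rule adj_sym)+
    moreover have "?r v a \<Longrightarrow> ?r w a \<Longrightarrow> ?r v w" "?r v b \<Longrightarrow> ?r w b \<Longrightarrow> ?r v w"
      using trans[OF _ sym] by blast+
    ultimately show ?thesis by argo
  qed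
  have comp_eq: "comp X v = comp X w \<longleftrightarrow> ?r v w" if "v < 4" "w < 4" for v w
  proof
    assume "comp X v = comp X w"
    moreover have "w \<in> comp X w" using that by (simp add: comp_def)
    ultimately have "w \<in> comp X v" by simp
    then show "?r v w" by (simp add: comp_def)
  next
    assume vw: "?r v w"
    then have "?r v z \<longleftrightarrow> ?r w z" for z using trans[OF vw] trans[OF sym[OF vw]] by blast
    then show "comp X v = comp X w" by (simp add: comp_def)
  qed
  have c': "comp (insert {a, b} X) v = (if ?r v a \<or> ?r v b then comp X a \<union> comp X b else comp X v)" if "v < 4" for v
  proof -
    have "?r a z \<longleftrightarrow> ?r z a" "?r b z \<longleftrightarrow> ?r z b" for z by (rule adj_sym)+
    moreover have "?r v z \<Longrightarrow> ?r v a \<Longrightarrow> ?r z a" "?r v z \<Longrightarrow> ?r v b \<Longrightarrow> ?r z b" for z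
      using trans[OF sym] by blast+
    ultimately show ?thesis unfolding comp_def r' by (cases "?r v a \<or> ?r v b") (simp_all, blast+)
  qed
  let ?C = "comp X ` {0..<4}"
  have "comp (insert {a, b} X) ` {0..<4} = insert (comp X a \<union> comp X b) (?C - {comp X a, comp X b})"
  proof (intro equalityI subsetI)
    fix K assume "K \<in> comp (insert {a, b} X) ` {0..<4}"
    then obtain v where v: "v < 4" "K = comp (insert {a, b} X) v" by auto
    then show "K \<in> insert (comp X a \<union> comp X b) (?C - {comp X a, comp X b})"
      using c'[OF v(1)] comp_eq[OF v(1) ab(1)] comp_eq[OF v(1) ab(2)] by auto
  next
    fix K assume "K \<in> insert (comp X a \<union> comp X b) (?C - {comp X a, comp X b})"
    then consider "K = comp X a \<union> comp X b" | v where "v < 4" "K = comp X v" "K \<noteq> comp X a" "K \<noteq> comp X b"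
      by (elim insertE DiffE imageE) (simp_all only: insert_iff empty_iff atLeastLessThan_iff de_Morgan_disj simp_thms, blast)
    then show "K \<in> comp (insert {a, b} X) ` {0..<4}"
    proof cases
      case 1
      then have "K = comp (insert {a, b} X) a" using c'[OF ab(1)] refl by simp
      then show ?thesis using ab by auto
    next
      case 2
      then have "K = comp (insert {a, b} X) v" using c'[of v] comp_eq ab by auto
      then show ?thesis using 2 by auto
    qed
  qed
  moreover have "comp X a \<union> comp X b \<notin> ?C"
  proof
    assume "comp X a \<union> comp X b \<in> ?C"
    then obtain v where v: "v < 4" "comp X a \<union> comp X b = comp X v" by auto
    have "a \<in> comp X a" "b \<in> comp X b" using ab by (auto simp: comp_def)
    then have "?r v a" "?r v b" using v by (auto simp: comp_def)
    then show False using n sym trans by blast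
  qed
  moreover have "comp X a \<noteq> comp X b" using comp_eq ab n by blast
  moreover have "{comp X a, comp X b} \<subseteq> ?C" using ab by auto
  moreover have "card {comp X a, comp X b} \<le> card ?C" using calculation(4) by (intro card_mono) auto
  ultimately show ?thesis by (simp add: card_Diff_subset)
qed

text \<open>Adding an edge merges two components exactly when its vector is not yet in the span.\<close>

lemma card_components_plus_rank:
  assumes "finite X" "X \<subseteq> ground MK4"
  shows "card (comp X ` {0..<4}) + vrank (chi ` X) = 4"
  using assms
proof (induction rule: finite_induct)
  case empty
  have "comp {} v = {v}" if "v < 4" for v using that by (auto simp: comp_def adj_def)
  then have "comp {} ` {0..<4} = (\<lambda>v. {v}) ` {0..<4}" by (intro image_cong) auto
  then show ?case by (simp add: card_image)
next
  case (insert e X)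
  have "e \<in> ground MK4" using insert by blast
  then obtain a b where ab: "e = {a, b}" "a < 4" "b < 4" "a \<noteq> b" by (rule edgeE)
  have X: "X \<subseteq> ground MK4" "insert e X \<subseteq> ground MK4" using insert by auto
  have r: "vrank (chi ` insert e X) = (if chi e \<in> span (chi ` X) then vrank (chi ` X) else Suc (vrank (chi ` X)))"
    using vrank_insert[of "chi ` X" "chi e"] insert by simp
  have iff: "chi e \<in> span (chi ` X) \<longleftrightarrow> (a, b) \<in> (adj X)\<^sup>*"
    using connected_iff_span[OF X(1) ab(2,3)] chi_edge[OF ab(4)] ab(1) by simp
  show ?case
  proof (cases "chi e \<in> span (chi ` X)")
    case True
    then have "span (chi ` insert e X) = span (chi ` X)" by (simp add: bv.span_redundant)
    then have "(v, w) \<in> (adj (insert e X))\<^sup>* \<longleftrightarrow> (v, w) \<in> (adj X)\<^sup>*" if "v < 4" "w < 4" for v w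
      using connected_iff_span[OF X(1) that] connected_iff_span[OF X(2) that] by simp
    then have "comp (insert e X) v = comp X v" if "v < 4" for v using that by (auto simp: comp_def)
    then have "comp (insert e X) ` {0..<4} = comp X ` {0..<4}" by (intro image_cong) auto
    then show ?thesis using insert X r True by simp
  next
    case False
    then show ?thesis using card_components_insert[OF ab(2,3), of X] iff insert X r ab(1) by simp
  qed
qed

lemma vrep_MK4: "vrep MK4 chi"
  unfolding vrep_def
proof (intro conjI allI impI)
  show fin: "finite (ground MK4)" unfolding ground_MK4 by simp
  show "inj_on chi (ground MK4)" by (auto simp: inj_on_def chi_eq_iff)
  show "0 \<notin> chi ` ground MK4" unfolding ground_MK4 chi_empty by (auto simp: chi_eq_iff)
  fix X assume X: "X \<subseteq> ground MK4"
  then have "finite X" using fin finite_subset by blast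
  from card_components_plus_rank[OF this X] show "rk MK4 X = vrank (chi ` X)"
    unfolding rk_def MK4_def by (simp add: K4_components_eq)
qed

lemma vrank_3_span:
  assumes "vrank {a, b, c :: bvec} = 2" "a \<noteq> 0" "b \<noteq> 0" "c \<noteq> 0" "a \<noteq> b" "c \<noteq> a" "c \<noteq> b"
  shows "c = a + b"
proof -
  have "vrank (insert c {a, b}) = 2" using assms by (simp add: insert_commute)
  then have "c \<in> span {a, b}"
    using vrank_insert[of "{a, b}" c] vrank_2[of a b] assms by (auto split: if_splits)
  then have "c \<in> span {b} \<or> c + a \<in> span {b}" by (simp only: span_insert)
  then have "c = 0 \<or> c = b \<or> c + a = 0 \<or> c + a = b" by (simp only: span_1) blast
  then show ?thesis using assms by (metis add.commute bvec_add_eq_0_iff bvec_add_eq_iff)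
qed

lemma vrank_3_not_span:
  assumes "vrank {a, b, c :: bvec} = 3" shows "c \<noteq> a + b"
proof
  assume "c = a + b"
  then have "c \<in> span {a, b}" using bv.span_base[of a "{a, b}"] bv.span_base[of b "{a, b}"]
    by (auto intro: span_add)
  then have "vrank (insert c {a, b}) = vrank {a, b}" by (subst vrank_insert) auto
  moreover have "vrank {a, b} \<le> 2" using vrank_le_card[of "{a, b}"] card_insert_le_m1[of 2 "{b}" a] by simp
  moreover have "insert c {a, b} = {a, b, c}" by auto
  ultimately show False using assms by simp
qed

text \<open>Independence of all triples forces \<open>d = a + b + c\<close> in every representation.
  The missing point is \<open>a + b\<close>, with the pairs \<open>{a, b}\<close> and
  \<open>{c, d}\<close>; the third pair \<open>{a + c, b + c}\<close> is absent.\<close>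

lemma bad_U34:
  assumes "vrep U34 \<psi>" shows "bad (\<psi> ` ground U34)"
proof -
  note v = vrepD[OF assms]
  have g: "ground U34 = {0, 1, 2, 3}" by (auto simp: ground_def U34_def)
  define a b c d where "a = \<psi> 0" and "b = \<psi> 1" and "c = \<psi> 2" and "d = \<psi> 3"
  have im: "\<psi> ` ground U34 = {a, b, c, d}" unfolding g a_def b_def c_def d_def by simp
  have r: "vrank (\<psi> ` X) = min (card X) 3" if "X \<subseteq> {0, 1, 2, 3}" for X
    using v(4)[of X] that g by (simp add: rk_def U34_def)
  have nz: "a \<noteq> 0" "b \<noteq> 0" "c \<noteq> 0" "d \<noteq> 0" using v(3) im by auto
  have ne: "a \<noteq> b" "a \<noteq> c" "a \<noteq> d" "b \<noteq> c" "b \<noteq> d" "c \<noteq> d"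
    using v(2) unfolding g a_def b_def c_def d_def by (auto simp: inj_on_def)
  have r3: "vrank {a, b, c} = 3" "vrank {a, b, d} = 3" "vrank {a, c, d} = 3" "vrank {b, c, d} = 3" "vrank {d, a, b, c} = 3"
    using r[of "{0, 1, 2}"] r[of "{0, 1, 3}"] r[of "{0, 2, 3}"] r[of "{1, 2, 3}"] r[of "{3, 0, 1, 2}"]
    unfolding a_def b_def c_def d_def by simp_all
  have n: "c \<noteq> a + b" "d \<noteq> a + b" "d \<noteq> a + c" "d \<noteq> b + c" using r3 vrank_3_not_span by blast+
  have "d \<in> span {a, b, c}" using vrank_insert[of "{a, b, c}" d] r3 by (auto split: if_splits)
  then have "d \<in> span {b, c} \<or> d + a \<in> span {b, c}" by (simp only: span_insert[of d a])
  then have "d \<in> span {c} \<or> d + b \<in> span {c} \<or> d + a \<in> span {c} \<or> d + a + b \<in> span {c}"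
    by (simp only: span_insert[of _ b]) blast
  then have "d = 0 \<or> d = c \<or> d + b = 0 \<or> d + b = c \<or> d + a = 0 \<or> d + a = c \<or> d + a + b = 0 \<or> d + a + b = c"
    by (simp only: span_1) blast
  moreover have "d + b \<noteq> 0" "d + a \<noteq> 0" using ne by auto
  moreover have "d + b \<noteq> c" using n by (metis add.commute bvec_add_eq_iff)
  moreover have "d + a \<noteq> c" using n by (metis add.commute bvec_add_eq_iff)
  moreover have "d + a + b \<noteq> 0" using n by (metis add.assoc bvec_add_eq_0_iff)
  ultimately have "d + a + b = c" using nz ne by metis
  then have d: "d = a + b + c" by (metis add.assoc add.commute bvec_add_self_left)
  have nin: "a + b \<noteq> a" "a + b \<noteq> b" "a + c \<noteq> a" "a + c \<noteq> c" "b + c \<noteq> b" "b + c \<noteq> c" "a + c \<noteq> b" "b + c \<noteq> a" "a + b \<noteq> 0"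
    "a + b \<noteq> d" "a + c \<noteq> d" "b + c \<noteq> d" "a + b \<noteq> c"
    using nz ne n by (auto simp: bvec_add_eq_iff bvec_ac)
  show ?thesis unfolding im
  proof (rule badI[of a _ "a + b" c])
    show "a + (a + b) \<in> {a, b, c, d}" "c + (a + b) \<in> {a, b, c, d}" using d by (simp_all add: bvec_ac)
    show "c \<noteq> a + (a + b)" using ne by simp
    show "(a + c \<in> {a, b, c, d}) = (a + c + (a + b) \<in> {a, b, c, d})"
      using nin ne nz by (simp add: bvec_ac)
  qed (use nin ne in auto)
qed

text \<open>A triangle has rank 2, so every representation makes each of its edges the sum of the
  other two. The missing point is the common sum \<open>?a + ?b + ?c\<close> of the three pairs of
  opposite edges.\<close>

lemma bad_MK4:
  assumes "vrep MK4 \<psi>" shows "bad (\<psi> ` ground MK4)"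
proof -
  note v = vrepD[OF assms]
  define p where "p i j = \<psi> {i, j}" for i j
  have im: "\<psi> ` ground MK4 = {p 0 1, p 0 2, p 0 3, p 1 2, p 1 3, p 2 3}" unfolding ground_MK4 p_def by simp
  have edge: "{i, j} \<in> ground MK4" if "i < 4" "j < 4" "i \<noteq> j" for i j
    using that unfolding ground_def MK4_def by auto
  have nz: "p i j \<noteq> 0" if "i < 4" "j < 4" "i \<noteq> j" for i j using v(3) edge[OF that] unfolding p_def by (metis imageI)
  have inj: "p i j \<noteq> p k l" if "i < 4" "j < 4" "i \<noteq> j" "k < 4" "l < 4" "k \<noteq> l" "{i, j} \<noteq> {k, l}" for i j k l
    using inj_onD[OF v(2)] edge[OF that(1-3)] edge[OF that(4-6)] that(7) unfolding p_def by blast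
  have r: "vrank (\<psi> ` X) = vrank (chi ` X)" if "X \<subseteq> ground MK4" for X
    using v(4)[OF that] vrepD(4)[OF vrep_MK4 that] by simp
  have tri: "p j k = p i j + p i k" if "i < 4" "j < 4" "k < 4" "i \<noteq> j" "j \<noteq> k" "i \<noteq> k" for i j k
  proof -
    have "vrank {chi {i, j}, chi {i, k}, chi {j, k}} = 2"
    proof -
      have "chi {j, k} = chi {i, j} + chi {i, k}" using that by (simp add: chi_edge bvec_ac)
      then have "chi {j, k} \<in> span {chi {i, j}, chi {i, k}}"
        using span_add by (simp add: bv.span_base)
      then have "vrank (insert (chi {j, k}) {chi {i, j}, chi {i, k}}) = vrank {chi {i, j}, chi {i, k}}"
        by (subst vrank_insert) auto
      also have "\<dots> = 2" using that by (subst vrank_2) (auto simp: chi_eq_0_iff chi_eq_iff doubleton_eq_iff)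
      finally show ?thesis by (simp add: insert_commute)
    qed
    then have r2: "vrank {p i j, p i k, p j k} = 2"
      using r[of "{{i, j}, {i, k}, {j, k}}"] edge that unfolding p_def by simp
    show ?thesis using that nz[of i j] nz[of i k] nz[of j k] inj[of i j i k] inj[of j k i j] inj[of j k i k]
      by (intro vrank_3_span[OF r2]) (auto simp: doubleton_eq_iff)
  qed
  have "vrank {chi {0, 1}, chi {0, 2}, chi {0, 3}} = 3"
    by (simp add: vrank_insert span_insert chi_simps del: bv.span_empty)
  then have "vrank {p 0 1, p 0 2, p 0 3} = 3"
    using r[of "{{0, 1}, {0, 2}, {0, 3}}"] edge unfolding p_def by simp
  then have ind: "p 0 3 \<noteq> p 0 1 + p 0 2" by (rule vrank_3_not_span)
  let ?a = "p 0 1" and ?b = "p 0 2" and ?c = "p 0 3"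
  have t: "p 1 2 = ?a + ?b" "p 1 3 = ?a + ?c" "p 2 3 = ?b + ?c" by (rule tri; simp)+
  have nz': "?a \<noteq> 0" "?b \<noteq> 0" "?c \<noteq> 0" by (rule nz; simp)+
  have ne: "?a \<noteq> ?b" "?a \<noteq> ?c" "?b \<noteq> ?c" by (rule inj; simp add: doubleton_eq_iff)+
  have n: "?a + ?b + ?c \<noteq> ?a" "?a + ?b + ?c \<noteq> ?b" "?a + ?b + ?c \<noteq> ?c" "?a + ?b + ?c \<noteq> ?a + ?b" "?a + ?b + ?c \<noteq> ?a + ?c" "?a + ?b + ?c \<noteq> ?b + ?c"
    "?a + ?b + ?c \<noteq> 0" "?b \<noteq> ?b + ?c"
    using nz' ne ind by (auto simp: bvec_add_eq_iff bvec_ac)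
  have eqs: "?a + (?a + ?b + ?c) = ?b + ?c" "?b + (?a + ?b + ?c) = ?a + ?c" "?a + ?b + (?a + ?b + ?c) = ?c"
    by (simp_all add: bvec_ac)
  show ?thesis unfolding im t
    by (rule badI[of ?a _ "?a + ?b + ?c" ?b]; (simp only: eqs)?)
      (use n ne in simp_all)
qed

lemma bad_iso_U34: "vrep M \<phi> \<Longrightarrow> isomorphic M U34 \<Longrightarrow> bad (\<phi> ` ground M)"
  using vrep_isomorphic[OF _ isomorphic_sym] bad_U34 by metis

lemma bad_iso_MK4: "vrep M \<phi> \<Longrightarrow> isomorphic M MK4 \<Longrightarrow> bad (\<phi> ` ground M)"
  using vrep_isomorphic[OF _ isomorphic_sym] bad_MK4 by metis

section \<open>From a bad plane to a flat isomorphic to an excluded matroid\<close>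

interpretation bvp: vector_space_pair "scl :: bit \<Rightarrow> bvec \<Rightarrow> bvec" "scl :: bit \<Rightarrow> bvec \<Rightarrow> bvec" ..

lemma exists_additive_3:
  assumes "n \<noteq> 0" "t \<notin> {0, n}" "s \<notin> span {t, n}"
  shows "\<exists>L. additive L \<and> L s = s' \<and> L t = t' \<and> L n = n'"
proof -
  have "bv.independent {n}" using bv.independent_insertI[of n "{}"] bv.independent_empty assms(1) by auto
  then have "bv.independent {t, n}" using bv.independent_insertI[of t "{n}"] assms(2) by (auto simp: span_1)
  then have i: "bv.independent {s, t, n}" using bv.independent_insertI[of s "{t, n}"] assms(3) by auto
  have "s \<noteq> t" "s \<noteq> n" using assms(3) bv.span_base by blast+
  moreover have "t \<noteq> n" using assms by auto
  moreover obtain g where g: "Vector_Spaces.linear scl scl g" "\<forall>x\<in>{s, t, n}. g x = (if x = s then s' else if x = t then t' else n')"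
    using bvp.linear_independent_extend[OF i, of "\<lambda>x. if x = s then s' else if x = t then t' else n'"] by blast
  moreover have "additive g"
    using g(1) unfolding additive_def by (simp add: Vector_Spaces.linear_iff)
  ultimately show ?thesis by (intro exI[of _ g]) auto
qed

lemma span_3: "span {s, t, n} = {0, s, t, n, s + t, s + n, t + n, s + t + n}"
proof -
  have "x \<in> span {s, t, n} \<longleftrightarrow> x = 0 \<or> x = n \<or> x + t = 0 \<or> x + t = n \<or> x + s = 0 \<or> x + s = n \<or> x + s + t = 0 \<or> x + s + t = n" for x
    by (simp only: span_insert[of _ s] span_insert[of _ t] span_1) blast
  moreover have "x + t = n \<longleftrightarrow> x = t + n" "x + s = n \<longleftrightarrow> x = s + n" "x + s + t = 0 \<longleftrightarrow> x = s + t" "x + s + t = n \<longleftrightarrow> x = s + t + n" for x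
    by (metis add.assoc add.commute bvec_add_self_left bvec_add_eq_0_iff)+
  ultimately show ?thesis by (intro set_eqI) (simp, blast)
qed

text \<open>The flat is the trace of the ground set on the plane spanned by \<open>s\<close>,
  \<open>t\<close>, \<open>n\<close>. These three are independent, so a linear map can carry them to
  the matching points of a standard representation, and it is injective on the plane.\<close>

lemma isomorphic_of_bad:
  assumes M: "vrep M \<phi>" and b: "bad (\<phi> ` ground M)"
  shows "\<exists>F. flat M F \<and> (isomorphic (restrict M F) U34 \<or> isomorphic (restrict M F) MK4)"
proof -
  let ?E = "\<phi> ` ground M"
  obtain s t n where b: "s \<in> ?E" "s + n \<in> ?E" "t \<in> ?E" "t + n \<in> ?E" "n \<notin> ?E" "n \<noteq> 0"
    "t \<noteq> s" "t \<noteq> s + n" "s + t \<in> ?E \<longleftrightarrow> s + t + n \<in> ?E" using b unfolding bad_def by blast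
  have 0: "0 \<notin> ?E" using vrepD(3)[OF M] .
  have nz: "s \<noteq> 0" "t \<noteq> 0" "s + n \<noteq> 0" "t + n \<noteq> 0" using b 0 by metis+
  let ?W = "span {s, t, n}"
  define F where "F = {e \<in> ground M. \<phi> e \<in> ?W}"
  have imF: "\<phi> ` F = ?E \<inter> ?W" unfolding F_def by blast
  have FW: "span (\<phi> ` F) \<subseteq> ?W" using span_subset[OF _ bv.subspace_span] imF by blast
  have fl: "flat M F" unfolding vrep_flat_iff[OF M] using FW unfolding F_def by blast
  have vF: "vrep (restrict M F) \<phi>" using vrep_restrict[OF M] by (simp add: F_def)
  have tn: "t \<notin> {0, n}" using nz by auto
  have sn: "s \<notin> span {t, n}"
  proof
    assume "s \<in> span {t, n}"
    then have "s = 0 \<or> s = n \<or> s + t = 0 \<or> s + t = n" by (simp only: span_insert[of _ t] span_1) blast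
    then show False using nz b by (metis add.commute bvec_add_eq_0_iff bvec_add_eq_iff)
  qed
  have im: "\<phi> ` F = {s, s + n, t, t + n} \<union> (if s + t \<in> ?E then {s + t, s + t + n} else {})"
    unfolding imF span_3 using b 0 by auto
  have iso: "isomorphic (restrict M F) K"
    if K: "vrep K \<psi>" and L: "additive L" "L ` \<phi> ` F = \<psi> ` ground K"
      and c: "L s = chi S" "L t = chi T" "L n = chi N"
        "chi S \<noteq> 0" "chi T \<noteq> 0" "chi N \<noteq> 0" "chi S + chi T \<noteq> 0" "chi S + chi N \<noteq> 0" "chi T + chi N \<noteq> 0" "chi S + chi T + chi N \<noteq> 0"
    for K :: "'b matroid" and \<psi> L S T N
  proof (rule isomorphic_by_additive[OF vF K L(1)])
    show "L ` \<phi> ` ground (restrict M F) = \<psi> ` ground K" using L(2) by simp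
    fix x assume "x \<in> span (\<phi> ` ground (restrict M F))" and Lx: "L x = 0"
    then have "x \<in> ?W" using FW by auto
    then show "x = 0" unfolding span_3
      by (elim insertE emptyE; use Lx in \<open>simp only: additiveD[OF L(1)] c\<close>)
  qed
  show ?thesis
  proof (cases "s + t \<in> ?E")
    case False
    \<comment> \<open>With \<open>n\<close> sent to \<open>chi {0, 1}\<close>, the points
      \<open>s + n\<close> and \<open>t + n\<close> become the second basis vector and the sum of
      all three.\<close>
    obtain L where L: "additive L" "L s = chi {0}" "L t = chi {2}" "L n = chi {0, 1}"
      using exists_additive_3[OF b(6) tn sn] by blast
    have "L ` \<phi> ` F = U34_vec ` ground U34"
    proof -
      have g: "ground U34 = {0, 1, 2, 3}" by (auto simp: ground_def U34_def)
      have "L ` \<phi> ` F = {chi {0}, chi {1}, chi {2}, chi {0, 1, 2}}"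
        unfolding im using False by (simp add: additiveD[OF L(1)] L chi_simps insert_commute)
      also have "\<dots> = U34_vec ` ground U34" unfolding g by (simp add: U34_vec_def)
      finally show ?thesis .
    qed
    from iso[OF vrep_U34 L(1) this L(2-4)] have "isomorphic (restrict M F) U34" by (simp add: chi_simps)
    then show ?thesis using fl by blast
  next
    case True
    \<comment> \<open>Opposite edges sum to the all-ones vector, so this is the place of
      \<open>n\<close>: the points \<open>s + n\<close> and \<open>t + n\<close> become the edges
      \<open>{2, 3}\<close> and \<open>{1, 3}\<close>.\<close>
    obtain L where L: "additive L" "L s = chi {0, 1}" "L t = chi {0, 2}" "L n = chi {0, 1, 2, 3}"
      using exists_additive_3[OF b(6) tn sn] by blast
    have "L ` \<phi> ` F = chi ` ground MK4"
      unfolding im ground_MK4 using True by (simp add: additiveD[OF L(1)] L chi_simps) (auto simp: insert_commute)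
    from iso[OF vrep_MK4 L(1) this L(2-4)] have "isomorphic (restrict M F) MK4" by (simp add: chi_simps)
    then show ?thesis using fl by blast
  qed
qed

lemma bad_free_of_no_minor:
  assumes M: "vrep M \<phi>" and no: "\<not> has_induced_minor M MK4" "\<not> has_induced_minor M U34"
  shows "bad_free (\<phi> ` ground M)"
  unfolding bad_free_def
proof (intro allI impI notI, elim conjE)
  fix f D assume f: "additive f" and D: "D \<subseteq> \<phi> ` ground M" and ker: "\<forall>x. f x = 0 \<longleftrightarrow> x \<in> span D"
    and bad: "bad (f ` \<phi> ` ground M - {0})"
  obtain C where C: "C \<subseteq> ground M" "D = \<phi> ` C" using D by (metis subset_imageE)
  obtain S where S: "simplification_set (contract M C) S" using exists_simplification_set[OF M C(1)] by blast
  let ?N = "restrict (contract M C) S"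
  have N: "vrep ?N (f \<circ> \<phi>)" "(f \<circ> \<phi>) ` ground ?N = f ` \<phi> ` ground M - {0}"
    using vrep_contract[OF M C(1) S f] ker C(2) by simp_all
  obtain F where F: "flat ?N F" "isomorphic (restrict ?N F) U34 \<or> isomorphic (restrict ?N F) MK4"
    using isomorphic_of_bad[OF N(1)] N(2) bad by metis
  have "induced_minor_step M ?N" unfolding induced_minor_step_def using C S by blast
  moreover have "induced_minor_step ?N (restrict ?N F)" unfolding induced_minor_step_def using F by blast
  ultimately have "induced_minor_step\<^sup>*\<^sup>* M (restrict ?N F)" by simp
  then show False using no F(2) unfolding has_induced_minor_def by blast
qed

subsection \<open>Projective geometries and generalized parallel connections\<close>

definition vmat :: "bvec set \<Rightarrow> bvec matroid" where "vmat A = (A, vrank)"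

lemma ground_vmat [simp]: "ground (vmat A) = A" and rk_vmat [simp]: "rk (vmat A) = vrank"
  by (simp_all add: ground_def rk_def vmat_def)

lemma vrep_vmat: "finite A \<Longrightarrow> 0 \<notin> A \<Longrightarrow> vrep (vmat A) (\<lambda>x. x)"
  by (simp add: vrep_def)

lemma isomorphic_vmat: "vrep M \<phi> \<Longrightarrow> isomorphic M (vmat (\<phi> ` ground M))"
  unfolding isomorphic_def by (rule exI[of _ \<phi>]) (simp add: vrepD bij_betw_def)

definition coord :: "nat \<Rightarrow> bvec set" where "coord n = {v. \<forall>i\<ge>n. v i = 0}"

lemma subspace_coord: "subspace (coord n)"
  by (simp add: subspace_iff coord_def)

lemma coord_0: "coord 0 = {0}"
  by (auto simp: coord_def fun_eq_iff)

lemma coord_Suc: "v \<in> coord (Suc n) \<longleftrightarrow> v(n := 0) \<in> coord n"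
  unfolding coord_def by (auto simp: le_Suc_eq)

lemma finite_coord: "finite (coord n)"
proof (induction n)
  case (Suc n)
  have "coord (Suc n) \<subseteq> (\<lambda>(v, b). v(n := b)) ` (coord n \<times> UNIV)"
  proof
    fix v assume "v \<in> coord (Suc n)"
    then have "(v(n := 0), v n) \<in> coord n \<times> UNIV" by (simp add: coord_Suc)
    then show "v \<in> (\<lambda>(v, b). v(n := b)) ` (coord n \<times> UNIV)" by (rule rev_image_eqI) simp
  qed
  moreover have "finite (UNIV :: bit set)"
  proof -
    have "(UNIV :: bit set) = {0, 1}" by (auto intro: bit_not_zero_iff[THEN iffD1])
    then show ?thesis by (metis finite.emptyI finite.insertI)
  qed
  ultimately show ?case using Suc finite_subset by blast
qed (simp add: coord_0)

text \<open>With 1 as the only nonzero scalar, a one-dimensional subspace is \<open>{0, v}\<close>,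
  so points correspond to nonzero vectors.\<close>

lemma PG_isomorphic_vmat: "isomorphic (vmat (coord n - {0})) (PG TYPE(bit) n)"
  unfolding isomorphic_def
proof (intro exI conjI allI impI)
  let ?l = "\<lambda>v. span {v}"
  have "ground (PG TYPE(bit) n) = ?l ` (coord n - {0})"
    unfolding ground_def PG_def coord_def by auto
  moreover have "inj_on ?l (coord n - {0})" by (auto simp: inj_on_def span_1)
  ultimately show "bij_betw ?l (ground (vmat (coord n - {0}))) (ground (PG TYPE(bit) n))"
    by (simp add: bij_betw_def)
  fix X assume "X \<subseteq> ground (vmat (coord n - {0}))"
  have "span (\<Union> (?l ` X)) = span X"
  proof (intro equalityI span_subset bv.subspace_span)
    show "\<Union> (?l ` X) \<subseteq> span X" by (intro UN_least bv.span_mono) simp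
    have "X \<subseteq> \<Union> (?l ` X)" by (auto simp: span_1)
    then show "X \<subseteq> span (\<Union> (?l ` X))" using bv.span_superset by (rule subset_trans)
  qed
  then have "vrank (\<Union> (?l ` X)) = vrank X" by (rule vrank_span_eq)
  then show "rk (PG TYPE(bit) n) (?l ` X) = rk (vmat (coord n - {0})) X"
    by (simp add: rk_def PG_def vmat_def)
qed

text \<open>\<open>PG\<close> lives on initial coordinates, so a finite span needs a coordinate
  system: a generator outside the span reached so far becomes the value on coordinate
  \<open>n\<close>.\<close>

lemma finite_subspace_parametrization:
  assumes "finite A"
  shows "\<exists>n L. additive L \<and> (\<forall>v\<in>coord n. L v = 0 \<longrightarrow> v = 0) \<and> L ` coord n = span A"
  using assms
proof (induction rule: finite_induct)
  case empty
  have "additive (\<lambda>v. v) \<and> (\<forall>v\<in>coord 0. v = 0 \<longrightarrow> v = 0) \<and> (\<lambda>v. v) ` coord 0 = span {}"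
    by (simp add: additive_id coord_0)
  then show ?case by (intro exI)
next
  case (insert a A)
  then obtain n L where L: "additive L" "\<And>v. v \<in> coord n \<Longrightarrow> L v = 0 \<Longrightarrow> v = 0" "L ` coord n = span A" by blast
  show ?case
  proof (cases "a \<in> span A")
    case True
    then have "span (insert a A) = span A" by (rule bv.span_redundant)
    then show ?thesis using L by metis
  next
    case False
    define L' where "L' v = L (v(n := 0)) + (if v n = 0 then 0 else a)" for v
    have "additive L'" unfolding additive_def
    proof (intro allI)
      fix x y :: bvec
      have "(x + y)(n := 0) = x(n := 0) + y(n := 0)" by (auto simp: fun_eq_iff)
      then have 1: "L ((x + y)(n := 0)) = L (x(n := 0)) + L (y(n := 0))" using additiveD[OF L(1)] by metis
      have 2: "(if (x + y) n = 0 then 0 else a) = (if x n = 0 then 0 else a) + (if y n = 0 then 0 else a)"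
        by (cases "x n"; cases "y n") auto
      show "L' (x + y) = L' x + L' y" unfolding L'_def 1 2 by (simp only: add.assoc add.commute add.left_commute)
    qed
    moreover have "v = 0" if v: "v \<in> coord (Suc n)" and z: "L' v = 0" for v
    proof -
      have c: "v(n := 0) \<in> coord n" using v by (simp add: coord_Suc)
      then have s: "L (v(n := 0)) \<in> span A" using L(3) by blast
      have n0: "v n = 0"
      proof (rule ccontr)
        assume "v n \<noteq> 0"
        then have "L (v(n := 0)) = a" using z unfolding L'_def by simp
        then show False using s False by simp
      qed
      then have "L (v(n := 0)) = 0" using z unfolding L'_def by simp
      then have "v(n := 0) = 0" using L(2)[OF c] by simp
      moreover have "v(n := 0) = v" using n0 by (simp add: fun_upd_idem)
      ultimately show "v = 0" by metis
    qed
    moreover have "L' ` coord (Suc n) = span (insert a A)"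
    proof (intro equalityI subsetI)
      fix x assume "x \<in> L' ` coord (Suc n)"
      then obtain v where v: "v \<in> coord (Suc n)" "x = L' v" by blast
      have "L (v(n := 0)) \<in> span A" using v(1) L(3) unfolding coord_Suc by blast
      then have "x \<in> span A \<or> x + a \<in> span A" unfolding v L'_def by (simp add: bvec_ac)
      then show "x \<in> span (insert a A)" by (simp add: span_insert)
    next
      fix x assume "x \<in> span (insert a A)"
      then consider "x \<in> span A" | "x + a \<in> span A" by (auto simp: span_insert)
      then show "x \<in> L' ` coord (Suc n)"
      proof cases
        case 1
        then obtain v where v: "v \<in> coord n" "x = L v" using L(3) by blast
        then have "v n = 0" by (simp add: coord_def)
        then have vv: "v(n := 0) = v" by (simp add: fun_upd_idem)
        have "v \<in> coord (Suc n)" unfolding coord_Suc vv by (rule v(1))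
        moreover have "L' v = x" unfolding L'_def vv using \<open>v n = 0\<close> v(2) by simp
        ultimately show ?thesis by blast
      next
        case 2
        then obtain v where v: "v \<in> coord n" "x + a = L v" using L(3) by blast
        then have "v n = 0" by (simp add: coord_def)
        then have vv: "(v(n := 1))(n := 0) = v" by (simp add: fun_upd_idem)
        have "v(n := 1) \<in> coord (Suc n)" unfolding coord_Suc vv by (rule v(1))
        moreover have "L' (v(n := 1)) = L v + a" unfolding L'_def vv by simp
        moreover have "L v + a = x" unfolding v(2)[symmetric] by (simp add: bvec_ac)
        ultimately show ?thesis by (metis imageI)
      qed
    qed
    ultimately show ?thesis by blast
  qed
qed

lemma is_PG_of_complete:
  assumes M: "vrep M \<phi>" and U: "subspace U" "finite U" "\<phi> ` ground M = U - {0}"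
  shows "is_PG TYPE(bit) M"
proof -
  obtain n L where L: "additive L" "\<And>v. v \<in> coord n \<Longrightarrow> L v = 0 \<Longrightarrow> v = 0" "L ` coord n = U"
    using finite_subspace_parametrization[OF U(2)] unfolding span_subspace[OF U(1)] by blast
  have fin: "finite (coord n - {0})" using finite_coord by simp
  have "isomorphic (vmat (coord n - {0})) M"
  proof (rule isomorphic_by_additive[OF vrep_vmat[OF fin] M L(1)])
    have L0: "L v = 0 \<longleftrightarrow> v = 0" if "v \<in> coord n" for v
    proof
      show "v = 0 \<Longrightarrow> L v = 0" by (simp only: additive_0[OF L(1)])
    qed (rule L(2)[OF that])
    have "L ` (coord n - {0}) = L ` coord n - {0}"
    proof (intro equalityI subsetI)
      fix x assume "x \<in> L ` (coord n - {0})"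
      then obtain v where v: "v \<in> coord n" "v \<noteq> 0" "x = L v" by blast
      have "x \<noteq> 0" unfolding v(3) L0[OF v(1)] by (rule v(2))
      then show "x \<in> L ` coord n - {0}" unfolding v(3) using v(1) by simp
    next
      fix x assume "x \<in> L ` coord n - {0}"
      then obtain v where v: "v \<in> coord n" "x = L v" "x \<noteq> 0" by blast
      then have "v \<noteq> 0" using L0[OF v(1)] by simp
      then show "x \<in> L ` (coord n - {0})" unfolding v(2) using v(1) by simp
    qed
    then show "L ` (\<lambda>x. x) ` ground (vmat (coord n - {0})) = \<phi> ` ground M" using U(3) L(3) by simp
    fix x assume "x \<in> span ((\<lambda>x. x) ` ground (vmat (coord n - {0})))" "L x = 0"
    then show "x = 0" using L(2) by (simp add: span_diff_0 span_subspace[OF subspace_coord])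
  qed simp
  then show ?thesis unfolding is_PG_def
    using isomorphic_trans[OF isomorphic_sym PG_isomorphic_vmat] by blast
qed

lemma vrep_of_is_PG:
  assumes "is_PG TYPE(bit) M"
  shows "\<exists>\<phi> U. vrep M \<phi> \<and> subspace U \<and> finite U \<and> \<phi> ` ground M = U - {0}"
proof -
  obtain n where "isomorphic M (PG TYPE(bit) n)" using assms unfolding is_PG_def by blast
  then have "isomorphic M (vmat (coord n - {0}))" using isomorphic_trans isomorphic_sym[OF PG_isomorphic_vmat] by blast
  moreover have "vrep (vmat (coord n - {0})) (\<lambda>x. x)" using finite_coord by (intro vrep_vmat) auto
  ultimately obtain \<phi> where "vrep M \<phi>" "\<phi> ` ground M = coord n - {0}"
    using vrep_isomorphic[of "vmat (coord n - {0})" "\<lambda>x. x" M] by auto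
  then show ?thesis using subspace_coord finite_coord by blast
qed

text \<open>A vector of one part that is spanned by \<open>F\<close> is \<open>w1 + w2\<close> with
  one summand from each part, and the summand from the other part then lies in
  \<open>X \<inter> Y\<close>. So it is \<open>0\<close> or represents a common element, which
  flatness in the other part puts into \<open>F\<close>; the vector is thus spanned within its own
  part.\<close>

lemma flat_glue_iff:
  assumes P: "vrep P \<phi>" and M1: "vrep M1 \<phi>" and M2: "vrep M2 \<phi>"
    and g: "ground P = ground M1 \<union> ground M2"
    and XY: "subspace X" "subspace Y" "\<phi> ` ground M1 \<subseteq> X" "\<phi> ` ground M2 \<subseteq> Y"
    and U: "X \<inter> Y - {0} \<subseteq> \<phi> ` (ground M1 \<inter> ground M2)"
    and F: "F \<subseteq> ground P"
  shows "flat P F \<longleftrightarrow> flat M1 (F \<inter> ground M1) \<and> flat M2 (F \<inter> ground M2)"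
proof
  assume "flat P F"
  then have cl: "e \<in> F" if "e \<in> ground P" "\<phi> e \<in> span (\<phi> ` F)" for e
    using that unfolding vrep_flat_iff[OF P] by blast
  have mono: "span (\<phi> ` (F \<inter> S)) \<subseteq> span (\<phi> ` F)" for S by (intro bv.span_mono) blast
  show "flat M1 (F \<inter> ground M1) \<and> flat M2 (F \<inter> ground M2)"
    unfolding vrep_flat_iff[OF M1] vrep_flat_iff[OF M2] using cl mono g by blast
next
  assume fl: "flat M1 (F \<inter> ground M1) \<and> flat M2 (F \<inter> ground M2)"
  have half: "e \<in> F"
    if e: "e \<in> G1" "\<phi> e = w1 + w2" "w1 \<in> span (\<phi> ` (F \<inter> G1))" "w2 \<in> span (\<phi> ` (F \<inter> G2))"
      and V: "subspace V1" "subspace V2" "\<phi> ` G1 \<subseteq> V1" "\<phi> ` G2 \<subseteq> V2" "V1 \<inter> V2 - {0} \<subseteq> \<phi> ` (G1 \<inter> G2)"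
      and fl1: "\<And>e. e \<in> G1 \<Longrightarrow> \<phi> e \<in> span (\<phi> ` (F \<inter> G1)) \<Longrightarrow> e \<in> F \<inter> G1"
      and fl2: "\<And>e. e \<in> G2 \<Longrightarrow> \<phi> e \<in> span (\<phi> ` (F \<inter> G2)) \<Longrightarrow> e \<in> F \<inter> G2"
    for e w1 w2 G1 G2 V1 V2
  proof -
    have "span (\<phi> ` (F \<inter> G1)) \<subseteq> V1" "span (\<phi> ` (F \<inter> G2)) \<subseteq> V2" using V(1-4) by (intro span_subset; blast)+
    then have w: "w1 \<in> V1" "w2 \<in> V2" using e by blast+
    moreover have "w1 + w2 \<in> V1" using e(1,2) V(3) by (metis image_subset_iff)
    ultimately have "w2 \<in> V1 \<inter> V2" using subspace_add_iff[OF V(1)] by blast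
    then have "w2 = 0 \<or> w2 \<in> \<phi> ` (G1 \<inter> G2)" using V(5) by blast
    then have "w2 \<in> span (\<phi> ` (F \<inter> G1))"
    proof
      assume "w2 \<in> \<phi> ` (G1 \<inter> G2)"
      then obtain t where t: "t \<in> G1" "t \<in> G2" "w2 = \<phi> t" by blast
      have "t \<in> F \<inter> G2" using fl2[OF t(2)] e(4) unfolding t(3) .
      then have "t \<in> F \<inter> G1" using t(1) by blast
      then show ?thesis unfolding t(3) by (intro bv.span_base imageI)
    qed (simp only: bv.span_zero)
    then have "\<phi> e \<in> span (\<phi> ` (F \<inter> G1))" unfolding e(2) by (rule span_add[OF e(3)])
    from fl1[OF e(1) this] show ?thesis by blast
  qed
  have fl1: "e \<in> F \<inter> ground M1" if "e \<in> ground M1" "\<phi> e \<in> span (\<phi> ` (F \<inter> ground M1))" for e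
    using fl that unfolding vrep_flat_iff[OF M1] by blast
  have fl2: "e \<in> F \<inter> ground M2" if "e \<in> ground M2" "\<phi> e \<in> span (\<phi> ` (F \<inter> ground M2))" for e
    using fl that unfolding vrep_flat_iff[OF M2] by blast
  have U': "Y \<inter> X - {0} \<subseteq> \<phi> ` (ground M2 \<inter> ground M1)" using U by (simp only: Int_commute)
  have "e \<in> F" if e: "e \<in> ground P" "\<phi> e \<in> span (\<phi> ` F)" for e
  proof -
    have "\<phi> ` F = \<phi> ` (F \<inter> ground M1) \<union> \<phi> ` (F \<inter> ground M2)" using F g by blast
    then obtain w1 w2 where w: "w1 \<in> span (\<phi> ` (F \<inter> ground M1))" "w2 \<in> span (\<phi> ` (F \<inter> ground M2))" "\<phi> e = w1 + w2"
      using e(2) bv.span_Un[of "\<phi> ` (F \<inter> ground M1)" "\<phi> ` (F \<inter> ground M2)"] by auto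
    have w': "\<phi> e = w2 + w1" using w(3) by (simp only: add.commute)
    from e(1) consider "e \<in> ground M1" | "e \<in> ground M2" unfolding g by blast
    then show ?thesis
    proof cases
      case 1 show ?thesis by (rule half[OF 1 w(3,1,2) XY U fl1 fl2])
    next
      case 2 show ?thesis by (rule half[OF 2 w' w(2,1) XY(2,1,4,3) U' fl2 fl1])
    qed
  qed
  then show "flat P F" unfolding vrep_flat_iff[OF P] using F by blast
qed

text \<open>Contracting \<open>U\<close> and contracting \<open>U \<inter> A\<close> have the same effect on the span of \<open>A\<close>.\<close>

lemma vrank_modular:
  assumes U: "subspace U" "finite U" and A: "finite A" "U \<inter> span A - {0} \<subseteq> A"
  shows "vrank (U - {0}) + vrank A = vrank ((U - {0}) \<union> A) + vrank ((U - {0}) \<inter> A)"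
proof -
  let ?D = "U - {0}"
  have spD: "span ?D = U" using span_diff_0 span_subspace[OF U(1)] by metis
  obtain f where f: "additive f" "\<And>x. f x = 0 \<longleftrightarrow> x \<in> span ?D"
    using exists_additive_ker[of ?D] U by blast
  obtain g where g: "additive g" "\<And>x. g x = 0 \<longleftrightarrow> x \<in> span (?D \<inter> A)"
    using exists_additive_ker[of "?D \<inter> A"] U by blast
  have eq: "vrank (f ` B) = vrank (g ` B)" if "finite B" "B \<subseteq> A" for B
    using that
  proof (induction rule: finite_induct)
    case (insert b B)
    have "f b \<in> span (f ` B) \<longleftrightarrow> g b \<in> span (g ` B)"
      unfolding mem_span_image_iff[OF f] mem_span_image_iff[OF g]
    proof
      assume "b \<in> span (?D \<inter> A \<union> B)"
      moreover have "span (?D \<inter> A \<union> B) \<subseteq> span (?D \<union> B)" by (intro bv.span_mono) blast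
      ultimately show "b \<in> span (?D \<union> B)" by blast
    next
      assume "b \<in> span (?D \<union> B)"
      then obtain d c where dc: "d \<in> U" "c \<in> span B" "b = d + c" unfolding bv.span_Un spD by blast
      have "c \<in> span A" using dc bv.span_mono[of B A] insert by blast
      moreover have "b \<in> span A" using insert by (intro bv.span_base) blast
      ultimately have "d \<in> span A" using dc(3) subspace_add_iff'[OF bv.subspace_span] by blast
      then have "d = 0 \<or> d \<in> ?D \<inter> A" using A(2) dc(1) by blast
      then have "d \<in> span (?D \<inter> A)" using bv.span_zero bv.span_base by metis
      then show "b \<in> span (?D \<inter> A \<union> B)" unfolding bv.span_Un using dc by blast
    qed
    then show ?case using insert vrank_insert[of "f ` B" "f b"] vrank_insert[of "g ` B" "g b"] by auto
  qed simp
  have "vrank (A \<union> ?D) = vrank (f ` A) + vrank ?D" using vrank_image[OF f A(1)] U by simp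
  moreover have "vrank (A \<union> (?D \<inter> A)) = vrank (g ` A) + vrank (?D \<inter> A)" using vrank_image[OF g A(1)] U by simp
  moreover have "A \<union> (?D \<inter> A) = A" by blast
  ultimately show ?thesis using eq[OF A(1) order_refl] by (simp add: Un_commute)
qed

section \<open>Decomposable sets give members of the class\<close>

definition encode :: "(bvec \<Rightarrow> nat) \<Rightarrow> bvec set \<Rightarrow> nat matroid" where
  "encode h F = (h ` F, \<lambda>X. vrank {v \<in> F. h v \<in> X})"

lemma ground_encode [simp]: "ground (encode h F) = h ` F"
  and rk_encode: "rk (encode h F) X = vrank {v \<in> F. h v \<in> X}"
  by (simp_all add: encode_def ground_def rk_def)

lemma inv_into_image: "inj_on h E \<Longrightarrow> F \<subseteq> E \<Longrightarrow> inv_into E h ` h ` F = F"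
  by (rule inv_into_image_cancel)

lemma vrep_encode:
  assumes h: "inj_on h E" and F: "F \<subseteq> E" "finite F" "0 \<notin> F"
  shows "vrep (encode h F) (inv_into E h)"
  unfolding vrep_def
proof (intro conjI allI impI)
  show "finite (ground (encode h F))" using F by simp
  show "inj_on (inv_into E h) (ground (encode h F))" using F(1) by (auto intro!: inj_on_inv_into)
  show "0 \<notin> inv_into E h ` ground (encode h F)" using F inv_into_image[OF h F(1)] by simp
  fix X assume "X \<subseteq> ground (encode h F)"
  then obtain B where B: "B \<subseteq> F" "X = h ` B" unfolding ground_encode by (rule subset_imageE)
  have BE: "B \<subseteq> E" using B(1) F(1) by (rule subset_trans)
  have "h v \<in> X \<longleftrightarrow> v \<in> B" if "v \<in> F" for v
    unfolding B(2) using inj_on_image_mem_iff[OF h _ BE] that F(1) by blast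
  then have "{v \<in> F. h v \<in> X} = B" using B(1) by blast
  moreover have "inv_into E h ` X = B" unfolding B(2) by (rule inv_into_image[OF h BE])
  ultimately show "rk (encode h F) X = vrank (inv_into E h ` X)" by (simp add: rk_encode)
qed

text \<open>One injective naming \<open>h\<close> serves both parts. Their ground sets then meet
  exactly in the names of \<open>U - {0}\<close>, and the two restrictions are equal as functions,
  as the rule \<open>gpc\<close> demands. Modularity comes from \<open>vrank_modular\<close> and the
  flats from \<open>flat_glue_iff\<close>.\<close>

lemma good_Mq_nat: "good E \<Longrightarrow> inj_on h E \<Longrightarrow> Mq_nat TYPE(bit) (encode h E)"
proof (induction arbitrary: h rule: good.induct)
  case (complete U)
  have "vrep (encode h (U - {0})) (inv_into (U - {0}) h)"
    using complete by (intro vrep_encode) auto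
  moreover have "inv_into (U - {0}) h ` ground (encode h (U - {0})) = U - {0}"
    using inv_into_image[OF complete.prems] by simp
  ultimately show ?case using is_PG_of_complete complete.hyps by (intro Mq_nat.pg) blast
next
  case (glue X Y E)
  have gE: "good E" using glue.hyps by (rule good.glue)
  have fin: "finite E" "0 \<notin> E" using good_finite[OF gE] good_nonzero[OF gE] .
  let ?k = "inv_into E h"
  let ?M1 = "encode h (E \<inter> X)" and ?M2 = "encode h (E \<inter> Y)" and ?P = "encode h E"
  define U where "U = X \<inter> Y"
  have U: "subspace U" unfolding U_def using glue.hyps by (intro bv.subspace_inter)
  have D: "E \<inter> X \<inter> (E \<inter> Y) = U - {0}" using glue.hyps fin unfolding U_def by blast
  have "U \<subseteq> insert 0 E" using D by blast
  then have finU: "finite U" using fin finite_subset by blast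
  have k: "?k ` h ` F = F" if "F \<subseteq> E" for F using inv_into_image[OF glue.prems that] .
  have v: "vrep (encode h F) ?k" if "F \<subseteq> E" for F
    using vrep_encode[OF glue.prems that] fin that finite_subset by blast
  have v1: "vrep ?M1 ?k" and v2: "vrep ?M2 ?k" and vP: "vrep ?P ?k" by (intro v; blast)+
  have T: "h ` (E \<inter> X) \<inter> h ` (E \<inter> Y) = h ` (U - {0})"
    unfolding D[symmetric] by (rule inj_on_image_Int[OF glue.prems, symmetric]) auto
  have UE: "U - {0} \<subseteq> E" "U - {0} \<subseteq> E \<inter> X" "U - {0} \<subseteq> E \<inter> Y" using D by blast+
  let ?T = "h ` (U - {0})"
  have TG: "?T \<subseteq> ground ?M1" "?T \<subseteq> ground ?M2" using UE by auto
  have spU: "span (U - {0}) = U" using span_diff_0 span_subspace[OF U] by metis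
  have kT: "?k ` ?T = U - {0}" using k UE by blast
  have kX: "?k ` ground ?M1 = E \<inter> X" "?k ` ground ?M2 = E \<inter> Y" using k by auto
  show ?case
  proof (rule Mq_nat.gpc[of "TYPE(bit)" ?M1 ?M2])
    show "Mq_nat TYPE(bit) ?M1" "Mq_nat TYPE(bit) ?M2"
      using glue.IH glue.prems inj_on_subset by (metis Int_lower1)+
    have flT: "flat ?M1 ?T" unfolding vrep_flat_iff[OF v1] kT spU
    proof (intro conjI ballI impI TG(1))
      fix e assume e: "e \<in> ground ?M1" "?k e \<in> U"
      then obtain w where w: "w \<in> E \<inter> X" "e = h w" by auto
      then have "?k e = w" using glue.prems by simp
      then have "w \<in> U - {0}" using e(2) w(1) fin by blast
      then show "e \<in> ?T" using w by blast
    qed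
    show "modular_flat ?M1 (ground ?M1 \<inter> ground ?M2)"
      unfolding modular_flat_def ground_encode T
    proof (intro conjI allI impI flT)
      fix G assume G: "flat ?M1 G"
      then have GG: "G \<subseteq> ground ?M1" by (simp add: flat_def)
      then obtain A where A: "A \<subseteq> E \<inter> X" "G = h ` A" unfolding ground_encode by (rule subset_imageE)
      have kG: "?k ` G = A" unfolding A(2) by (rule k) (use A(1) in blast)
      have "U \<inter> span A - {0} \<subseteq> A"
      proof
        fix u assume u: "u \<in> U \<inter> span A - {0}"
        then have uE: "u \<in> E \<inter> X" using UE by blast
        then have "?k (h u) = u" using glue.prems by simp
        then have "h u \<in> G" using G u uE unfolding vrep_flat_iff[OF v1] kG by auto
        then show "u \<in> A" using kG \<open>?k (h u) = u\<close> by force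
      qed
      moreover have "finite A" using A fin finite_subset by blast
      ultimately have m: "vrank (U - {0}) + vrank A = vrank ((U - {0}) \<union> A) + vrank ((U - {0}) \<inter> A)"
        by (intro vrank_modular U finU)
      have "?k ` (?T \<inter> G) = (U - {0}) \<inter> A"
      proof -
        have "?T \<inter> G = h ` ((U - {0}) \<inter> A)" unfolding A(2)
          by (rule inj_on_image_Int[OF glue.prems, symmetric]) (use UE A in auto)
        then show ?thesis using k UE by (metis Int_lower1 subset_trans)
      qed
      moreover have "?k ` (?T \<union> G) = (U - {0}) \<union> A" unfolding image_Un kT kG ..
      ultimately show "rk ?M1 ?T + rk ?M1 G = rk ?M1 (?T \<union> G) + rk ?M1 (?T \<inter> G)"
        using m vrepD(4)[OF v1, of ?T] vrepD(4)[OF v1, of G] vrepD(4)[OF v1, of "?T \<union> G"] vrepD(4)[OF v1, of "?T \<inter> G"]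
          TG GG kT kG by (simp add: le_infI1)
    qed
    have same: "{w \<in> F. h w \<in> Z \<inter> ?T} = {w \<in> U - {0}. h w \<in> Z}" if "U - {0} \<subseteq> F" "F \<subseteq> E" for F Z
      using that UE glue.prems by (auto dest: inj_onD)
    show "restrict ?M1 (ground ?M1 \<inter> ground ?M2) = restrict ?M2 (ground ?M1 \<inter> ground ?M2)"
      unfolding restrict_def ground_encode T rk_encode using same[of "E \<inter> X"] same[of "E \<inter> Y"] UE by simp
    have "vrep (restrict ?M1 ?T) ?k" using vrep_restrict[OF v1 TG(1)] .
    moreover have "?k ` ground (restrict ?M1 ?T) = U - {0}" using kT by simp
    ultimately show "is_PG TYPE(bit) (restrict ?M1 (ground ?M1 \<inter> ground ?M2))"
      unfolding ground_encode T by (rule is_PG_of_complete[OF _ U finU])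
    show "is_gpc ?P ?M1 ?M2" unfolding is_gpc_def
    proof (intro conjI allI impI)
      show "matroid ?P" using vrep_matroid[OF vP] .
      show g: "ground ?P = ground ?M1 \<union> ground ?M2" using glue.hyps by auto
      fix F assume "F \<subseteq> ground ?P"
      moreover have "?k ` ground ?M1 \<subseteq> X" "?k ` ground ?M2 \<subseteq> Y" unfolding kX by blast+
      moreover have "X \<inter> Y - {0} \<subseteq> ?k ` (ground ?M1 \<inter> ground ?M2)"
        unfolding ground_encode T kT by (simp add: U_def)
      ultimately show "flat ?P F \<longleftrightarrow> flat ?M1 (F \<inter> ground ?M1) \<and> flat ?M2 (F \<inter> ground ?M2)"
        by (intro flat_glue_iff[OF vP v1 v2 g glue.hyps(1,2)])
    qed
  qed
qed

lemma good_in_M2: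
  assumes "vrep M \<phi>" "good (\<phi> ` ground M)" shows "in_M2 M"
proof -
  let ?E = "\<phi> ` ground M"
  have fin: "finite ?E" using good_finite[OF assms(2)] .
  then obtain h :: "bvec \<Rightarrow> nat" where h: "inj_on h ?E" using finite_imp_inj_to_nat_seg[OF fin] by metis
  have v: "vrep (encode h ?E) (inv_into ?E h)" by (rule vrep_encode[OF h order_refl fin good_nonzero[OF assms(2)]])
  have "isomorphic (encode h ?E) (vmat ?E)"
    using isomorphic_vmat[OF v] inv_into_image[OF h order_refl] by simp
  then have "isomorphic M (encode h ?E)"
    using isomorphic_trans[OF isomorphic_vmat[OF assms(1)] isomorphic_sym] by blast
  then show ?thesis unfolding in_Mq_def using good_Mq_nat[OF assms(2) h] by blast
qed

section \<open>Members of the class give decomposable sets\<close>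

definition even_part :: "bvec \<Rightarrow> bvec" where "even_part v = (\<lambda>i. if even i then v (i div 2) else 0)"
definition odd_part :: "bvec \<Rightarrow> bvec" where "odd_part v = (\<lambda>i. if odd i then v (i div 2) else 0)"

lemma additive_parts: "additive even_part" "additive odd_part"
  unfolding additive_def even_part_def odd_part_def by (simp_all add: fun_eq_iff)

text \<open>Even and odd coordinates do not interfere, so the single type \<open>bvec\<close>
  contains the direct sum of two copies of itself.\<close>

lemma parts_eq:
  assumes "even_part a + odd_part b = even_part c + odd_part d" shows "a = c" "b = d"
proof -
  have e: "(even_part a + odd_part b) i = (even_part c + odd_part d) i" for i using assms by simp
  have "a i = c i" for i using e[of "2 * i"] by (simp add: even_part_def odd_part_def del: add_bit_eq_xor)
  then show "a = c" by (simp add: fun_eq_iff)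
  have "b i = d i" for i using e[of "2 * i + 1"] by (simp add: even_part_def odd_part_def del: add_bit_eq_xor)
  then show "b = d" by (simp add: fun_eq_iff)
qed

lemma vrep_compose:
  assumes M: "vrep M \<phi>" and f: "additive f" "\<And>x. f x = 0 \<Longrightarrow> x = 0"
  shows "vrep M (f \<circ> \<phi>)"
proof -
  note v = vrepD[OF M]
  have inj: "inj f"
  proof (rule injI)
    fix x y assume "f x = f y"
    then have "x + y = 0" using f(2) additive_eq_iff[OF f(1)] by blast
    then show "x = y" by simp
  qed
  show ?thesis unfolding vrep_def
  proof (intro conjI allI impI)
    show "inj_on (f \<circ> \<phi>) (ground M)" using comp_inj_on[OF v(2)] inj inj_on_subset by blast
    show "0 \<notin> (f \<circ> \<phi>) ` ground M"
    proof
      assume "0 \<in> (f \<circ> \<phi>) ` ground M"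
      then obtain e where "e \<in> ground M" "f (\<phi> e) = 0" by auto
      then have "\<phi> e = 0" "e \<in> ground M" using f(2) by blast+
      then show False using v(3) by (metis imageI)
    qed
    fix X assume X: "X \<subseteq> ground M"
    have "vrank (f ` \<phi> ` X) = vrank (\<phi> ` X)"
      using X v(1) finite_subset f(2) by (intro vrank_inj_image[OF f(1)]) blast+
    then show "rk M X = vrank ((f \<circ> \<phi>) ` X)" using v(4)[OF X] by (simp add: image_comp)
  qed (rule v(1))
qed

lemma vrep_cong: "vrep M \<phi> \<Longrightarrow> (\<And>e. e \<in> ground M \<Longrightarrow> \<phi> e = \<psi> e) \<Longrightarrow> vrep M \<psi>"
  unfolding vrep_def by (metis (no_types, lifting) image_cong inj_on_cong subset_iff)

text \<open>Produces the third point of a line and recognises it by rank alone. The same point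
  therefore works in both parts of a parallel connection, and by \<open>vrep_sum\<close> every
  representation sends it to the sum.\<close>

lemma complete_sum:
  assumes T: "T \<subseteq> ground M" "is_PG TYPE(bit) (restrict M T)" and xy: "x \<in> T" "y \<in> T" "x \<noteq> y"
  shows "\<exists>z\<in>T. z \<noteq> x \<and> z \<noteq> y \<and> rk M {x, y, z} = 2"
proof -
  obtain \<psi> U where \<psi>: "vrep (restrict M T) \<psi>" "subspace U" "\<psi> ` T = U - {0}"
    using vrep_of_is_PG[OF T(2)] by auto
  note v = vrepD[OF \<psi>(1), unfolded ground_restrict]
  have ne: "\<psi> x \<noteq> \<psi> y" using inj_onD[OF v(2)] xy by blast
  have nz: "\<psi> x \<noteq> 0" "\<psi> y \<noteq> 0" using v(3) xy by (metis imageI)+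
  have "\<psi> x + \<psi> y \<in> U - {0}" using subspace_add[OF \<psi>(2)] \<psi>(3) xy ne by auto
  then obtain z where z: "z \<in> T" "\<psi> z = \<psi> x + \<psi> y" using \<psi>(3) by (metis imageE)
  have "\<psi> z \<in> span {\<psi> x, \<psi> y}" unfolding z(2) by (intro span_add bv.span_base) auto
  then have "vrank (insert (\<psi> z) {\<psi> x, \<psi> y}) = 2" using vrank_2[OF nz] ne by (subst vrank_insert) auto
  moreover have "rk (restrict M T) {x, y, z} = vrank (\<psi> ` {x, y, z})" using v(4)[of "{x, y, z}"] xy z by blast
  ultimately have "rk M {x, y, z} = 2" using xy z by (simp add: insert_commute)
  moreover have "z \<noteq> x" "z \<noteq> y" using z(2) nz by (auto simp: bvec_add_eq_iff)
  ultimately show ?thesis using z(1) by blast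
qed

lemma vrep_sum:
  assumes "vrep M \<phi>" "x \<in> ground M" "y \<in> ground M" "z \<in> ground M" "x \<noteq> y" "z \<noteq> x" "z \<noteq> y" "rk M {x, y, z} = 2"
  shows "\<phi> z = \<phi> x + \<phi> y"
proof -
  note v = vrepD[OF assms(1)]
  have "vrank {\<phi> x, \<phi> y, \<phi> z} = 2" using v(4)[of "{x, y, z}"] assms by simp
  moreover have "\<phi> x \<noteq> 0" "\<phi> y \<noteq> 0" "\<phi> z \<noteq> 0" using v(3) assms(2-4) by (metis imageI)+
  moreover have "\<phi> x \<noteq> \<phi> y" "\<phi> z \<noteq> \<phi> x" "\<phi> z \<noteq> \<phi> y" using inj_onD[OF v(2)] assms by blast+
  ultimately show ?thesis by (rule vrank_3_span)
qed

lemma good_injective_image: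
  assumes "good E" "additive f" "\<And>x. f x = 0 \<Longrightarrow> x = 0" shows "good (f ` E)"
proof -
  have "good (f ` E - {0})"
  proof (rule good_image[OF assms(1,2)])
    fix x assume "f x = 0"
    then have "x = 0" by (rule assms(3))
    then show "x \<in> span {e \<in> E. f e = 0}" by (simp only: bv.span_zero)
  qed
  moreover have "0 \<notin> f ` E" using good_nonzero[OF assms(1)] assms(3) by (metis imageE)
  ultimately show ?thesis by simp
qed

text \<open>In the last case the representations of the two parts are placed on even and odd coordinates; dividing
  out the subspace of all sums \<open>even_part (\<phi>1 t) + odd_part (\<phi>2 t)\<close> with \<open>t\<close> in the common geometry
  makes them agree there and nowhere else.\<close>

theorem Mq_nat_good: "Mq_nat TYPE(bit) M \<Longrightarrow> \<exists>\<phi>. vrep M \<phi> \<and> good (\<phi> ` ground M)"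
proof (induction rule: Mq_nat.induct)
  case (pg M)
  then obtain \<phi> U where "vrep M \<phi>" "subspace U" "finite U" "\<phi> ` ground M = U - {0}"
    using vrep_of_is_PG by blast
  then show ?case using good.complete by metis
next
  case (iso M M')
  then show ?case using vrep_isomorphic[OF _ isomorphic_sym] by metis
next
  case (gpc M1 M2 P)
  obtain \<phi>1 where 1: "vrep M1 \<phi>1" "good (\<phi>1 ` ground M1)" using gpc.IH by blast
  obtain \<phi>2 where 2: "vrep M2 \<phi>2" "good (\<phi>2 ` ground M2)" using gpc.IH by blast
  define T where "T = ground M1 \<inter> ground M2"
  have TG: "T \<subseteq> ground M1" "T \<subseteq> ground M2" by (auto simp: T_def)
  have PGT: "is_PG TYPE(bit) (restrict M1 T)" "is_PG TYPE(bit) (restrict M2 T)" using gpc.hyps unfolding T_def by metis+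
  have rkT: "rk M1 X = rk M2 X" if "X \<subseteq> T" for X
  proof -
    have "rk (restrict M1 T) X = rk (restrict M2 T) X" using gpc.hyps unfolding T_def by metis
    then show ?thesis using that by (simp add: Int_absorb2)
  qed
  let ?d = "\<lambda>t. even_part (\<phi>1 t) + odd_part (\<phi>2 t)"
  \<comment> \<open>The graph of the correspondence between the two images of \<open>T\<close>. It
    is a subspace because third points of lines correspond.\<close>
  let ?K = "insert 0 (?d ` T)"
  have addparts: "even_part (x + y) = even_part x + even_part y" "odd_part (x + y) = odd_part x + odd_part y" for x y
    using additiveD[OF additive_parts(1)] additiveD[OF additive_parts(2)] by blast+
  have closed: "?d x + ?d y \<in> ?K" if xy: "x \<in> T" "y \<in> T" for x y
  proof (cases "x = y")
    case True
    then show ?thesis by (simp only: bvec_add_self insertI1)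
  next
    case False
    obtain z where z: "z \<in> T" "z \<noteq> x" "z \<noteq> y" "rk M1 {x, y, z} = 2"
      using complete_sum[OF TG(1) PGT(1) xy False] by blast
    have r2: "rk M2 {x, y, z} = 2" using rkT[of "{x, y, z}"] xy z by simp
    note G1 = subsetD[OF TG(1)] and G2 = subsetD[OF TG(2)]
    have "\<phi>1 z = \<phi>1 x + \<phi>1 y" by (rule vrep_sum[OF 1(1) G1[OF xy(1)] G1[OF xy(2)] G1[OF z(1)] False z(2,3,4)])
    moreover have "\<phi>2 z = \<phi>2 x + \<phi>2 y"
      by (rule vrep_sum[OF 2(1) G2[OF xy(1)] G2[OF xy(2)] G2[OF z(1)] False z(2,3) r2])
    ultimately have eq: "?d z = ?d x + ?d y" by (simp only: addparts bvec_ac)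
    have "?d z \<in> ?K" using z(1) by (intro insertI2 imageI)
    then show ?thesis unfolding eq .
  qed
  have K: "subspace ?K" unfolding subspace_iff
  proof (intro conjI ballI)
    fix x y assume "x \<in> ?K" "y \<in> ?K"
    then show "x + y \<in> ?K" using closed by (elim insertE imageE) (simp_all only: add_0_left add_0_right insertI1 bvec_add_self, blast+)
  qed simp
  have finT: "finite T" using vrepD(1)[OF 1(1)] TG finite_subset by blast
  obtain f where f: "additive f" "\<And>x. f x = 0 \<longleftrightarrow> x \<in> ?K"
    using exists_additive_ker[of ?K] finT unfolding span_subspace[OF K] by blast
  have part0: "even_part 0 = 0" "odd_part 0 = 0" using additive_0 additive_parts by blast+
  have nz1: "\<phi>1 t \<noteq> 0" if "t \<in> T" for t using vrepD(3)[OF 1(1)] subsetD[OF TG(1) that] by (metis imageI)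
  have nz2: "\<phi>2 t \<noteq> 0" if "t \<in> T" for t using vrepD(3)[OF 2(1)] subsetD[OF TG(2) that] by (metis imageI)
  \<comment> \<open>Since both coordinates of a vector of \<open>?K\<close> vanish together,
    \<open>g1\<close> and \<open>g2\<close> will be injective, and their values can agree only at
    \<open>0\<close> and on \<open>T\<close>.\<close>
  have Kdec: "x = 0 \<and> y = 0 \<or> (\<exists>t\<in>T. x = \<phi>1 t \<and> y = \<phi>2 t)" if "even_part x + odd_part y \<in> ?K" for x y
    using that
  proof (elim insertE imageE)
    assume "even_part x + odd_part y = 0"
    then have "even_part x + odd_part y = even_part 0 + odd_part 0" by (simp only: part0 add_0_right)
    then show ?thesis using parts_eq by blast
  next
    fix t assume "even_part x + odd_part y = ?d t" "t \<in> T"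
    then show ?thesis using parts_eq by blast
  qed
  define g1 g2 where "g1 = f \<circ> even_part" and "g2 = f \<circ> odd_part"
  have ga: "additive g1" "additive g2" unfolding g1_def g2_def using additive_comp f(1) additive_parts by blast+
  have g0: "x = 0" if "g1 x = 0" for x
  proof -
    have "f (even_part x) = 0" using that by (simp only: g1_def o_apply)
    then have "even_part x + odd_part 0 \<in> ?K" unfolding part0 add_0_right f(2) .
    from Kdec[OF this] show ?thesis using nz2 by metis
  qed
  have g0': "x = 0" if "g2 x = 0" for x
  proof -
    have "f (odd_part x) = 0" using that by (simp only: g2_def o_apply)
    then have "even_part 0 + odd_part x \<in> ?K" unfolding part0 add_0_left f(2) .
    from Kdec[OF this] show ?thesis using nz1 by metis
  qed
  have geq: "x = 0 \<and> y = 0 \<or> (\<exists>t\<in>T. x = \<phi>1 t \<and> y = \<phi>2 t)" if "g1 x = g2 y" for x y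
  proof (rule Kdec)
    have "f (even_part x) = f (odd_part y)" using that by (simp only: g1_def g2_def o_apply)
    then show "even_part x + odd_part y \<in> ?K" unfolding additive_eq_iff[OF f(1)] f(2) .
  qed
  have gT: "g1 (\<phi>1 t) = g2 (\<phi>2 t)" if "t \<in> T" for t
  proof -
    have "?d t \<in> ?K" using that by (intro insertI2 imageI)
    then have "f (even_part (\<phi>1 t)) = f (odd_part (\<phi>2 t))" unfolding additive_eq_iff[OF f(1)] f(2) .
    then show ?thesis by (simp only: g1_def g2_def o_apply)
  qed
  define \<phi> where "\<phi> e = (if e \<in> ground M1 then g1 (\<phi>1 e) else g2 (\<phi>2 e))" for e
  have \<phi>1: "(g1 \<circ> \<phi>1) e = \<phi> e" if "e \<in> ground M1" for e using that by (simp add: \<phi>_def)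
  have \<phi>2: "(g2 \<circ> \<phi>2) e = \<phi> e" if "e \<in> ground M2" for e using that gT[of e] by (auto simp: \<phi>_def T_def)
  have v1: "vrep M1 \<phi>" using vrep_cong[OF vrep_compose[OF 1(1) ga(1) g0] \<phi>1] .
  have v2: "vrep M2 \<phi>" using vrep_cong[OF vrep_compose[OF 2(1) ga(2) g0'] \<phi>2] .
  have im1: "\<phi> ` ground M1 = g1 ` \<phi>1 ` ground M1" using \<phi>1 by (auto simp: image_iff)
  have im2: "\<phi> ` ground M2 = g2 ` \<phi>2 ` ground M2" using \<phi>2 by (auto simp: image_iff)
  have good12: "good (\<phi> ` ground M1)" "good (\<phi> ` ground M2)"
    unfolding im1 im2 by (rule good_injective_image[OF 1(2) ga(1)], erule g0)
      (rule good_injective_image[OF 2(2) ga(2)], erule g0')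
  define X Y where "X = span (\<phi> ` ground M1)" and "Y = span (\<phi> ` ground M2)"
  have XY: "subspace X" "subspace Y" "\<phi> ` ground M1 \<subseteq> X" "\<phi> ` ground M2 \<subseteq> Y"
    unfolding X_def Y_def by (rule bv.subspace_span bv.span_superset)+
  have U: "X \<inter> Y - {0} \<subseteq> \<phi> ` T"
  proof
    fix w assume w: "w \<in> X \<inter> Y - {0}"
    then obtain x y where xy: "w = g1 x" "w = g2 y" unfolding X_def Y_def im1 im2
      using span_image[OF ga(1)] span_image[OF ga(2)] by blast
    have "g1 x \<noteq> 0" using w unfolding xy(1) by blast
    then have "x \<noteq> 0" using additive_0[OF ga(1)] by metis
    then obtain t where t: "t \<in> T" "x = \<phi>1 t" using geq[of x y] xy by metis
    then have "w = \<phi> t" using \<phi>1[OF subsetD[OF TG(1) t(1)]] xy(1) by simp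
    then show "w \<in> \<phi> ` T" using t(1) by (rule image_eqI)
  qed
  have gP: "ground P = ground M1 \<union> ground M2" and mP: "matroid P"
    and flP: "\<And>F. F \<subseteq> ground P \<Longrightarrow> flat P F \<longleftrightarrow> flat M1 (F \<inter> ground M1) \<and> flat M2 (F \<inter> ground M2)"
    using gpc.hyps unfolding is_gpc_def by blast+
  \<comment> \<open>\<open>P\<close> is given only through its flats. \<open>Q\<close> is the
    matroid that \<phi> represents; it has the same flats by \<open>flat_glue_iff\<close>, hence the
    same ranks.\<close>
  define Q where "Q = (ground P, \<lambda>Z. vrank (\<phi> ` Z))"
  have gQ: "ground Q = ground P" and rkQ: "rk Q Z = vrank (\<phi> ` Z)" for Z by (simp_all add: Q_def ground_def rk_def)
  have cross: "e = e'" if e: "e \<in> ground M1" "e' \<in> ground M2" "\<phi> e = \<phi> e'" for e e'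
  proof -
    have "\<phi> e \<noteq> 0" using vrepD(3)[OF v1] e(1) by (metis imageI)
    moreover have "\<phi> e \<in> X" using subsetD[OF XY(3) imageI[OF e(1)]] .
    moreover have "\<phi> e \<in> Y" unfolding e(3) using subsetD[OF XY(4) imageI[OF e(2)]] .
    ultimately have "\<phi> e \<in> X \<inter> Y - {0}" by simp
    from subsetD[OF U this] obtain t where t: "\<phi> e = \<phi> t" "t \<in> T" by (rule imageE)
    have "e = t" by (rule inj_onD[OF vrepD(2)[OF v1] t(1) e(1) subsetD[OF TG(1) t(2)]])
    moreover have "e' = t" by (rule inj_onD[OF vrepD(2)[OF v2] _ e(2) subsetD[OF TG(2) t(2)]]) (use e t in simp)
    ultimately show ?thesis by simp
  qed
  have inj: "inj_on \<phi> (ground P)"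
  proof (rule inj_onI)
    fix x y assume "x \<in> ground P" "y \<in> ground P" "\<phi> x = \<phi> y"
    then show "x = y" unfolding gP
      using cross[of x y] cross[of y x] inj_onD[OF vrepD(2)[OF v1], of x y] inj_onD[OF vrepD(2)[OF v2], of x y] by (metis UnE)
  qed
  have fin: "finite (ground P)" using mP by (rule matroidD)
  have "0 \<notin> \<phi> ` ground P" using vrepD(3)[OF v1] vrepD(3)[OF v2] unfolding gP by blast
  then have vQ: "vrep Q \<phi>" unfolding vrep_def gQ rkQ using fin inj by blast
  have gQ': "ground Q = ground M1 \<union> ground M2" using gQ gP by simp
  have "rk P Z = rk Q Z" if "Z \<subseteq> ground P" for Z
  proof (rule matroid_eq_by_flats[OF mP vrep_matroid[OF vQ] gQ[symmetric] _ that])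
    fix F assume F: "F \<subseteq> ground P"
    show "flat P F \<longleftrightarrow> flat Q F"
      unfolding flP[OF F] using flat_glue_iff[OF vQ v1 v2 gQ' XY U[unfolded T_def]] F gQ by simp
  qed
  then have "vrep P \<phi>" using vQ unfolding vrep_def gQ rkQ by simp
  moreover have "good (\<phi> ` ground P)"
  proof (rule good.glue[OF XY(1,2)])
    show "\<phi> ` ground P \<subseteq> X \<union> Y" unfolding gP using XY by blast
    show "X \<inter> Y - {0} \<subseteq> \<phi> ` ground P" using U TG gP by blast
    have cut: "(A \<union> B) \<inter> V = A" if "A \<subseteq> V" "B \<subseteq> W" "V \<inter> W - {0} \<subseteq> A" "0 \<notin> B" for A B V W :: "bvec set"
      using that by blast
    have T12: "\<phi> ` T \<subseteq> \<phi> ` ground M1" "\<phi> ` T \<subseteq> \<phi> ` ground M2" using TG by (intro image_mono; simp)+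
    have "\<phi> ` ground P \<inter> X = \<phi> ` ground M1" unfolding gP image_Un
      by (rule cut[OF XY(3,4) subset_trans[OF U T12(1)] vrepD(3)[OF v2]])
    then show "good (\<phi> ` ground P \<inter> X)" using good12 by simp
    have "Y \<inter> X - {0} \<subseteq> \<phi> ` ground M2" using subset_trans[OF U T12(2)] by (simp only: Int_commute)
    then have "\<phi> ` ground P \<inter> Y = \<phi> ` ground M2" unfolding gP image_Un Un_commute[of "\<phi> ` ground M1"]
      by (rule cut[OF XY(4,3) _ vrepD(3)[OF v1]])
    then show "good (\<phi> ` ground P \<inter> Y)" using good12 by simp
  qed
  ultimately show ?case by blast
qed

subsection \<open>Excluded induced minors\<close>

lemma in_M2_good: "in_M2 M \<Longrightarrow> \<exists>\<phi>. vrep M \<phi> \<and> good (\<phi> ` ground M)"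
  unfolding in_Mq_def using Mq_nat_good vrep_isomorphic by metis

lemma in_M2_iff_no_minor:
  assumes "simple M" "binary M"
  shows "in_M2 M \<longleftrightarrow> \<not> has_induced_minor M MK4 \<and> \<not> has_induced_minor M U34"
proof
  assume "in_M2 M"
  then obtain \<phi> where \<phi>: "vrep M \<phi>" "good (\<phi> ` ground M)" using in_M2_good by blast
  have no: False if m: "induced_minor_step\<^sup>*\<^sup>* M N" "isomorphic N MK4 \<or> isomorphic N U34" for N
  proof -
    obtain \<psi> where "vrep N \<psi>" "good (\<psi> ` ground N)" using good_induced_minor[OF m(1) \<phi>] by blast
    then show False using good_not_bad bad_iso_MK4 bad_iso_U34 m(2) by blast
  qed
  then show "\<not> has_induced_minor M MK4 \<and> \<not> has_induced_minor M U34"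
    unfolding has_induced_minor_def by blast
next
  assume no: "\<not> has_induced_minor M MK4 \<and> \<not> has_induced_minor M U34"
  obtain \<phi> where v: "vrep M \<phi>" using simple_binary_vrep[OF assms] by blast
  have "bad_free (\<phi> ` ground M)" using bad_free_of_no_minor[OF v] no by blast
  then have "good (\<phi> ` ground M)" using vrepD(1,3)[OF v] by (intro bad_free_good) auto
  then show "in_M2 M" using good_in_M2[OF v] by blast
qed

text \<open>A flat other than the ground set has smaller rank, and contracting a nonempty set lowers
  the rank because there are no loops; the other steps change nothing. Rank functions are compared
  only on subsets of the ground set, since \<open>restrict\<close> alters values elsewhere.\<close>

lemma induced_minor_step_cases:
  assumes M: "vrep M \<phi>" and step: "induced_minor_step M N"
  shows "\<exists>\<psi>. vrep N \<psi>"
    and "ground N = ground M \<and> (\<forall>X. X \<subseteq> ground M \<longrightarrow> rk N X = rk M X) \<or>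
      ground N \<subset> ground M \<and> rk N (ground N) < rk M (ground M)"
proof -
  note v = vrepD[OF M]
  have "(\<exists>\<psi>. vrep N \<psi>) \<and> (ground N = ground M \<and> (\<forall>X. X \<subseteq> ground M \<longrightarrow> rk N X = rk M X) \<or>
      ground N \<subset> ground M \<and> rk N (ground N) < rk M (ground M))"
    using step unfolding induced_minor_step_def
  proof (elim disjE exE conjE)
    fix F assume F: "flat M F" "N = restrict M F"
    have FG: "F \<subseteq> ground M" using F by (simp add: flat_def)
    show ?thesis
    proof (cases "F = ground M")
      case True
      then show ?thesis using vrep_restrict[OF M] F(2) by (auto simp: Int_absorb2)
    next
      case False
      then obtain e where e: "e \<in> ground M" "e \<notin> F" using FG by blast
      have "rk M F + 1 = rk M (insert e F)" using F(1) e by (simp add: flat_def)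
      also have "\<dots> \<le> rk M (ground M)" using vrep_matroid[OF M] FG e by (intro matroidD(3)) auto
      finally show ?thesis using vrep_restrict[OF M FG] F(2) False FG by auto
    qed
  next
    fix C S assume C: "C \<subseteq> ground M" and S: "simplification_set (contract M C) S" and N: "N = restrict (contract M C) S"
    have finC: "finite (\<phi> ` C)" using C v(1) finite_subset by blast
    obtain f where f: "additive f" "\<And>x. f x = 0 \<longleftrightarrow> x \<in> span (\<phi> ` C)" using exists_additive_ker[OF finC] by blast
    have vN: "vrep N (f \<circ> \<phi>)" and im: "(f \<circ> \<phi>) ` ground N = f ` \<phi> ` ground M - {0}"
      using vrep_contract[OF M C S f] N by simp_all
    have SG: "S \<subseteq> ground M - C" using S unfolding simplification_set_def nonloops_def by auto
    have rk0: "rk M {} = 0" using v(4)[of "{}"] by simp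
    show ?thesis
    proof (cases "C = {}")
      case True
      have rkC: "rk (contract M C) Y = rk M Y" if "Y \<subseteq> ground M" for Y
        using that rk0 by (simp add: rk_contract True Int_absorb2)
      have "e \<in> S" if e: "e \<in> ground M" for e
      proof -
        have sM: "simple M" using vrep_simple[OF M] .
        have "rk (contract M C) {e} = 1" using rkC[of "{e}"] e sM by (simp add: simple_def)
        then have "e \<in> nonloops (contract M C)" using e True by (simp add: nonloops_def)
        then obtain s where s: "s \<in> S" "rk (contract M C) {e, s} = 1"
          using S unfolding simplification_set_def by blast
        have sG: "s \<in> ground M" using s SG by blast
        have "rk M {e, s} = 1" using s(2) rkC[of "{e, s}"] e sG by simp
        then have "e = s" using sM e sG unfolding simple_def by fastforce
        then show ?thesis using s by simp
      qed
      then have "S = ground M" using SG by blast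
      then show ?thesis using vN rkC N by (auto simp: Int_absorb2)
    next
      case False
      then obtain c where c: "c \<in> C" by blast
      have "\<phi> c \<noteq> 0" using v(3) c C by (metis imageI subsetD)
      then have "vrank {\<phi> c} = 1" by simp
      moreover have "vrank {\<phi> c} \<le> vrank (\<phi> ` C)" using c finC by (intro vrank_mono) auto
      ultimately have pos: "0 < vrank (\<phi> ` C)" by simp
      have fin: "finite (\<phi> ` ground M)" using v(1) by simp
      have "rk N (ground N) = vrank (f ` \<phi> ` ground M - {0})" using vrepD(4)[OF vN order_refl] unfolding im .
      also have "\<dots> = vrank (f ` \<phi> ` ground M)" by (rule vrank_span_eq[OF span_diff_0])
      finally have "rk N (ground N) + vrank (\<phi> ` C) = vrank (\<phi> ` ground M \<union> \<phi> ` C)"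
        using vrank_image[OF f fin finC] by simp
      also have "\<phi> ` ground M \<union> \<phi> ` C = \<phi> ` ground M" using C by blast
      also have "vrank \<dots> = rk M (ground M)" using v(4)[OF order_refl] by simp
      finally have "rk N (ground N) < rk M (ground M)" using pos by simp
      moreover have "ground N \<subset> ground M" using SG c C N by auto
      ultimately show ?thesis using vN by blast
    qed
  qed
  then show "\<exists>\<psi>. vrep N \<psi>" "ground N = ground M \<and> (\<forall>X. X \<subseteq> ground M \<longrightarrow> rk N X = rk M X) \<or>
      ground N \<subset> ground M \<and> rk N (ground N) < rk M (ground M)" by blast+
qed

lemma induced_minor_cases:
  assumes "induced_minor_step\<^sup>*\<^sup>* M N" "vrep M \<phi>"
  shows "(\<exists>\<psi>. vrep N \<psi>) \<and> (ground N = ground M \<and> (\<forall>X. X \<subseteq> ground M \<longrightarrow> rk N X = rk M X) \<or>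
      ground N \<subset> ground M \<and> rk N (ground N) < rk M (ground M))"
  using assms(1)
proof (induction rule: rtranclp_induct)
  case base
  show ?case using assms(2) by blast
next
  case (step N K)
  then obtain \<psi> where \<psi>: "vrep N \<psi>" by blast
  note c = induced_minor_step_cases[OF \<psi> step.hyps(2)]
  from step.IH c(2) show ?case using c(1) by auto
qed

lemma isomorphic_rank: "isomorphic M N \<Longrightarrow> rk M (ground M) = rk N (ground N)"
  unfolding isomorphic_def bij_betw_def by force

lemma rank_U34: "rk U34 (ground U34) = 3"
  by (simp add: rk_def ground_def U34_def)

lemma rank_MK4: "rk MK4 (ground MK4) = 3"
proof -
  have "rk MK4 (ground MK4) = vrank (chi ` ground MK4)" using vrepD(4)[OF vrep_MK4 order_refl] .
  also have "\<dots> = 3" unfolding ground_MK4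
    by (simp add: vrank_insert span_insert chi_simps del: bv.span_empty)
  finally show ?thesis .
qed

text \<open>Both excluded matroids have rank 3, while a proper induced minor has smaller rank. It
  therefore contains neither of them and belongs to the class by
  \<open>in_M2_iff_no_minor\<close>.\<close>

lemma forbidden_of_isomorphic:
  assumes N: "isomorphic N MK4 \<or> isomorphic N U34"
  shows "forbidden_induced_minor TYPE(bit) N"
proof -
  have "\<exists>\<phi>. vrep N \<phi>"
    using N vrep_isomorphic[OF vrep_MK4, of N] vrep_isomorphic[OF vrep_U34, of N] by auto
  then obtain \<phi> where v: "vrep N \<phi>" ..
  have rank: "rk L (ground L) = 3" if "isomorphic L MK4 \<or> isomorphic L U34" for L :: "'a matroid"
    using that isomorphic_rank[of L MK4] isomorphic_rank[of L U34] rank_U34 rank_MK4 by auto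
  have r: "rk N (ground N) = 3" using rank[OF N] .
  have "\<not> in_M2 N"
  proof
    assume "in_M2 N"
    then obtain \<psi> where "vrep N \<psi>" "good (\<psi> ` ground N)" using in_M2_good by blast
    then show False using good_not_bad bad_iso_MK4 bad_iso_U34 N by blast
  qed
  moreover have "in_M2 K" if K: "proper_induced_minor N K" for K
  proof -
    have K': "induced_minor_step\<^sup>*\<^sup>* N K" "card (ground K) < card (ground N)"
      using K unfolding proper_induced_minor_def by blast+
    obtain \<psi> where \<psi>: "vrep K \<psi>" using induced_minor_cases[OF K'(1) v] by blast
    have rK: "rk K (ground K) < 3" using induced_minor_cases[OF K'(1) v] K'(2) r by auto
    have no: False if "induced_minor_step\<^sup>*\<^sup>* K L" "isomorphic L MK4 \<or> isomorphic L U34" for L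
    proof -
      have "rk L (ground L) = 3" using rank[OF that(2)] .
      moreover have "rk L (ground L) \<le> rk K (ground K)" using induced_minor_cases[OF that(1) \<psi>] by auto
      ultimately show False using rK by simp
    qed
    then show "in_M2 K" using in_M2_iff_no_minor[OF vrep_simple[OF \<psi>] vrep_binary[OF \<psi>]]
      unfolding has_induced_minor_def by blast
  qed
  ultimately show ?thesis unfolding forbidden_induced_minor_def
    using vrep_simple[OF v] vrep_binary[OF v] by blast
qed

text \<open>The excluded matroid found as a minor \<open>K\<close> is outside the class, so by
  minimality \<open>K\<close> is not proper, and a minor that is not proper agrees with
  \<open>N\<close>.\<close>

lemma isomorphic_of_forbidden:
  assumes "forbidden_induced_minor TYPE(bit) N"
  shows "isomorphic N MK4 \<or> isomorphic N U34"
proof -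
  have N: "simple N" "binary N" "\<not> in_M2 N" and min: "\<And>K. proper_induced_minor N K \<Longrightarrow> in_M2 K"
    using assms unfolding forbidden_induced_minor_def by blast+
  obtain \<phi> where v: "vrep N \<phi>" using simple_binary_vrep[OF N(1,2)] by blast
  obtain K where K: "induced_minor_step\<^sup>*\<^sup>* N K" "isomorphic K MK4 \<or> isomorphic K U34"
    using N(3) in_M2_iff_no_minor[OF N(1,2)] unfolding has_induced_minor_def by blast
  have "\<not> in_M2 K" using forbidden_of_isomorphic[OF K(2)] unfolding forbidden_induced_minor_def by blast
  then have "\<not> card (ground K) < card (ground N)" using min K(1) unfolding proper_induced_minor_def by blast
  then have "\<not> ground K \<subset> ground N" using psubset_card_mono vrepD(1)[OF v] by blast
  then have eq: "ground K = ground N" "\<And>X. X \<subseteq> ground N \<Longrightarrow> rk K X = rk N X"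
    using induced_minor_cases[OF K(1) v] by blast+
  have NK: "isomorphic N K" unfolding isomorphic_def using eq by (intro exI[of _ "\<lambda>x. x"]) (simp add: bij_betw_def)
  show ?thesis using K(2) isomorphic_trans[OF NK, of MK4] isomorphic_trans[OF NK, of U34] by blast
qed

theorem theorem1p3:
  shows "(\<forall>M :: 'a matroid. simple M \<and> binary M \<longrightarrow>
            (in_M2 M \<longleftrightarrow> \<not> has_induced_minor M MK4 \<and> \<not> has_induced_minor M U34))
       \<and> forbidden_induced_minor TYPE(bit) MK4
       \<and> forbidden_induced_minor TYPE(bit) U34
       \<and> (\<forall>N :: 'a matroid. forbidden_induced_minor TYPE(bit) N \<longleftrightarrow>
            (isomorphic N MK4 \<or> isomorphic N U34))"
proof (intro conjI allI impI iffI)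
  show "forbidden_induced_minor TYPE(bit) MK4" "forbidden_induced_minor TYPE(bit) U34"
    by (intro forbidden_of_isomorphic disjI1 isomorphic_refl)
      (intro forbidden_of_isomorphic disjI2 isomorphic_refl)
  show "forbidden_induced_minor TYPE(bit) N \<Longrightarrow> isomorphic N MK4 \<or> isomorphic N U34" for N :: "'a matroid"
    by (rule isomorphic_of_forbidden)
  show "isomorphic N MK4 \<or> isomorphic N U34 \<Longrightarrow> forbidden_induced_minor TYPE(bit) N" for N :: "'a matroid"
    by (rule forbidden_of_isomorphic)
qed (simp_all add: in_M2_iff_no_minor)

end
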